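(* Let $A\in M^+(n,\mathbb{R})$ with trace $\alpha$, and let $\varphi\in C^0(\mathbb{R}^n)\cap C^\infty(\mathbb{R}^n\setminus\{0\})$ be a positive $A$-homogeneous function. Let $w$ be a complex number with $\operatorname{Re}w>0$, let $N$ be a positive integer and let $0<\varepsilon<1$. Then $$\theta(\varphi,iw)=\Gamma(\alpha+1)\,|B_\varphi|\,w^{-\alpha}+\sum_{k=1}^{N}\frac{(-1)^k\zeta(\varphi,-k)}{k!}\,w^k+\frac{1}{2\pi i}\int_{(-N-1+\varepsilon)}\Gamma(s)\,\zeta(\varphi,s)\,w^{-s}\,ds.$$ Moreover, given $0<\delta<\pi/2$, there exists $c>0$ which (for the given $\varphi$) depends only on $N$, $\varepsilon$ and $\delta$ such that, whenever $\operatorname{Re}w>0$ and $|\arg w|\le\pi/2-\delta$, $$\left|\int_{(-N-1+\varepsilon)}\Gamma(s)\,\zeta(\varphi,s)\,w^{-s}\,ds\right|\le c\,|w|^{N+1-\varepsilon}.$$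
   Context: $n$ is a positive integer. $M^+(n,\mathbb{R})$ is the set of real $n\times n$ matrices all of whose eigenvalues $\lambda$ satisfy $\operatorname{Re}\lambda>0$. For $t>0$, $t^A:=e^{(\log t)A}$. A function $\varphi:\mathbb{R}^n\to\mathbb{R}$ is $A$-homogeneous if $\varphi(t^Ax)=t\varphi(x)$ for all $t>0$ and $x\in\mathbb{R}^n$ (so $\varphi(0)=0$). An $A$-homogeneous function with values in $[0,+\infty)$ is positive if $\varphi(x)>0$ for all $x\neq0$. $B_\varphi=\{x\in\mathbb{R}^n:\varphi(x)<1\}$ and $|B_\varphi|$ is its Lebesgue measure. For $\operatorname{Im}\tau>0$, $\theta(\varphi,\tau)=\sum_{\omega\in\mathbb{Z}^n}e^{i\tau\varphi(\omega)}$. The series $\sum_{\omega\in\mathbb{Z}^n\setminus\{0\}}\varphi(\omega)^{-s}$ converges for $\operatorname{Re}s>\alpha$ and extends to a holomorphic function on $\mathbb{C}\setminus\{\alpha\}$ with a simple pole at $\alpha$; $\zeta(\varphi,s)$ denotes this extension. $\Gamma$ is the Euler Gamma function. $\arg$ is the principal argument and powers $w^{-s}$ are taken with the principal branch of the logarithm. For $\sigma\in\mathbb{R}$, $\int_{(\sigma)}f(s)\,ds=\lim_{T\to+\infty}\int_{\sigma-iT}^{\sigma+iT}f(s)\,ds$. *)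

theory Defs
  imports "HOL-Complex_Analysis.Complex_Analysis"
begin

definition matrix_eigenvalue :: "'a::field^'n^'n \<Rightarrow> 'a \<Rightarrow> bool" where
  "matrix_eigenvalue M l \<longleftrightarrow> (\<exists>v. v \<noteq> 0 \<and> M *v v = l *s v)"

text \<open>The set \<open>M\<^sup>+(n,\<real>)\<close>, where \<open>n\<close> is the cardinality of the index type; eigenvalues are
  those of the complexified matrix.\<close>

definition M_plus :: "(real^'n^'n) set" where
  "M_plus = {A. \<forall>l. matrix_eigenvalue (map_matrix complex_of_real A) l \<longrightarrow> Re l > 0}"

text \<open>The type \<open>real^'n^'n\<close> carries componentwise multiplication, so neither its powers nor
  \<open>exp\<close> is the matrix one; the exponential series is formed with the matrix product instead.\<close>

definition matrix_exp :: "real^'n^'n \<Rightarrow> real^'n^'n" where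
  "matrix_exp M = (\<Sum>k. (1 / fact k) *\<^sub>R ((\<lambda>B. M ** B) ^^ k) (mat 1))"

definition matrix_powr :: "real \<Rightarrow> real^'n^'n \<Rightarrow> real^'n^'n" where
  "matrix_powr t A = matrix_exp (ln t *\<^sub>R A)"

definition homogeneous :: "real^'n^'n \<Rightarrow> (real^'n \<Rightarrow> real) \<Rightarrow> bool" where
  "homogeneous A \<phi> \<longleftrightarrow> (\<forall>t>0. \<forall>x. \<phi> (matrix_powr t A *v x) = t * \<phi> x)"

definition positive_homogeneous :: "real^'n^'n \<Rightarrow> (real^'n \<Rightarrow> real) \<Rightarrow> bool" where
  "positive_homogeneous A \<phi> \<longleftrightarrow>
     homogeneous A \<phi> \<and> (\<forall>x. \<phi> x \<ge> 0) \<and> (\<forall>x. x \<noteq> 0 \<longrightarrow> \<phi> x > 0)"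

text \<open>For open \<open>S\<close>, \<open>Ck_on k S f\<close> says that \<open>f\<close> is of class \<open>C\<^sup>k\<close> on \<open>S\<close>.\<close>

primrec Ck_on :: "nat \<Rightarrow> 'a::real_normed_vector set \<Rightarrow> ('a \<Rightarrow> real) \<Rightarrow> bool" where
  "Ck_on 0 S f \<longleftrightarrow> continuous_on S f"
| "Ck_on (Suc k) S f \<longleftrightarrow>
     (\<forall>x\<in>S. f differentiable (at x)) \<and>
     (\<forall>v. Ck_on k S (\<lambda>x. frechet_derivative f (at x) v))"

definition Cinf_on :: "'a::real_normed_vector set \<Rightarrow> ('a \<Rightarrow> real) \<Rightarrow> bool" where
  "Cinf_on S f \<longleftrightarrow> (\<forall>k. Ck_on k S f)"

definition unit_sublevel :: "(real^'n \<Rightarrow> real) \<Rightarrow> (real^'n) set" where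
  "unit_sublevel \<phi> = {x. \<phi> x < 1}"

definition int_lattice :: "(real^'n) set" where
  "int_lattice = {x. \<forall>i. x $ i \<in> \<int>}"

definition theta_term :: "(real^'n \<Rightarrow> real) \<Rightarrow> complex \<Rightarrow> real^'n \<Rightarrow> complex" where
  "theta_term \<phi> \<tau> x = exp (\<i> * \<tau> * complex_of_real (\<phi> x))"

definition theta :: "(real^'n \<Rightarrow> real) \<Rightarrow> complex \<Rightarrow> complex" where
  "theta \<phi> \<tau> = (\<Sum>\<^sub>\<infinity>\<omega>\<in>int_lattice. theta_term \<phi> \<tau> \<omega>)"

text \<open>\<open>Z\<close> is the holomorphic extension to \<open>\<complex> - {\<alpha>}\<close> of the Dirichlet series of \<open>\<phi>\<close>. It is unique on
  that set by the identity theorem; its value at the pole \<open>\<alpha>\<close> is left unspecified.\<close>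

definition is_zeta_extension :: "real \<Rightarrow> (real^'n \<Rightarrow> real) \<Rightarrow> (complex \<Rightarrow> complex) \<Rightarrow> bool" where
  "is_zeta_extension \<alpha> \<phi> Z \<longleftrightarrow>
     Z holomorphic_on (- {complex_of_real \<alpha>}) \<and>
     (\<forall>s. Re s > \<alpha> \<longrightarrow>
        ((\<lambda>\<omega>. complex_of_real (\<phi> \<omega>) powr (- s)) has_sum Z s) (int_lattice - {0}))"

definition zeta :: "real \<Rightarrow> (real^'n \<Rightarrow> real) \<Rightarrow> complex \<Rightarrow> complex" where
  "zeta \<alpha> \<phi> = (SOME Z. is_zeta_extension \<alpha> \<phi> Z)"

definition vline_segment :: "real \<Rightarrow> real \<Rightarrow> real \<Rightarrow> complex" where
  "vline_segment \<sigma> T = linepath (Complex \<sigma> (- T)) (Complex \<sigma> T)"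

definition vline_integral :: "real \<Rightarrow> (complex \<Rightarrow> complex) \<Rightarrow> complex" where
  "vline_integral \<sigma> f = Lim at_top (\<lambda>T. contour_integral (vline_segment \<sigma> T) f)"

text \<open>Existence of the limit defining \<open>vline_integral\<close> (and of the integrals under it), without
  which the values of \<open>Lim\<close> and \<open>contour_integral\<close> are meaningless.\<close>

definition vline_integrable :: "real \<Rightarrow> (complex \<Rightarrow> complex) \<Rightarrow> bool" where
  "vline_integrable \<sigma> f \<longleftrightarrow>
     (\<forall>T>0. f contour_integrable_on vline_segment \<sigma> T) \<and>
     (\<exists>I. ((\<lambda>T. contour_integral (vline_segment \<sigma> T) f) \<longlongrightarrow> I) at_top)"

end

theory Submission
  imports Defs
begin

text \<open>A homogeneous \<open>\<phi>\<close> turns a function of \<open>\<phi>\<close> into its dilates: \<open>h (\<phi> x / T ^ J)\<close> is \<open>h \<circ> \<phi>\<close> composed with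
  the linear map \<open>(1/T)\<^sup>J\<^sup>A\<close>, which contracts like \<open>q ^ J\<close> because \<open>\<phi>\<close> is positive, continuous and
  homogeneous. Summed over translates of the lattice, a smooth compactly supported function of this kind
  gives a periodic function whose high derivatives are tiny; by Rolle's theorem the function itself is then
  nearly constant, so the lattice sum equals the integral up to any power of \<open>T\<^sup>-\<^sup>J\<close>, with a constant that
  is polynomial in \<open>s\<close> for \<open>h u = \<eta> u \<cdot> u\<^sup>-\<^sup>s\<close>. Adding up the shells \<open>T ^ J \<le> \<phi> x < T ^ (J + 1)\<close>, smoothly cut off, continues the zeta function as
  \<open>\<alpha>|B|/(s - \<alpha>)\<close> plus an entire function of polynomial growth on vertical strips, with value \<open>-1\<close> at \<open>0\<close>.
  The exponential decay of \<open>\<Gamma>\<close> on vertical lines then allows summing the Cahen--Mellin integral over the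
  lattice and shifting the contour to the left.\<close>

text \<open>The obstacle is that \<phi> need not be differentiable at 0, so Poisson summation or a
  derivative estimate is not directly available for exp (- w \<phi>). Every function given to the
  lattice estimate is therefore constant near 0, and its derivatives live on a compact shell where
  \<phi> is smooth. The rates balance as follows. At scale T ^ J, taking m derivatives gains (q ^ m)
  ^ J, the lattice points involved cost (Q ^ n) ^ J, and on the strip |Re s| \<le> M the factor T ^
  (- J s) costs (T ^ M) ^ J. The order m is chosen so large that (1/2) ^ J survives; since M is
  arbitrary, the difference of sum and integral converges in the whole plane. The value -1 at 0
  cancels the term \<omega> = 0 of the theta series, which is why the sum in the expansion starts at
  k = 1. The decay exp (- pi |t| / 2) of Gamma meets the growth exp (|arg w| |t|) of w ^ (- s); the
  surplus pi / 2 - |arg w| \<ge> \<delta> makes the final bound uniform in w.\<close>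

no_notation fps_nth (infixl "$" 75)

subsection \<open>The matrix exponential\<close>

abbreviation matpow :: "real^'n^'n \<Rightarrow> nat \<Rightarrow> real^'n^'n" where
  "matpow M k \<equiv> ((\<lambda>B. M ** B) ^^ k) (mat 1)"

lemma matpow_add:
  fixes M :: "real^'n^'n"
  shows "matpow M (i + j) = matpow M i ** matpow M j"
  by (induction i) (simp_all add: matrix_mul_assoc)

lemma matpow_scaleR:
  fixes M :: "real^'n^'n"
  shows "matpow (u *\<^sub>R M) k = u ^ k *\<^sub>R matpow M k"
proof (induction k)
  case (Suc k)
  have "(u *\<^sub>R M) ** (u ^ k *\<^sub>R matpow M k) = (u * u ^ k) *\<^sub>R (M ** matpow M k)"
    by (simp only: scalar_matrix_assoc[symmetric] matrix_scalar_ac scaleR_scaleR mult.commute)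
  then show ?case using Suc by simp
qed simp

text \<open>An entry of the power is a coordinate of its value at a basis vector, so the operator
  norm controls it. This gives absolute convergence of the exponential series entry by
  entry.\<close>

lemma abs_matpow_le:
  fixes M :: "real^'n^'n"
  shows "\<bar>matpow M k $ i $ j\<bar> \<le> onorm ((*v) M) ^ k"
proof -
  have bl: "bounded_linear ((*v) M)" by (rule matrix_vector_mul_bounded_linear)
  have 1: "norm (matpow M k *v x) \<le> onorm ((*v) M) ^ k * norm x" for x
  proof (induction k)
    case (Suc k)
    have "norm (matpow M (Suc k) *v x) = norm (M *v (matpow M k *v x))"
      by (simp add: matrix_vector_mul_assoc)
    also have "\<dots> \<le> onorm ((*v) M) * norm (matpow M k *v x)" by (rule onorm[OF bl])
    also have "\<dots> \<le> onorm ((*v) M) * (onorm ((*v) M) ^ k * norm x)"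
      by (intro mult_left_mono Suc onorm_pos_le[OF bl])
    finally show ?case by simp
  qed simp
  have "matpow M k $ i $ j = (matpow M k *v axis j 1) $ i"
    by (simp add: matrix_vector_mult_basis column_def)
  also have "\<bar>\<dots>\<bar> \<le> norm (matpow M k *v axis j 1)" by (rule component_le_norm_cart)
  also have "\<dots> \<le> onorm ((*v) M) ^ k" using 1[of "axis j 1"] by simp
  finally show ?thesis .
qed

lemma summable_norm_matpow:
  fixes M :: "real^'n^'n"
  shows "summable (\<lambda>k. norm (1 / fact k * matpow M k $ i $ j * u ^ k))"
proof (rule summable_comparison_test')
  show "summable (\<lambda>k. (onorm ((*v) M) * \<bar>u\<bar>) ^ k /\<^sub>R fact k)" by (rule summable_exp_generic)
  show "norm (norm (1 / fact k * matpow M k $ i $ j * u ^ k)) \<le> (onorm ((*v) M) * \<bar>u\<bar>) ^ k /\<^sub>R fact k"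
    if "k \<ge> 0" for k
    using mult_right_mono[OF abs_matpow_le[where M = M and k = k and i = i and j = j], of "\<bar>u\<bar>^k"]
    by (simp add: abs_mult power_abs power_mult_distrib divide_simps)
qed

lemma summable_matpow:
  fixes M :: "real^'n^'n"
  shows "summable (\<lambda>k. (1 / fact k * matpow M k $ i $ j) * u ^ k)"
  using summable_norm_matpow by (rule summable_norm_cancel)

lemma sums_cartI: "(\<And>i. (\<lambda>k. f k $ i) sums (s $ i)) \<Longrightarrow> f sums s"
  unfolding sums_def by (intro vec_tendstoI) (simp add: sum_component)

text \<open>Each entry is an everywhere convergent real power series in \<open>u\<close>, so the
  Cauchy product and termwise differentiation of scalar series become available for the matrix
  exponential.\<close>

lemma matrix_exp_scaleR_nth:
  fixes M :: "real^'n^'n"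
  shows "matrix_exp (u *\<^sub>R M) $ i $ j = (\<Sum>k. (1 / fact k * matpow M k $ i $ j) * u ^ k)"
proof -
  define s :: "real^'n^'n" where "s = (\<chi> i j. (\<Sum>k. (1 / fact k * matpow M k $ i $ j) * u ^ k))"
  have "(\<lambda>k. (1 / fact k) *\<^sub>R matpow (u *\<^sub>R M) k) sums s"
  proof (rule sums_cartI, rule sums_cartI)
    fix i j
    have "(\<lambda>k. (1 / fact k * matpow M k $ i $ j) * u ^ k) sums (s $ i $ j)"
      unfolding s_def by (simp only: vec_lambda_beta) (rule summable_sums[OF summable_matpow])
    then show "(\<lambda>k. ((1 / fact k) *\<^sub>R matpow (u *\<^sub>R M) k) $ i $ j) sums (s $ i $ j)"
      unfolding matpow_scaleR by (simp add: mult_ac)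
  qed
  then have "matrix_exp (u *\<^sub>R M) = s" unfolding matrix_exp_def by (simp add: sums_iff)
  then show ?thesis by (simp add: s_def)
qed

lemma matrix_exp_0: "matrix_exp 0 = (mat 1 :: real^'n^'n)"
proof -
  have "matrix_exp (0 *\<^sub>R (0 :: real^'n^'n)) $ i $ j = (mat 1 :: real^'n^'n) $ i $ j" for i j
    unfolding matrix_exp_scaleR_nth by (subst powser_zero) simp
  then show ?thesis by (simp add: vec_eq_iff)
qed

text \<open>Cauchy product of the entry series, with \<open>l\<close> the middle index of the matrix
  product. Summing over \<open>l\<close> collapses the product of the k-th and (p - k)-th powers
  into the p-th one, and the binomial theorem does the rest.\<close>

lemma matrix_exp_add:
  fixes M :: "real^'n^'n"
  shows "matrix_exp ((u + v) *\<^sub>R M) = matrix_exp (u *\<^sub>R M) ** matrix_exp (v *\<^sub>R M)"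
proof -
  have "(matrix_exp (u *\<^sub>R M) ** matrix_exp (v *\<^sub>R M)) $ i $ j
      = matrix_exp ((u + v) *\<^sub>R M) $ i $ j" for i j
  proof -
    let ?a = "\<lambda>l k. 1 / fact k * matpow M k $ i $ l * u ^ k"
    let ?b = "\<lambda>l k. 1 / fact k * matpow M k $ l $ j * v ^ k"
    have "(\<lambda>p. \<Sum>l\<in>UNIV. \<Sum>k\<le>p. ?a l k * ?b l (p - k)) sums
        (\<Sum>l\<in>UNIV. (\<Sum>k. ?a l k) * (\<Sum>k. ?b l k))"
      by (intro sums_sum Cauchy_product_sums summable_norm_matpow)
    moreover have "(\<Sum>l\<in>UNIV. \<Sum>k\<le>p. ?a l k * ?b l (p - k)) = (1 / fact p * matpow M p $ i $ j) * (u + v) ^ p" for p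
    proof -
      have "(\<Sum>l\<in>UNIV. \<Sum>k\<le>p. ?a l k * ?b l (p - k))
          = (\<Sum>k\<le>p. (1 / fact k * (1 / fact (p - k)) * u ^ k * v ^ (p - k)) *
              (\<Sum>l\<in>UNIV. matpow M k $ i $ l * matpow M (p - k) $ l $ j))"
        by (subst sum.swap) (simp add: sum_distrib_left mult_ac)
      also have "\<dots> = (\<Sum>k\<le>p. (1 / fact k * (1 / fact (p - k)) * u ^ k * v ^ (p - k)) * matpow M p $ i $ j)"
      proof (intro sum.cong refl arg_cong2[where f="(*)"])
        fix k assume "k \<in> {..p}"
        then have "matpow M p = matpow M k ** matpow M (p - k)" using matpow_add[where M = M and i = k and j = "p - k"] by simp
        then show "(\<Sum>l\<in>UNIV. matpow M k $ i $ l * matpow M (p - k) $ l $ j) = matpow M p $ i $ j"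
          by (simp add: matrix_matrix_mult_def)
      qed
      also have "\<dots> = (1 / fact p * matpow M p $ i $ j) * (\<Sum>k\<le>p. of_nat (p choose k) * u ^ k * v ^ (p - k))"
        unfolding sum_distrib_left
        by (intro sum.cong refl) (simp add: binomial_fact)
      finally show ?thesis by (simp add: binomial_ring)
    qed
    ultimately have "(\<lambda>p. (1 / fact p * matpow M p $ i $ j) * (u + v) ^ p) sums
        (\<Sum>l\<in>UNIV. (\<Sum>k. ?a l k) * (\<Sum>k. ?b l k))" by simp
    then have "matrix_exp ((u + v) *\<^sub>R M) $ i $ j = (\<Sum>l\<in>UNIV. (\<Sum>k. ?a l k) * (\<Sum>k. ?b l k))"
      unfolding matrix_exp_scaleR_nth by (simp add: sums_iff)
    then show ?thesis by (simp add: matrix_matrix_mult_def matrix_exp_scaleR_nth)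
  qed
  then show ?thesis by (simp add: vec_eq_iff)
qed

lemma has_real_derivative_matrix_exp_0:
  fixes M :: "real^'n^'n"
  shows "((\<lambda>u. matrix_exp (u *\<^sub>R M) $ i $ j) has_real_derivative M $ i $ j) (at 0)"
proof -
  let ?c = "\<lambda>k. 1 / fact k * matpow M k $ i $ j"
  have "((\<lambda>u. \<Sum>k. ?c k * u ^ k) has_real_derivative (\<Sum>k. diffs ?c k * 0 ^ k)) (at 0)"
    by (intro termdiffs_strong_converges_everywhere summable_matpow)
  moreover have "(\<Sum>k. diffs ?c k * 0 ^ k) = diffs ?c 0" by (rule powser_zero)
  ultimately show ?thesis unfolding matrix_exp_scaleR_nth by (simp add: diffs_def)
qed

text \<open>In the Leibniz formula only the identity permutation contributes: at
  \<open>u = 0\<close> the matrix is the identity, any other permutation moves at least two points,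
  and the product rule removes just one factor.\<close>

lemma has_real_derivative_det_matrix_exp_0:
  fixes M :: "real^'n^'n"
  shows "((\<lambda>u. det (matrix_exp (u *\<^sub>R M))) has_real_derivative trace M) (at 0)"
proof -
  let ?E = "\<lambda>u. matrix_exp (u *\<^sub>R M)"
  have E0: "matrix_exp 0 $ i $ j = (if i = j then 1 else 0)" for i j :: 'n
    by (simp add: matrix_exp_0 mat_def)
  let ?P = "{p. p permutes (UNIV::'n set)}"
  have D: "((\<lambda>u. det (?E u)) has_real_derivative
     (\<Sum>p\<in>?P. of_int (sign p) * (\<Sum>i\<in>UNIV. M $ i $ p i * (\<Prod>k\<in>UNIV - {i}. ?E 0 $ k $ p k)))) (at 0)"
    unfolding det_def
    by (rule DERIV_sum, rule DERIV_cmult, rule has_field_derivative_prod) (rule has_real_derivative_matrix_exp_0)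
  have z: "of_int (sign p) * (\<Sum>i\<in>UNIV. M $ i $ p i * (\<Prod>k\<in>UNIV - {i}. ?E 0 $ k $ p k)) = 0"
    if p: "p \<in> ?P - {id}" for p
  proof -
    obtain a where a: "p a \<noteq> a" using p by (auto simp: fun_eq_iff)
    have inj: "inj p" using p permutes_inj by blast
    \<comment> \<open>Both \<open>a\<close> and \<open>p a\<close> are moved by \<open>p\<close>. At
      most one of them is the removed index \<open>i\<close>, so the other still contributes an
      off-diagonal entry 0.\<close>
    have pz: "(\<Prod>k\<in>UNIV - {i}. ?E 0 $ k $ p k) = 0" for i
    proof (cases "a = i")
      case True
      have "p (p a) \<noteq> p a" using a inj by (auto dest: injD)
      then show ?thesis using True a by (intro prod_zero bexI[of _ "p a"]) (auto simp: E0)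
    next
      case False
      then show ?thesis using a by (intro prod_zero bexI[of _ a]) (auto simp: E0)
    qed
    show ?thesis by (simp only: pz mult_zero_right sum.neutral_const)
  qed
  have "(\<Sum>p\<in>?P. of_int (sign p) * (\<Sum>i\<in>UNIV. M $ i $ p i * (\<Prod>k\<in>UNIV - {i}. ?E 0 $ k $ p k)))
     = (\<Sum>p\<in>{id}. of_int (sign p) * (\<Sum>i\<in>UNIV. M $ i $ p i * (\<Prod>k\<in>UNIV - {i}. ?E 0 $ k $ p k)))"
    using z by (intro sum.mono_neutral_right) (auto simp: permutes_id finite_permutations)
  also have "\<dots> = trace M" by (simp add: E0 trace_def sign_id)
  finally show ?thesis using D by simp
qed

text \<open>The group law carries the derivative at 0 to every point, giving the differential
  equation D' = (trace M) D; multiplying by exp (- u trace M) makes the solution constant.\<close>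

lemma det_matrix_exp:
  fixes M :: "real^'n^'n"
  shows "det (matrix_exp (u *\<^sub>R M)) = exp (u * trace M)"
proof -
  let ?D = "\<lambda>u. det (matrix_exp (u *\<^sub>R M))"
  have "(?D has_real_derivative ?D x * trace M) (at x)" for x
  proof -
    have "((\<lambda>u. ?D x * ?D (u + - x)) has_real_derivative ?D x * trace M) (at x)"
      using DERIV_cmult[of "\<lambda>u. ?D (u + - x)" "trace M" x UNIV "?D x"]
        DERIV_shift[of ?D "trace M" x "- x"] has_real_derivative_det_matrix_exp_0[of M] by simp
    moreover have "?D x * ?D (u + - x) = ?D u" for u
      by (simp add: det_mul[symmetric] matrix_exp_add[symmetric])
    ultimately show ?thesis by simp
  qed
  then have "((\<lambda>u. ?D u * exp (- u * trace M)) has_real_derivative 0) (at x)" for x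
    by (auto intro!: derivative_eq_intros)
  then have "?D u * exp (- u * trace M) = ?D 0 * exp (- 0 * trace M)"
    by (intro DERIV_isconst_all) auto
  then have "?D u * exp (- u * trace M) = 1" by (simp add: matrix_exp_0)
  then show ?thesis by (simp add: exp_minus field_simps)
qed

lemma matrix_powr_mult: "s > 0 \<Longrightarrow> t > 0 \<Longrightarrow> matrix_powr (s * t) M = matrix_powr s M ** matrix_powr t M"
  unfolding matrix_powr_def by (simp add: ln_mult matrix_exp_add)

lemma matrix_powr_1: "matrix_powr 1 M = mat 1"
  unfolding matrix_powr_def by (simp add: matrix_exp_0)

lemma det_matrix_powr: "t > 0 \<Longrightarrow> det (matrix_powr t M) = t powr trace M"
  unfolding matrix_powr_def det_matrix_exp by (simp add: powr_def mult.commute)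

lemma matrix_powr_inverse_vector:
  assumes "t > 0" shows "matrix_powr t M *v (matrix_powr (1 / t) M *v x) = x"
proof -
  have "matrix_powr t M ** matrix_powr (1 / t) M = mat 1"
    using matrix_powr_mult[of t "1/t" M] assms by (simp add: matrix_powr_1)
  then show ?thesis by (simp add: matrix_vector_mul_assoc)
qed

subsection \<open>Dilations\<close>

text \<open>Induction over a factorisation into elementary matrices. A zero row makes the map
  singular and the image negligible, a diagonal matrix is a stretch, and a column swap or a shear
  has determinant of modulus 1, where \<open>unimodular\<close> reduces the claim to boxes.\<close>

lemma lmeasurable_matrix_image:
  fixes M :: "real^'n^'n"
  assumes "S \<in> lmeasurable"
  shows "(*v) M ` S \<in> lmeasurable \<and> measure lebesgue ((*v) M ` S) = \<bar>det M\<bar> * measure lebesgue S"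
proof -
  let ?P = "\<lambda>M::real^'n^'n. \<forall>S\<in>lmeasurable. (*v) M ` S \<in> lmeasurable \<and>
    measure lebesgue ((*v) M ` S) = \<bar>det M\<bar> * measure lebesgue S"
  have unimodular: "?P M" if "\<bar>det M\<bar> = 1"
    "\<And>a b. cbox a b \<noteq> {} \<Longrightarrow> measure lebesgue ((*v) M ` cbox a b) = measure lebesgue (cbox a b)" for M
  proof
    fix S :: "(real^'n) set" assume S: "S \<in> lmeasurable"
    have "measure lebesgue ((*v) M ` cbox a b) = 1 * measure lebesgue (cbox a b)" for a b
      using that(2)[of a b] by (cases "cbox a b = {}") auto
    from measure_linear_sufficient[OF matrix_vector_mul_linear S this]
    show "(*v) M ` S \<in> lmeasurable \<and> measure lebesgue ((*v) M ` S) = \<bar>det M\<bar> * measure lebesgue S"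
      using that(1) by simp
  qed
  have "?P M"
  proof (induction M rule: induct_matrix_elementary_alt)
    case (1 A B)
    have "(*v) (A ** B) ` S = (*v) A ` ((*v) B ` S)" for S
      by (auto simp: matrix_vector_mul_assoc image_iff)
    then show ?case using 1 by (simp add: det_mul abs_mult)
  next
    case (2 M i)
    have d: "det M = 0" using det_zero_row(1)[of i M] 2 by (simp add: row_def vec_eq_iff)
    have "negligible ((*v) M ` S)" for S
    proof (rule negligible_linear_singular_image)
      show "\<not> inj ((*v) M)" using d det_nz_iff_inj[OF matrix_vector_mul_linear, of M] by simp
    qed simp
    then show ?case using d negligible_imp_measurable negligible_imp_measure0 by auto
  next
    case (3 M)
    have "M *v x = (\<chi> i. M $ i $ i * x $ i)" for x
    proof -
      have "(\<Sum>j\<in>UNIV. M $ i $ j * x $ j) = (\<Sum>j\<in>{i}. M $ i $ j * x $ j)" for i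
        using 3[of i] by (intro sum.mono_neutral_right) auto
      then show ?thesis by (simp add: matrix_vector_mult_def vec_eq_iff)
    qed
    then have "(*v) M = (\<lambda>x. \<chi> i. M $ i $ i * x $ i)" by auto
    then show ?case
      using measurable_stretch[of _ "\<lambda>i. M $ i $ i"] measure_stretch[of _ "\<lambda>i. M $ i $ i"] det_diagonal[of M] 3 by simp
  next
    case (4 m n)
    let ?M = "\<chi> i j. (mat 1 :: real^'n^'n) $ i $ Transposition.transpose m n j"
    let ?s = "\<lambda>x::real^'n. \<chi> i. x $ Transposition.transpose m n i"
    have eq: "(*v) ?M = ?s"
    proof
      fix x :: "real^'n"
      have "(\<Sum>j\<in>UNIV. (if i = Transposition.transpose m n j then 1 else 0) * x $ j)
        = (\<Sum>j\<in>UNIV. if j = Transposition.transpose m n i then x $ j else 0)" for i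
        by (intro sum.cong) auto
      then show "?M *v x = ?s x" by (simp add: matrix_vector_mult_def mat_def vec_eq_iff)
    qed
    show ?case
    proof (rule unimodular)
      have p: "Transposition.transpose m n permutes (UNIV::'n set)" by (rule permutes_swap_id) auto
      show "\<bar>det ?M\<bar> = 1" using det_permute_columns[OF p, of "mat 1 :: real^'n^'n"] 4
        by (simp add: sign_swap_id)
      fix a b :: "real^'n" assume ne: "cbox a b \<noteq> {}"
      have "?s ` cbox a b = cbox (?s a) (?s b)"
      proof (intro equalityI subsetI)
        fix y assume "y \<in> cbox (?s a) (?s b)"
        then have y: "a $ Transposition.transpose m n i \<le> y $ i \<and> y $ i \<le> b $ Transposition.transpose m n i" for i
          by (simp add: mem_box_cart)
        have "?s y \<in> cbox a b" using y[of "Transposition.transpose m n _"] by (simp add: mem_box_cart)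
        moreover have "y = ?s (?s y)" by (simp add: vec_eq_iff)
        ultimately show "y \<in> ?s ` cbox a b" by blast
      qed (auto simp: mem_box_cart)
      moreover have "(\<Prod>i\<in>UNIV. b $ Transposition.transpose m n i - a $ Transposition.transpose m n i) = (\<Prod>i\<in>UNIV. b $ i - a $ i)"
        using prod.permute[OF p, of "\<lambda>i. b $ i - a $ i"] by (simp add: o_def)
      moreover have "cbox (?s a) (?s b) \<noteq> {}" using ne calculation(1) by auto
      ultimately show "measure lebesgue ((*v) ?M ` cbox a b) = measure lebesgue (cbox a b)"
        using ne by (simp add: eq content_cbox_cart)
    qed
  next
    case (5 m n)
    let ?M = "(\<chi> i j. of_bool (i = m \<and> j = n \<or> i = j)) :: real^'n^'n"
    let ?s = "\<lambda>x::real^'n. \<chi> i. if i = m then x $ m + x $ n else x $ i"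
    have eq: "(*v) ?M = ?s"
    proof
      fix x :: "real^'n"
      have "(\<Sum>j\<in>UNIV. of_bool (i = m \<and> j = n \<or> i = j) * x $ j)
        = (\<Sum>j\<in>UNIV. (if j = i then x $ j else 0) + (if i = m \<and> j = n then x $ j else 0))" for i
        using 5 by (intro sum.cong) auto
      also have "\<dots> i = ?s x $ i" for i by (auto simp: sum.distrib)
      finally show "?M *v x = ?s x" by (simp add: matrix_vector_mult_def vec_eq_iff)
    qed
    show ?case
    proof (rule unimodular)
      have "?M = (\<chi> k. if k = m then row m (mat 1) + 1 *s row n (mat 1) else row k (mat 1))"
        using 5 by (auto simp: vec_eq_iff row_def mat_def)
      then have "det ?M = det (mat 1 :: real^'n^'n)"
        by (simp only: det_row_operation[OF 5])
      then show "\<bar>det ?M\<bar> = 1" by simp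
      fix a b :: "real^'n" assume ne: "cbox a b \<noteq> {}"
      \<comment> \<open>The volume formula for a sheared box asks for a nonnegative n-th coordinate
        of the lower corner; this translation makes it 0 without changing any volume.\<close>
      let ?v = "axis n (- a $ n) :: real^'n"
      have "cbox a b = (+) (- ?v) ` cbox (?v + a) (?v + b)"
        by (simp only: cbox_translation image_image) simp
      then have "(*v) ?M ` cbox a b = (*v) ?M ` ((+) (- ?v) ` cbox (?v + a) (?v + b))"
        by (rule arg_cong)
      also have "\<dots> = (+) (?M *v (- ?v)) ` ((*v) ?M ` cbox (?v + a) (?v + b))"
        by (simp only: image_image matrix_vector_right_distrib)
      finally have "(*v) ?M ` cbox a b = (+) (?M *v (- ?v)) ` ((*v) ?M ` cbox (?v + a) (?v + b))" .
      then have "measure lebesgue ((*v) ?M ` cbox a b) = measure lebesgue (?s ` cbox (?v + a) (?v + b))"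
        by (simp only: measure_translation) (simp only: eq)
      also have "\<dots> = measure lebesgue (cbox (?v + a) (?v + b))"
      proof (rule measure_shear_interval)
        show "cbox (?v + a) (?v + b) \<noteq> {}" using ne by (simp add: cbox_translation)
      qed (use 5 in auto)
      also have "\<dots> = measure lebesgue (cbox a b)" unfolding cbox_translation by (rule measure_translation)
      finally show "measure lebesgue ((*v) ?M ` cbox a b) = measure lebesgue (cbox a b)" .
    qed
  qed
  then show ?thesis using assms by blast
qed

section \<open>Homogeneous functions and their dilations\<close>

locale pos_homogeneous =
  fixes A :: "real^'n^'n" and \<phi> :: "real^'n \<Rightarrow> real"
  assumes cont: "continuous_on UNIV \<phi>"
    and smooth: "Cinf_on (UNIV - {0}) \<phi>"
    and hom: "positive_homogeneous A \<phi>"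
begin

abbreviation "P t \<equiv> matrix_powr t A"
abbreviation "vol \<equiv> measure lebesgue (unit_sublevel \<phi>)"

lemma phi_dilation [simp]: "t > 0 \<Longrightarrow> \<phi> (P t *v x) = t * \<phi> x"
  using hom by (auto simp: positive_homogeneous_def homogeneous_def)

lemma phi_zero [simp]: "\<phi> 0 = 0"
  using phi_dilation[of 2 0] by simp

lemma phi_nonneg [simp]: "\<phi> x \<ge> 0" and phi_pos: "x \<noteq> 0 \<Longrightarrow> \<phi> x > 0"
  using hom by (auto simp: positive_homogeneous_def)

lemma cont_on: "continuous_on S \<phi>"
  using cont continuous_on_subset by blast

lemma dilation_inverse [simp]:
  assumes "t > 0" shows "P t *v (P (1 / t) *v x) = x" "P (1 / t) *v (P t *v x) = x"
  using matrix_powr_inverse_vector[of t A x] matrix_powr_inverse_vector[of "1 / t" A x] assms by auto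

text \<open>Where \<phi> is larger than its maximum on the unit ball, the norm exceeds 1. For large
  \<open>T\<close> this applies to the image of the whole unit sphere; by compactness the least
  expansion factor \<open>r\<close> is still larger than 1, linearity extends it to all vectors, and
  the inverse dilation contracts by \<open>q = 1 / r\<close>.\<close>

lemma expanding_dilation:
  obtains T q where "T > 1" "0 < q" "q < 1" "\<And>x. norm (P (1 / T) *v x) \<le> q * norm x"
proof -
  have "\<exists>x\<in>cball 0 1. \<forall>y\<in>cball 0 1. \<phi> y \<le> \<phi> x"
    by (rule continuous_attains_sup) (auto intro: cont_on)
  then obtain x where "\<forall>y\<in>cball 0 1. \<phi> y \<le> \<phi> x" by blast
  then have C: "\<phi> y \<le> \<phi> x" if "norm y \<le> 1" for y using that by simp
  have ne: "sphere (0::real^'n) 1 \<noteq> {}" using norm_axis_1 by fastforce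
  have "\<exists>x\<in>sphere 0 1. \<forall>y\<in>sphere 0 1. \<phi> x \<le> \<phi> y"
    by (rule continuous_attains_inf) (use ne in \<open>auto intro: cont_on\<close>)
  then obtain z where z: "norm z = 1" "\<And>y. norm y = 1 \<Longrightarrow> \<phi> z \<le> \<phi> y" by auto
  then have zp: "\<phi> z > 0" by (intro phi_pos) auto
  \<comment> \<open>Here \<open>\<phi> x\<close> is the maximum on the ball and
    \<open>\<phi> z\<close> the minimum on the sphere. The second entry gives
    \<open>T * \<phi> z > \<phi> x\<close>, the 2 gives \<open>T > 1\<close>.\<close>
  define T where "T = max 2 (\<phi> x / \<phi> z + 1)"
  have T: "T > 1" "T * \<phi> z > \<phi> x" using zp by (auto simp: T_def max_def field_simps)
  have gt: "norm (P T *v y) > 1" if "norm y = 1" for y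
  proof (rule ccontr)
    assume "\<not> ?thesis"
    then have "T * \<phi> y \<le> \<phi> x" using C[of "P T *v y"] T by auto
    moreover have "T * \<phi> z \<le> T * \<phi> y" using z(2)[OF that] T by simp
    ultimately show False using T by linarith
  qed
  have "\<exists>x\<in>sphere 0 1. \<forall>y\<in>sphere 0 1. norm (P T *v x) \<le> norm (P T *v y)"
    by (rule continuous_attains_inf) (use ne in \<open>auto intro!: continuous_intros matrix_vector_mult_linear_continuous_on\<close>)
  then obtain y where y: "norm y = 1" "\<And>x. norm x = 1 \<Longrightarrow> norm (P T *v y) \<le> norm (P T *v x)" by auto
  define r where "r = norm (P T *v y)"
  have r: "r > 1" using gt y by (simp add: r_def)
  have exp: "r * norm x \<le> norm (P T *v x)" for x
  proof (cases "x = 0")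
    case False
    have "r \<le> norm (P T *v ((1 / norm x) *\<^sub>R x))" unfolding r_def by (rule y(2)) (use False in simp)
    also have "\<dots> = norm (P T *v x) / norm x"
      using False by (simp add: matrix_vector_mult_scaleR)
    finally show ?thesis using False by (simp add: field_simps)
  qed auto
  have "norm (P (1 / T) *v x) \<le> (1 / r) * norm x" for x
    using exp[of "P (1 / T) *v x"] T r by (simp add: field_simps)
  then show thesis using that[of T "1 / r"] T r by simp
qed


lemma sublevel_image: "t > 0 \<Longrightarrow> (*v) (P t) ` {x. \<phi> x < u} = {x. \<phi> x < t * u}"
proof safe
  fix x assume t: "t > 0" and x: "\<phi> x < t * u"
  have "\<phi> (P (1 / t) *v x) < u" using t x by (simp add: field_simps)
  moreover have "x = P t *v (P (1 / t) *v x)" using t by simp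
  ultimately show "x \<in> (*v) (P t) ` {x. \<phi> x < u}" by blast
qed simp

end

text \<open>Two competing rates for one step of ratio \<open>T\<close>: \<open>q\<close> is what a
  derivative of a dilated function gains, \<open>Q\<close> bounds how fast the sublevel sets grow in
  norm.\<close>

locale dilation = pos_homogeneous A \<phi> for A :: "real^'n^'n" and \<phi> +
  fixes T q Q :: real
  assumes T: "T > 1" and q: "0 < q" "q < 1" and Q: "Q \<ge> 1"
    and contract: "\<And>x. norm (P (1 / T) *v x) \<le> q * norm x"
    and expand: "\<And>x. norm (P T *v x) \<le> Q * norm x"
begin

lemma T_pos [simp]: "T > 0" "T ^ j > 0" "T \<noteq> 0" using T by auto

lemma contract_power: "norm (P (1 / T ^ j) *v x) \<le> q ^ j * norm x"
proof (induction j)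
  case (Suc j)
  have "P (1 / T ^ Suc j) *v x = P (1 / T) *v (P (1 / T ^ j) *v x)"
    using matrix_powr_mult[of "1 / T" "1 / T ^ j" A] by (simp add: matrix_vector_mul_assoc)
  also have "norm \<dots> \<le> q * norm (P (1 / T ^ j) *v x)" by (rule contract)
  also have "\<dots> \<le> q * (q ^ j * norm x)" using Suc q by (intro mult_left_mono) auto
  finally show ?case by (simp add: mult_ac)
qed (simp add: matrix_powr_1)

lemma expand_power: "norm (P (T ^ j) *v x) \<le> Q ^ j * norm x"
proof (induction j)
  case (Suc j)
  have "P (T ^ Suc j) *v x = P T *v (P (T ^ j) *v x)"
    using matrix_powr_mult[of T "T ^ j" A] by (simp add: matrix_vector_mul_assoc)
  also have "norm \<dots> \<le> Q * norm (P (T ^ j) *v x)" by (rule expand)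
  also have "\<dots> \<le> Q * (Q ^ j * norm x)" using Suc Q by (intro mult_left_mono) auto
  finally show ?case by (simp add: mult_ac)
qed (simp add: matrix_powr_1)

text \<open>Iterating the contraction moves any point outside the unit ball into the shell
  \<open>1 \<le> norm z \<le> Q\<close>, where \<open>\<phi>\<close> has a positive minimum.\<close>

lemma small_value_norm: "\<exists>c>0. \<forall>y. \<phi> y < c \<longrightarrow> norm y < 1"
proof -
  let ?K = "cball (0::real^'n) Q \<inter> - ball 0 1"
  have K: "compact ?K" by (intro compact_Int_closed) auto
  have "axis undefined 1 \<in> ?K" using Q by (simp add: norm_axis_1)
  then have ne: "?K \<noteq> {}" by blast
  have "\<exists>x\<in>?K. \<forall>y\<in>?K. \<phi> x \<le> \<phi> y"
    by (rule continuous_attains_inf[OF K ne]) (rule cont_on)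
  then obtain z where z: "z \<in> ?K" "\<And>y. y \<in> ?K \<Longrightarrow> \<phi> z \<le> \<phi> y" by auto
  have "norm y < 1" if y: "\<phi> y < \<phi> z" for y
  proof (rule ccontr)
    assume "\<not> norm y < 1"
    then have n: "norm y \<ge> 1" by simp
    have "(\<lambda>j. q ^ j * norm y) \<longlonglongrightarrow> 0"
      using q by (intro tendsto_mult_left_zero LIMSEQ_power_zero) auto
    then have "\<exists>j. q ^ j * norm y < 1"
      by (metis (mono_tags, lifting) eventually_happens' order_tendstoD(2) sequentially_bot zero_less_one)
    then obtain j where "norm (P (1 / T ^ j) *v y) < 1" using contract_power le_less_trans by blast
    then have ex: "\<exists>j. norm (P (1 / T ^ j) *v y) < 1" by blast
    define k where "k = (LEAST j. norm (P (1 / T ^ j) *v y) < 1)"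
    have k: "norm (P (1 / T ^ k) *v y) < 1" unfolding k_def by (rule LeastI_ex[OF ex])
    have "k \<noteq> 0" using k n by (auto simp: matrix_powr_1 intro!: Nat.gr0I)
    then obtain i where i: "k = Suc i" by (cases k) auto
    let ?w = "P (1 / T ^ i) *v y"
    have w1: "norm ?w \<ge> 1" using not_less_Least[of i "\<lambda>j. norm (P (1 / T ^ j) *v y) < 1"] i
      by (simp add: k_def)
    have "?w = P T *v (P (1 / T ^ k) *v y)"
      using matrix_powr_mult[of T "1 / T ^ k" A] i by (simp add: matrix_vector_mul_assoc)
    then have "norm ?w \<le> Q * norm (P (1 / T ^ k) *v y)" using expand by simp
    also have "\<dots> \<le> Q * 1" using k Q by (intro mult_left_mono) auto
    finally have "?w \<in> ?K" using w1 by simp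
    then have "\<phi> z \<le> \<phi> ?w" by (rule z)
    also have "\<dots> \<le> \<phi> y" using T mult_left_mono[of 1 "T ^ i" "\<phi> y"] by (simp add: field_simps)
    finally show False using y by simp
  qed
  moreover have "\<phi> z > 0" by (rule phi_pos) (use z in auto)
  ultimately show ?thesis by blast
qed

text \<open>Dilating down by \<open>T ^ (i + j)\<close>, with \<open>i\<close> depending only on
  \<open>R\<close>, brings the value of \<phi> below the threshold that forces norm less than 1.
  Dilating back costs at most \<open>Q ^ (i + j)\<close>, so \<open>r = Q ^ i\<close> works for all
  \<open>j\<close>.\<close>

lemma sublevel_norm_le: "\<exists>r\<ge>1. \<forall>j x. \<phi> x \<le> R * T ^ j \<longrightarrow> norm x \<le> r * Q ^ j"
proof -
  obtain c where c: "c > 0" "\<And>y. \<phi> y < c \<Longrightarrow> norm y < 1" using small_value_norm by blast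
  obtain i where i: "R / c < T ^ i" using real_arch_pow[OF T] by blast
  have "norm x \<le> Q ^ i * Q ^ j" if "\<phi> x \<le> R * T ^ j" for j x
  proof -
    let ?y = "P (1 / T ^ (i + j)) *v x"
    have "\<phi> x < c * T ^ i * T ^ j"
      using that i c by (intro le_less_trans[OF that] mult_strict_right_mono) (auto simp: field_simps)
    then have "\<phi> ?y < c" by (simp add: field_simps power_add)
    then have "norm ?y < 1" by (rule c)
    have "norm (P (T ^ (i + j)) *v ?y) \<le> Q ^ (i + j) * norm ?y" by (rule expand_power)
    also have "\<dots> \<le> Q ^ (i + j) * 1" using \<open>norm ?y < 1\<close> Q by (intro mult_left_mono) auto
    finally show ?thesis by (simp add: power_add)
  qed
  then show ?thesis using Q by (intro exI[of _ "Q ^ i"]) auto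
qed

section \<open>Volumes of sublevel sets\<close>

lemma bounded_sublevel: "bounded {x. \<phi> x \<le> R}"
proof -
  obtain r where "\<And>j x. \<phi> x \<le> R * T ^ j \<Longrightarrow> norm x \<le> r * Q ^ j" using sublevel_norm_le[of R] by blast
  from this[of _ 0] show ?thesis by (auto simp: bounded_iff)
qed

lemma open_sublevel: "open {x. \<phi> x < u}"
  using cont by (intro open_Collect_less continuous_intros)

lemma closed_sublevel: "closed {x. \<phi> x \<le> u}"
  using cont by (intro closed_Collect_le continuous_intros)

lemma compact_sublevel: "compact {x. \<phi> x \<le> u}"
  using bounded_sublevel closed_sublevel by (simp add: compact_eq_bounded_closed)

lemma lmeasurable_sublevel: "{x. \<phi> x < u} \<in> lmeasurable" "{x. \<phi> x \<le> u} \<in> lmeasurable"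
proof -
  show "{x. \<phi> x < u} \<in> lmeasurable"
    by (rule lmeasurable_open) (auto intro: bounded_subset[OF bounded_sublevel[of u]] open_sublevel)
  show "{x. \<phi> x \<le> u} \<in> lmeasurable" by (rule lmeasurable_compact[OF compact_sublevel])
qed

text \<open>The sublevel set of \<open>u\<close> is the image of the unit one under
  \<open>P u\<close>, whose determinant is \<open>u powr trace A\<close>.\<close>

lemma measure_sublevel:
  assumes "u > 0" shows "measure lebesgue {x. \<phi> x < u} = u powr trace A * vol"
proof -
  have "measure lebesgue ((*v) (P u) ` {x. \<phi> x < 1}) = u powr trace A * vol"
    using lmeasurable_matrix_image[OF lmeasurable_sublevel(1), of "P u" 1] det_matrix_powr[OF assms, of A]
    by (simp add: unit_sublevel_def)
  then show ?thesis using sublevel_image[of u 1] assms by simp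
qed

lemma vol_pos: "vol > 0"
proof -
  have "0 \<in> unit_sublevel \<phi>" by (simp add: unit_sublevel_def)
  then have "\<not> negligible (unit_sublevel \<phi>)"
    unfolding unit_sublevel_def by (intro open_not_negligible open_sublevel) blast
  then show ?thesis using lmeasurable_sublevel(1)[of 1]
    by (simp add: unit_sublevel_def negligible_iff_measure zero_less_measure_iff)
qed

text \<open>The sublevel sets of \<open>1 / T ^ j\<close> lie in balls of radius
  \<open>q ^ j * r\<close>, so their volumes tend to 0. By scaling these volumes are
  \<open>(1 / T ^ j) powr trace A * vol\<close>, which for a trace at most 0 would stay at least
  \<open>vol\<close>.\<close>

lemma trace_pos: "trace A > 0"
proof (rule ccontr)
  assume neg: "\<not> ?thesis"
  obtain r where r: "r \<ge> 1" "\<And>x. \<phi> x \<le> 1 \<Longrightarrow> norm x \<le> r"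
    using sublevel_norm_le[of 1] by (metis mult.right_neutral power_0)
  have le: "vol \<le> (q ^ j * r) ^ CARD('n) * measure lebesgue (ball (0::real^'n) 1 )" for j
  proof -
    have sub: "{x. \<phi> x < 1 / T ^ j} \<subseteq> cball 0 (q ^ j * r)"
    proof
      fix x assume "x \<in> {x. \<phi> x < 1 / T ^ j}"
      then have "norm (P (T ^ j) *v x) \<le> r" by (intro r) (simp add: field_simps)
      then have "q ^ j * norm (P (T ^ j) *v x) \<le> q ^ j * r" using q by (intro mult_left_mono) auto
      with contract_power[of j "P (T ^ j) *v x"] show "x \<in> cball 0 (q ^ j * r)" by simp
    qed
    have "1 \<le> (T ^ j) powr (- trace A)" using neg T by (intro ge_one_powr_ge_zero) auto
    then have "1 \<le> (1 / T ^ j) powr trace A" by (simp add: powr_divide powr_minus_divide)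
    then have "vol \<le> (1 / T ^ j) powr trace A * vol" using vol_pos by simp
    also have "\<dots> = measure lebesgue {x. \<phi> x < 1 / T ^ j}" by (rule measure_sublevel[symmetric]) simp
    also have "\<dots> \<le> measure lebesgue (cball (0::real^'n) (q ^ j * r))"
    proof (rule measure_mono_fmeasurable[OF sub])
      show "{x. \<phi> x < 1 / T ^ j} \<in> sets lebesgue" by (rule fmeasurableD[OF lmeasurable_sublevel(1)])
    qed simp
    also have "\<dots> = measure lebesgue (ball (0::real^'n) (q ^ j * r))" using q r by (simp add: content_cball_conv_ball)
    also have "\<dots> = (q ^ j * r) ^ CARD('n) * measure lebesgue (ball (0::real^'n) 1)"
      using content_ball_conv_unit_ball[of "q ^ j * r" "0::real^'n"] q r by simp
    finally show ?thesis .
  qed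
  have "(\<lambda>j. q ^ j) \<longlonglongrightarrow> 0" using q by (intro LIMSEQ_power_zero) auto
  then have "(\<lambda>j. (q ^ j * r) ^ CARD('n) * measure lebesgue (ball (0::real^'n) 1)) \<longlonglongrightarrow>
     (0 * r) ^ CARD('n) * measure lebesgue (ball (0::real^'n) 1)"
    using q by (intro tendsto_intros) auto
  from LIMSEQ_le_const[OF this] le vol_pos show False by (force simp: zero_power)
qed

text \<open>The upper bound comes from the open sublevel sets of \<open>v > u\<close> as
  \<open>v\<close> decreases to \<open>u\<close>. Together with the open case it shows that level
  sets are null.\<close>

lemma measure_closed_sublevel:
  assumes u: "u > 0" shows "measure lebesgue {x. \<phi> x \<le> u} = u powr trace A * vol"
proof (rule antisym)
  have "((\<lambda>v. v powr trace A * vol) \<longlongrightarrow> u powr trace A * vol) (at_right u)"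
    using u by (intro tendsto_intros) auto
  moreover have "measure lebesgue {x. \<phi> x \<le> u} \<le> v powr trace A * vol" if "v > u" for v
  proof -
    have "measure lebesgue {x. \<phi> x \<le> u} \<le> measure lebesgue {x. \<phi> x < v}"
      using that lmeasurable_sublevel by (intro measure_mono_fmeasurable) auto
    then show ?thesis using measure_sublevel[of v] that u by simp
  qed
  then have "eventually (\<lambda>v. measure lebesgue {x. \<phi> x \<le> u} \<le> v powr trace A * vol) (at_right u)"
    by (auto simp: eventually_at_filter)
  ultimately show "measure lebesgue {x. \<phi> x \<le> u} \<le> u powr trace A * vol"
    by (rule tendsto_lowerbound) simp
  show "u powr trace A * vol \<le> measure lebesgue {x. \<phi> x \<le> u}"
    using lmeasurable_sublevel by (subst measure_sublevel[OF u, symmetric]) (auto intro!: measure_mono_fmeasurable)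
qed


text \<open>The image under \<phi> of Lebesgue measure on a shell has the density
  \<open>trace A * vol * u powr (trace A - 1)\<close>, the derivative of the volume of sublevel
  sets. The two measures \<open>M\<close> and \<open>N\<close> on the line agree because they agree
  on all rays.\<close>

lemma integral_shell:
  fixes k :: "real \<Rightarrow> complex"
  assumes k: "k \<in> borel_measurable borel" and b: "b \<ge> 1"
  shows "(\<integral>x. indicator {1..b} (\<phi> x) *\<^sub>R k (\<phi> x) \<partial>lborel)
    = (\<integral>u. (indicator {1..b} u * (trace A * vol * u powr (trace A - 1))) *\<^sub>R k u \<partial>lborel)"
proof -
  have \<phi>[measurable]: "\<phi> \<in> borel_measurable borel" using cont by (intro borel_measurable_continuous_onI)
  note k[measurable]
  let ?g = "\<lambda>u. trace A * vol * u powr (trace A - 1)"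
  define M where "M = distr (density lborel (\<lambda>x. ennreal (indicator {1..b} (\<phi> x)))) borel \<phi>"
  define N where "N = density lborel (\<lambda>u. ennreal (indicator {1..b} u * ?g u))"
  have em: "emeasure lborel {x. a < \<phi> x \<and> \<phi> x \<le> b} = ennreal ((b powr trace A - a powr trace A) * vol)"
    if "a > 0" "a \<le> b" for a b
  proof -
    have "measure lebesgue {x. a < \<phi> x \<and> \<phi> x \<le> b} = measure lebesgue ({x. \<phi> x \<le> b} - {x. \<phi> x \<le> a})"
      by (rule arg_cong[where f = "measure lebesgue"]) auto
    also have "\<dots> = measure lebesgue {x. \<phi> x \<le> b} - measure lebesgue {x. \<phi> x \<le> a}"
      using that lmeasurable_sublevel by (intro measurable_measure_Diff) (auto intro: fmeasurableD)
    also have "\<dots> = (b powr trace A - a powr trace A) * vol"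
      using that measure_closed_sublevel[of a] measure_closed_sublevel[of b] by (simp add: algebra_simps)
    finally have "measure lebesgue {x. a < \<phi> x \<and> \<phi> x \<le> b} = (b powr trace A - a powr trace A) * vol" .
    moreover have "{x. a < \<phi> x \<and> \<phi> x \<le> b} = {x. \<phi> x \<le> b} - {x. \<phi> x \<le> a}" by auto
    then have "{x. a < \<phi> x \<and> \<phi> x \<le> b} \<in> lmeasurable"
      by (simp only: fmeasurable.Diff[OF lmeasurable_sublevel(2) lmeasurable_sublevel(2)])
    then have "emeasure lebesgue {x. a < \<phi> x \<and> \<phi> x \<le> b} = measure lebesgue {x. a < \<phi> x \<and> \<phi> x \<le> b}"
      by (intro emeasure_eq_measure2)
    moreover have "emeasure lebesgue {x. a < \<phi> x \<and> \<phi> x \<le> b} = emeasure lborel {x. a < \<phi> x \<and> \<phi> x \<le> b}"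
      by (simp add: main_part_sets)
    ultimately show ?thesis by simp
  qed
  \<comment> \<open>The indicator includes the value 1, whereas \<open>em\<close> measures shells
    open at their lower end, so the level set of 1 must be shown to be null.\<close>
  have null: "emeasure lborel {x. \<phi> x = 1} = 0"
  proof -
    have "measure lebesgue {x. \<phi> x = 1} = measure lebesgue ({x. \<phi> x \<le> 1} - {x. \<phi> x < 1})"
      by (rule arg_cong[where f = "measure lebesgue"]) auto
    also have "\<dots> = measure lebesgue {x. \<phi> x \<le> 1} - measure lebesgue {x. \<phi> x < 1}"
      using lmeasurable_sublevel by (intro measurable_measure_Diff) (auto intro: fmeasurableD)
    finally have "measure lebesgue {x. \<phi> x = 1} = 0" 
      using measure_closed_sublevel[of 1] measure_sublevel[of 1] by simp
    moreover have "{x. \<phi> x = 1} = {x. \<phi> x \<le> 1} - {x. \<phi> x < 1}" by auto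
    then have "{x. \<phi> x = 1} \<in> lmeasurable"
      by (simp only: fmeasurable.Diff[OF lmeasurable_sublevel(2) lmeasurable_sublevel(1)])
    then have "emeasure lebesgue {x. \<phi> x = 1} = measure lebesgue {x. \<phi> x = 1}"
      by (intro emeasure_eq_measure2)
    moreover have "emeasure lebesgue {x. \<phi> x = 1} = emeasure lborel {x. \<phi> x = 1}"
      by (simp add: main_part_sets)
    ultimately show ?thesis by simp
  qed
  have "AE x in lborel. \<phi> x \<noteq> 1" using null by (intro AE_I[of _ _ "{x. \<phi> x = 1}"]) auto
  have MN: "M = N"
  proof (rule measure_eqI_lessThan)
    show "sets M = sets borel" "sets N = sets borel" by (simp_all add: M_def N_def)
    fix x :: real
    \<comment> \<open>Moving the end point of the ray into the interval [1, b] changes its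
      intersection with that interval at most by the point 1.\<close>
    define a where "a = max 1 (min x b)"
    have a: "a \<ge> 1" "a \<le> b" using b by (auto simp: a_def)
    have "emeasure M {x<..} = (\<integral>\<^sup>+y. indicator {1..b} (\<phi> y) * indicator {x<..} (\<phi> y) \<partial>lborel)"
      unfolding M_def
      by (subst emeasure_distr, simp, simp, subst emeasure_density)
        (auto intro!: nn_integral_cong measurable_sets_borel[OF \<phi>] simp: indicator_def)
    also have "\<dots> = (\<integral>\<^sup>+y. indicator {x. a < \<phi> x \<and> \<phi> x \<le> b} y \<partial>lborel)"
      using \<open>AE x in lborel. \<phi> x \<noteq> 1\<close>
      by (intro nn_integral_cong_AE) (auto simp: indicator_def a_def max_def min_def split: if_splits)
    also have "\<dots> = ennreal ((b powr trace A - a powr trace A) * vol)"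
      using a by (subst nn_integral_indicator) (auto simp: em)
    finally have 1: "emeasure M {x<..} = ennreal ((b powr trace A - a powr trace A) * vol)" .
    have "emeasure N {x<..} = (\<integral>\<^sup>+u. ennreal (indicator {1..b} u * ?g u) * indicator {x<..} u \<partial>lborel)"
      unfolding N_def by (subst emeasure_density) auto
    also have "\<dots> = (\<integral>\<^sup>+u. ennreal (?g u) * indicator {a..b} u \<partial>lborel)"
      using AE_lborel_singleton[of a]
      by (intro nn_integral_cong_AE) (auto simp: indicator_def a_def max_def min_def split: if_splits)
    also have "\<dots> = ennreal (vol * b powr trace A - vol * a powr trace A)"
    proof (rule nn_integral_FTC_Icc)
      show "?g u \<ge> 0" if "u \<in> {a..b}" for u using trace_pos vol_pos by simp
      show "DERIV (\<lambda>u. vol * u powr trace A) u :> ?g u" if "u \<in> {a..b}" for u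
        using that a by (auto intro!: derivative_eq_intros)
    qed (use a in auto)
    finally have 2: "emeasure N {x<..} = ennreal ((b powr trace A - a powr trace A) * vol)"
      by (simp add: algebra_simps)
    show "emeasure M {x<..} = emeasure N {x<..}" "emeasure M {x<..} < \<infinity>" using 1 2 by auto
  qed
  have "(\<integral>x. indicator {1..b} (\<phi> x) *\<^sub>R k (\<phi> x) \<partial>lborel) = integral\<^sup>L M k"
    unfolding M_def by (subst integral_distr) (auto simp: integral_density)
  also have "\<dots> = (\<integral>u. (indicator {1..b} u * ?g u) *\<^sub>R k u \<partial>lborel)"
    unfolding MN N_def using trace_pos vol_pos by (subst integral_density) (auto simp: indicator_def)
  finally show ?thesis .
qed

end

subsection \<open>Iterated directional derivatives\<close>

lemma Ck_on_cong:
  assumes "open S" "\<And>x. x \<in> S \<Longrightarrow> f x = g x" "Ck_on k S f"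
  shows "Ck_on k S g"
  using assms(2,3)
proof (induction k arbitrary: f g)
  case 0
  from 0(1) have "continuous_on S f \<longleftrightarrow> continuous_on S g" by (intro continuous_on_cong refl)
  with 0(2) show ?case by simp
next
  case (Suc k)
  have f: "\<forall>x\<in>S. f differentiable (at x)" "\<And>v. Ck_on k S (\<lambda>x. frechet_derivative f (at x) v)"
    using Suc.prems(2) unfolding Ck_on.simps by blast+
  have g: "(g has_derivative frechet_derivative f (at x)) (at x)" if "x \<in> S" for x
  proof (rule has_derivative_transform_within_open[OF _ assms(1) that])
    show "(f has_derivative frechet_derivative f (at x)) (at x)"
      using f(1) that unfolding frechet_derivative_works[symmetric] by blast
  qed (rule Suc.prems(1))
  have "Ck_on k S (\<lambda>x. frechet_derivative g (at x) v)" for v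
    by (rule Suc.IH[OF _ f(2)[of v]]) (rule fun_cong[OF frechet_derivative_at[OF g]])
  moreover have "\<forall>x\<in>S. g differentiable (at x)" using g differentiableI by blast
  ultimately show ?case unfolding Ck_on.simps by blast
qed

lemma Ck_on_Suc_imp: "Ck_on (Suc k) S f \<Longrightarrow> Ck_on k S f"
proof (induction k arbitrary: f)
  case 0
  then have "\<forall>x\<in>S. f differentiable (at x)" unfolding Ck_on.simps by (rule conjunct1)
  then show ?case unfolding Ck_on.simps
    by (intro continuous_at_imp_continuous_on ballI differentiable_imp_continuous_within) blast
next
  case (Suc k)
  then have 1: "\<forall>x\<in>S. f differentiable (at x)" and 2: "\<And>v. Ck_on (Suc k) S (\<lambda>x. frechet_derivative f (at x) v)"
    unfolding Ck_on.simps(2)[of "Suc k"] by blast+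
  from 2 have "\<And>v. Ck_on k S (\<lambda>x. frechet_derivative f (at x) v)" by (rule Suc.IH)
  with 1 show ?case unfolding Ck_on.simps(2)[of k] by blast
qed

lemma Ck_on_add:
  assumes "open S" "Ck_on k S f" "Ck_on k S g"
  shows "Ck_on k S (\<lambda>x. f x + g x)"
  using assms(2,3)
proof (induction k arbitrary: f g)
  case 0
  then show ?case by (simp add: continuous_on_add)
next
  case (Suc k)
  have "Ck_on k S (\<lambda>x. frechet_derivative (\<lambda>x. f x + g x) (at x) v)" for v
  proof (rule Ck_on_cong[OF assms(1)])
    show "Ck_on k S (\<lambda>x. frechet_derivative f (at x) v + frechet_derivative g (at x) v)"
      using Suc by simp
    fix x assume "x \<in> S"
    then have "((\<lambda>x. f x + g x) has_derivative (\<lambda>v. frechet_derivative f (at x) v + frechet_derivative g (at x) v)) (at x)"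
      using Suc.prems by (intro has_derivative_add) (auto simp: frechet_derivative_works[symmetric])
    from fun_cong[OF frechet_derivative_at[OF this]] show "frechet_derivative f (at x) v + frechet_derivative g (at x) v =
        frechet_derivative (\<lambda>x. f x + g x) (at x) v" .
  qed
  then show ?case using Suc.prems by simp
qed

lemma Ck_on_mult:
  assumes "open S" "Ck_on k S f" "Ck_on k S g"
  shows "Ck_on k S (\<lambda>x. f x * g x)"
  using assms(2,3)
proof (induction k arbitrary: f g)
  case 0
  then show ?case unfolding Ck_on.simps by (intro continuous_on_mult)
next
  case (Suc k)
  have "Ck_on k S (\<lambda>x. frechet_derivative (\<lambda>x. f x * g x) (at x) v)" for v
  proof (rule Ck_on_cong[OF assms(1)])
    show "Ck_on k S (\<lambda>x. f x * frechet_derivative g (at x) v + frechet_derivative f (at x) v * g x)"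
    proof (rule Ck_on_add[OF assms(1)]; rule Suc.IH)
      show "Ck_on k S f" "Ck_on k S g" by (rule Ck_on_Suc_imp[OF Suc.prems(1)], rule Ck_on_Suc_imp[OF Suc.prems(2)])
      show "Ck_on k S (\<lambda>x. frechet_derivative f (at x) v)" "Ck_on k S (\<lambda>x. frechet_derivative g (at x) v)"
        using Suc.prems unfolding Ck_on.simps by blast+
    qed
    fix x assume "x \<in> S"
    then have "((\<lambda>x. f x * g x) has_derivative (\<lambda>v. f x * frechet_derivative g (at x) v + frechet_derivative f (at x) v * g x)) (at x)"
      using Suc.prems unfolding Ck_on.simps
      by (intro has_derivative_mult) (auto simp only: frechet_derivative_works[symmetric])
    from fun_cong[OF frechet_derivative_at[OF this]] show "f x * frechet_derivative g (at x) v + frechet_derivative f (at x) v * g x =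
        frechet_derivative (\<lambda>x. f x * g x) (at x) v" .
  qed
  moreover have "(\<lambda>x. f x * g x) differentiable (at x)" if "x \<in> S" for x
    using Suc.prems that unfolding Ck_on.simps by (intro differentiable_mult) blast+
  ultimately show ?case unfolding Ck_on.simps by blast
qed

lemma Cinf_on_mult: "open S \<Longrightarrow> Cinf_on S f \<Longrightarrow> Cinf_on S g \<Longrightarrow> Cinf_on S (\<lambda>x. f x * g x)"
  unfolding Cinf_on_def by (intro allI Ck_on_mult) blast+

lemma Cinf_on_frechet_derivative:
  assumes "Cinf_on S f" shows "Cinf_on S (\<lambda>x. frechet_derivative f (at x) v)"
  unfolding Cinf_on_def
proof
  fix k
  have "Ck_on (Suc k) S f" using assms unfolding Cinf_on_def by (rule spec)
  then show "Ck_on k S (\<lambda>x. frechet_derivative f (at x) v)" by simp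
qed

lemma Cinf_on_const: "Cinf_on S (\<lambda>x. c)"
proof -
  have "Ck_on k S (\<lambda>x. c)" for k by (induction k arbitrary: c) simp_all
  then show ?thesis by (simp add: Cinf_on_def)
qed

lemma Cinf_on_imp_continuous: "Cinf_on S f \<Longrightarrow> continuous_on S f"
  using Ck_on.simps(1)[of S f] by (simp add: Cinf_on_def del: Ck_on.simps)

lemma Cinf_on_imp_has_derivative:
  assumes "Cinf_on S f" "x \<in> S" shows "(f has_derivative frechet_derivative f (at x)) (at x)"
proof -
  have "Ck_on (Suc 0) S f" using assms(1) unfolding Cinf_on_def by (rule spec)
  with assms(2) show ?thesis by (simp add: frechet_derivative_works[symmetric])
qed

text \<open>The derivative of \<open>a \<cdot> (H j \<circ> \<phi>)\<close> in direction \<open>v\<close> is again a combination of such products, so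
  that the recursion below produces the \<open>m\<close>-th directional derivative when each \<open>H (Suc j)\<close> is the
  derivative of \<open>H j\<close>.\<close>

primrec dir_deriv :: "(real^'n \<Rightarrow> real) \<Rightarrow> (nat \<Rightarrow> real \<Rightarrow> real) \<Rightarrow> real^'n \<Rightarrow> nat \<Rightarrow>
    (real^'n \<Rightarrow> real) \<Rightarrow> nat \<Rightarrow> real^'n \<Rightarrow> real" where
  "dir_deriv \<phi> H v 0 a j x = a x * H j (\<phi> x)"
| "dir_deriv \<phi> H v (Suc m) a j x = (\<Sum>i\<in>UNIV. v $ i *
     (dir_deriv \<phi> H v m (\<lambda>x. frechet_derivative a (at x) (axis i 1)) j x +
      dir_deriv \<phi> H v m (\<lambda>x. a x * frechet_derivative \<phi> (at x) (axis i 1)) (Suc j) x))"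

lemma linear_axis_expansion:
  fixes f :: "real^'n \<Rightarrow> real"
  assumes "linear f" shows "f v = (\<Sum>i\<in>UNIV. v $ i * f (axis i 1))"
proof -
  have "f v = f (\<Sum>i\<in>UNIV. v $ i *s axis i 1)" by (simp only: basis_expansion)
  also have "\<dots> = (\<Sum>i\<in>UNIV. f (v $ i *s axis i 1))" by (rule linear_sum[OF assms, unfolded o_def])
  finally show ?thesis using assms by (simp add: scalar_mult_eq_scaleR linear_cmul)
qed

lemma has_real_derivative_along_line:
  fixes f :: "'a::real_normed_vector \<Rightarrow> real"
  assumes "(f has_derivative f') (at (p + u *\<^sub>R v))"
  shows "((\<lambda>u. f (p + u *\<^sub>R v)) has_real_derivative f' v) (at u)"
proof -
  have "((\<lambda>u. p + u *\<^sub>R v) has_derivative (\<lambda>h. h *\<^sub>R v)) (at u)"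
    by (auto intro!: derivative_eq_intros)
  from has_derivative_compose[OF this assms]
  have "((\<lambda>u. f (p + u *\<^sub>R v)) has_derivative (\<lambda>h. f' (h *\<^sub>R v))) (at u)" .
  then have "((\<lambda>u. f (p + u *\<^sub>R v)) has_derivative (\<lambda>h. h * f' v)) (at u)"
    using has_derivative_linear[OF assms] by (simp add: linear_cmul)
  moreover have "(\<lambda>h. h * f' v) = (*) (f' v)" by (auto simp: mult.commute)
  ultimately show ?thesis by (simp add: has_field_derivative_def)
qed

lemma dir_deriv_has_real_derivative:
  assumes H: "\<And>j u. (H j has_real_derivative H (Suc j) u) (at u)"
    and \<phi>: "Cinf_on S \<phi>" and S: "open S" and a: "Cinf_on S a" and x: "p + u *\<^sub>R v \<in> S"
  shows "((\<lambda>u. dir_deriv \<phi> H v m a j (p + u *\<^sub>R v)) has_real_derivative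
    dir_deriv \<phi> H v (Suc m) a j (p + u *\<^sub>R v)) (at u)"
  using a
proof (induction m arbitrary: a j)
  case 0
  let ?x = "p + u *\<^sub>R v"
  have da: "(a has_derivative frechet_derivative a (at ?x)) (at ?x)"
    and dp: "(\<phi> has_derivative frechet_derivative \<phi> (at ?x)) (at ?x)"
    using Cinf_on_imp_has_derivative 0 \<phi> x by blast+
  have "((\<lambda>u. a (p + u *\<^sub>R v) * H j (\<phi> (p + u *\<^sub>R v))) has_real_derivative
     frechet_derivative a (at ?x) v * H j (\<phi> ?x) + (H (Suc j) (\<phi> ?x) * frechet_derivative \<phi> (at ?x) v) * a ?x) (at u)"
    by (intro DERIV_mult has_real_derivative_along_line[OF da] DERIV_chain2[OF H] has_real_derivative_along_line[OF dp])
  moreover have "frechet_derivative a (at ?x) v * H j (\<phi> ?x) + (H (Suc j) (\<phi> ?x) * frechet_derivative \<phi> (at ?x) v) * a ?x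
    = dir_deriv \<phi> H v (Suc 0) a j ?x"
    unfolding linear_axis_expansion[OF has_derivative_linear[OF da], of v]
      linear_axis_expansion[OF has_derivative_linear[OF dp], of v] dir_deriv.simps
    by (simp add: sum_distrib_left sum_distrib_right sum.distrib distrib_left mult_ac)
  ultimately show ?case by simp
next
  case (Suc m)
  show ?case
    unfolding dir_deriv.simps(2)[of _ _ _ "Suc m"] dir_deriv.simps(2)[of _ _ _ m a]
    by (intro DERIV_sum DERIV_cmult DERIV_add Suc.IH Cinf_on_frechet_derivative Cinf_on_mult S \<phi> Suc.prems)
qed

text \<open>The coefficient functions of the recursion are built from \<open>a\<close> and
  derivatives of \<phi> alone, hence bounded on \<open>K\<close>; the direction enters only through
  its coordinates, once per derivative, and \<open>H\<close> only through its values. So one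
  constant serves all \<open>H\<close> and \<open>v\<close>, which later means all \<open>s\<close>
  and all scales.\<close>

lemma dir_deriv_bound:
  fixes \<phi> :: "real^'n \<Rightarrow> real"
  assumes \<phi>: "Cinf_on S \<phi>" and S: "open S" and K: "compact K" "K \<subseteq> S" and a: "Cinf_on S a"
  shows "\<exists>C\<ge>0. \<forall>H B v x. x \<in> K \<longrightarrow> (\<forall>i\<le>j + m. \<forall>u. \<bar>H i u\<bar> \<le> B) \<longrightarrow>
     \<bar>dir_deriv \<phi> H v m a j x\<bar> \<le> C * norm v ^ m * B"
  using a
proof (induction m arbitrary: a j)
  case 0
  have "continuous_on K a" using Cinf_on_imp_continuous[OF 0] K(2) continuous_on_subset by blast
  then have "bounded (a ` K)" using K(1) compact_continuous_image compact_imp_bounded by blast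
  then obtain C where C: "\<And>x. x \<in> K \<Longrightarrow> \<bar>a x\<bar> \<le> C" by (auto simp: bounded_iff)
  have "\<bar>a x * H j (\<phi> x)\<bar> \<le> \<bar>C\<bar> * B" if "x \<in> K" "\<forall>i\<le>j. \<forall>u. \<bar>H i u\<bar> \<le> B" for H B x
    unfolding abs_mult using C[OF that(1)] that(2) by (intro mult_mono) (auto intro: order_trans[OF abs_ge_zero])
  then show ?case by (intro exI[of _ "\<bar>C\<bar>"]) auto
next
  case (Suc m)
  let ?a = "\<lambda>i x. frechet_derivative a (at x) (axis i 1)"
  let ?b = "\<lambda>i x. a x * frechet_derivative \<phi> (at x) (axis i 1)"
  have "\<forall>i. \<exists>C\<ge>0. \<forall>H B v x. x \<in> K \<longrightarrow> (\<forall>i\<le>j + m. \<forall>u. \<bar>H i u\<bar> \<le> B) \<longrightarrow>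
     \<bar>dir_deriv \<phi> H v m (?a i) j x\<bar> \<le> C * norm v ^ m * B"
    by (intro allI Suc.IH Cinf_on_frechet_derivative Suc.prems)
  from choice[OF this] obtain C where C: "\<And>i. C i \<ge> 0" "\<And>i H B v x. x \<in> K \<Longrightarrow> (\<forall>i\<le>j + m. \<forall>u. \<bar>H i u\<bar> \<le> B) \<Longrightarrow>
     \<bar>dir_deriv \<phi> H v m (?a i) j x\<bar> \<le> C i * norm v ^ m * B" by blast
  have "\<forall>i. \<exists>C\<ge>0. \<forall>H B v x. x \<in> K \<longrightarrow> (\<forall>i\<le>Suc j + m. \<forall>u. \<bar>H i u\<bar> \<le> B) \<longrightarrow>
     \<bar>dir_deriv \<phi> H v m (?b i) (Suc j) x\<bar> \<le> C * norm v ^ m * B"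
    by (intro allI Suc.IH Cinf_on_mult Cinf_on_frechet_derivative Suc.prems \<phi> S)
  from choice[OF this] obtain D where D: "\<And>i. D i \<ge> 0" "\<And>i H B v x. x \<in> K \<Longrightarrow> (\<forall>i\<le>Suc j + m. \<forall>u. \<bar>H i u\<bar> \<le> B) \<Longrightarrow>
     \<bar>dir_deriv \<phi> H v m (?b i) (Suc j) x\<bar> \<le> D i * norm v ^ m * B" by blast
  have "\<bar>dir_deriv \<phi> H v (Suc m) a j x\<bar> \<le> (\<Sum>i\<in>UNIV. C i + D i) * norm v ^ Suc m * B"
    if x: "x \<in> K" and HB: "\<forall>i\<le>j + Suc m. \<forall>u. \<bar>H i u\<bar> \<le> B" for H B v x
  proof -
    have "\<bar>dir_deriv \<phi> H v (Suc m) a j x\<bar> \<le>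
        (\<Sum>i\<in>UNIV. \<bar>v $ i * (dir_deriv \<phi> H v m (?a i) j x + dir_deriv \<phi> H v m (?b i) (Suc j) x)\<bar>)"
      unfolding dir_deriv.simps by (rule sum_abs)
    also have "\<dots> \<le> (\<Sum>i\<in>UNIV. norm v * (C i * norm v ^ m * B + D i * norm v ^ m * B))"
    proof (intro sum_mono)
      fix i
      show "\<bar>v $ i * (dir_deriv \<phi> H v m (?a i) j x + dir_deriv \<phi> H v m (?b i) (Suc j) x)\<bar>
          \<le> norm v * (C i * norm v ^ m * B + D i * norm v ^ m * B)"
        unfolding abs_mult using HB
        by (intro mult_mono component_le_norm_cart order_trans[OF abs_triangle_ineq] add_mono C D x) auto
    qed
    also have "\<dots> = (\<Sum>i\<in>UNIV. C i + D i) * norm v ^ Suc m * B"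
      unfolding sum_distrib_right by (intro sum.cong refl) (simp add: algebra_simps)
    finally show ?thesis .
  qed
  moreover have "(\<Sum>i\<in>UNIV. C i + D i) \<ge> 0" using C(1) D(1) by (intro sum_nonneg add_nonneg_nonneg)
  ultimately show ?case by blast
qed

lemma dir_deriv_zero: "dir_deriv \<phi> H v m (\<lambda>x. 0) j x = 0"
  by (induction m arbitrary: j) simp_all

text \<open>The recursion never lowers the index of \<open>H\<close>, so only values
  \<open>H i (\<phi> x)\<close> with \<open>i \<ge> j\<close> occur.\<close>

lemma dir_deriv_eq_0:
  assumes "\<And>i. i \<ge> j \<Longrightarrow> H i (\<phi> x) = 0" shows "dir_deriv \<phi> H v m a j x = 0"
  using assms
proof (induction m arbitrary: j a)
  case (Suc m)
  have "dir_deriv \<phi> H v m (\<lambda>x. frechet_derivative a (at x) (axis i 1)) j x = 0"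
    "dir_deriv \<phi> H v m (\<lambda>x. a x * frechet_derivative \<phi> (at x) (axis i 1)) (Suc j) x = 0" for i
    by (rule Suc.IH, rule Suc.prems, simp)+
  then show ?case by simp
qed simp

subsection \<open>Lattice sums and integrals\<close>

text \<open>Each derivative of order between 1 and
  \<open>m - 1\<close> vanishes somewhere by Rolle, so all of them are controlled by the \<open>m\<close>-th one.\<close>

lemma periodic_oscillation:
  fixes s :: "nat \<Rightarrow> real \<Rightarrow> real" and K :: real
  assumes deriv: "\<And>j u. j < m \<Longrightarrow> (s j has_real_derivative s (Suc j) u) (at u)"
    and per: "\<And>j. j < m \<Longrightarrow> s j 0 = s j 1"
    and bd: "\<And>u. 0 \<le> u \<Longrightarrow> u \<le> 1 \<Longrightarrow> \<bar>s m u\<bar> \<le> K"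
    and m: "m \<ge> 1" and u: "0 \<le> u" "u \<le> 1"
  shows "\<bar>s 0 u - s 0 0\<bar> \<le> K"
proof -
  have diff: "\<bar>s j x - s j y\<bar> \<le> K" if "\<And>u. 0 \<le> u \<Longrightarrow> u \<le> 1 \<Longrightarrow> \<bar>s (Suc j) u\<bar> \<le> K" "j < m"
    "0 \<le> x" "x \<le> 1" "0 \<le> y" "y \<le> 1" for j x y
  proof -
    have "norm (s j x - s j y) \<le> K * norm (x - y)"
      by (rule field_differentiable_bound[of "{0..1}" "s j" "s (Suc j)"])
        (use that deriv[of j] in \<open>auto intro: has_field_derivative_at_within\<close>)
    also have "\<dots> \<le> K * 1" using that by (intro mult_left_mono order_trans[OF _ that(1)[of 0]]) auto
    finally show ?thesis by simp
  qed
  have "\<forall>u. 0 \<le> u \<and> u \<le> 1 \<longrightarrow> \<bar>s (m - d) u\<bar> \<le> K" if "d < m" for d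
    using that
  proof (induction d)
    case 0
    then show ?case using bd by simp
  next
    case (Suc d)
    let ?j = "m - Suc d"
    have j: "Suc ?j = m - d" "?j < m" using Suc.prems by auto
    obtain j0 where j0: "?j = Suc j0" using Suc.prems by (cases ?j) auto
    have "\<exists>z. 0 < z \<and> z < 1 \<and> s j0 1 - s j0 0 = (1 - 0) * s ?j z"
      unfolding j0 by (rule MVT2) (use deriv[of j0] j0 Suc.prems in auto)
    then obtain z where z: "0 < z" "z < 1" "s ?j z = 0" using per[of j0] j0 Suc.prems by auto
    show ?case
    proof (intro allI impI)
      fix u :: real assume u: "0 \<le> u \<and> u \<le> 1"
      have "\<bar>s ?j u - s ?j z\<bar> \<le> K" by (rule diff) (use Suc j u z in auto)
      then show "\<bar>s ?j u\<bar> \<le> K" using z by simp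
    qed
  qed
  from this[of "m - 1"] have "\<And>u. 0 \<le> u \<Longrightarrow> u \<le> 1 \<Longrightarrow> \<bar>s (Suc 0) u\<bar> \<le> K" using m by auto
  then show ?thesis using u m by (intro diff) auto
qed

section \<open>Integer points and the unit cell\<close>

lemma int_lattice_add: "x \<in> int_lattice \<Longrightarrow> y \<in> int_lattice \<Longrightarrow> x + y \<in> int_lattice"
  by (simp add: int_lattice_def)

lemma int_lattice_diff: "x \<in> int_lattice \<Longrightarrow> y \<in> int_lattice \<Longrightarrow> x - y \<in> int_lattice"
  by (simp add: int_lattice_def)

lemma zero_in_int_lattice [simp]: "0 \<in> int_lattice"
  by (simp add: int_lattice_def)

lemma axis_in_int_lattice [simp]: "axis i 1 \<in> int_lattice"
  by (simp add: int_lattice_def axis_def)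

text \<open>Each coordinate of such a point is one of the integers of modulus at most the floor of
  \<open>R\<close>, so counting the points of a cube is enough.\<close>

lemma int_lattice_ball:
  fixes R :: real
  assumes "R \<ge> 0"
  shows "finite {x\<in>int_lattice. norm (x::real^'n) \<le> R}"
    and "real (card {x\<in>int_lattice. norm (x::real^'n) \<le> R}) \<le> (2 * R + 1) ^ CARD('n)"
proof -
  let ?I = "{- \<lfloor>R\<rfloor>..\<lfloor>R\<rfloor>}"
  let ?F = "PiE (UNIV::'n set) (\<lambda>_. ?I)"
  have sub: "{x\<in>int_lattice. norm (x::real^'n) \<le> R} \<subseteq> (\<lambda>f. \<chi> i. of_int (f i)) ` ?F"
  proof
    fix x :: "real^'n" assume "x \<in> {x\<in>int_lattice. norm x \<le> R}"
    then have x: "\<And>i. x $ i \<in> \<int>" "\<And>i. \<bar>x $ i\<bar> \<le> R"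
      using component_le_norm_cart order_trans by (auto simp: int_lattice_def) blast
    have "\<lfloor>x $ i\<rfloor> \<in> ?I" for i
    proof -
      obtain z where z: "x $ i = of_int z" using x(1)[of i] by (rule Ints_cases)
      then have "of_int z \<le> R" "of_int (- z) \<le> R" using x(2)[of i] by (auto simp: abs_le_iff)
      then have "z \<le> \<lfloor>R\<rfloor>" "- z \<le> \<lfloor>R\<rfloor>" by (simp_all only: le_floor_iff)
      then show ?thesis using z by simp
    qed
    then have "(\<lambda>i. \<lfloor>x $ i\<rfloor>) \<in> ?F" by auto
    moreover have "x = (\<chi> i. of_int \<lfloor>x $ i\<rfloor>)" using x(1) by (simp add: vec_eq_iff)
    ultimately show "x \<in> (\<lambda>f. \<chi> i. of_int (f i)) ` ?F"
      using image_eqI[where x = "\<lambda>i. \<lfloor>x $ i\<rfloor>" and f = "\<lambda>f. \<chi> i. of_int (f i)" and b = x and A = ?F] by blast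
  qed
  have fin: "finite ?F" by (intro finite_PiE) auto
  then show "finite {x\<in>int_lattice. norm (x::real^'n) \<le> R}" using sub finite_surj by blast
  have "card {x\<in>int_lattice. norm (x::real^'n) \<le> R} \<le> card ?F" using sub fin surj_card_le by blast
  also have "card ?F = nat (2 * \<lfloor>R\<rfloor> + 1) ^ CARD('n)" by (simp add: card_PiE)
  finally have "real (card {x\<in>int_lattice. norm (x::real^'n) \<le> R}) \<le> real (nat (2 * \<lfloor>R\<rfloor> + 1)) ^ CARD('n)"
    by (metis of_nat_le_iff of_nat_power)
  also have "\<dots> \<le> (2 * R + 1) ^ CARD('n)"
    using assms by (intro power_mono) (auto simp: of_nat_nat)
  finally show "real (card {x\<in>int_lattice. norm (x::real^'n) \<le> R}) \<le> (2 * R + 1) ^ CARD('n)" .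
qed

text \<open>Half-open, so that its translates by integer vectors tile the space without
  overlap.\<close>

definition unit_cell :: "(real^'n) set" where
  "unit_cell = {y. \<forall>i. 0 \<le> y $ i \<and> y $ i < 1}"

lemma unit_cell_borel [measurable]: "unit_cell \<in> sets borel"
proof -
  have "unit_cell = (\<Inter>i\<in>UNIV. {y::real^'n. y $ i \<ge> 0} \<inter> {y. y $ i < 1})"
    by (auto simp: unit_cell_def)
  also have "\<dots> \<in> sets borel"
    by (intro sets.finite_INT sets.Int borel_open borel_closed closed_halfspace_component_ge_cart
      open_halfspace_component_lt_cart) auto
  finally show ?thesis .
qed

lemma emeasure_unit_cell: "emeasure lborel (unit_cell :: (real^'n) set) = 1"
proof (rule antisym)
  have one: "(1::real^'n) \<bullet> b = 1" if "b \<in> Basis" for b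
    using that by (auto simp: Basis_vec_def inner_axis)
  have "emeasure lborel (unit_cell :: (real^'n) set) \<le> emeasure lborel (cbox (0::real^'n) 1)"
    by (intro emeasure_mono) (auto simp: unit_cell_def mem_box_cart less_imp_le)
  also have "\<dots> = 1"
    by (subst emeasure_lborel_cbox) (simp_all add: one prod.neutral)
  finally show "emeasure lborel (unit_cell :: (real^'n) set) \<le> 1" .
  have "1 = emeasure lborel (box (0::real^'n) 1)"
    by (subst emeasure_lborel_box) (simp_all add: one prod.neutral)
  also have "\<dots> \<le> emeasure lborel (unit_cell :: (real^'n) set)"
    by (intro emeasure_mono) (auto simp: unit_cell_def mem_box_cart less_imp_le)
  finally show "1 \<le> emeasure lborel (unit_cell :: (real^'n) set)" .
qed

lemma norm_unit_cube_le:
  fixes y :: "real^'n" assumes "\<And>i. 0 \<le> y $ i \<and> y $ i \<le> 1" shows "norm y \<le> CARD('n)"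
proof -
  have "norm y \<le> (\<Sum>i\<in>UNIV. \<bar>y $ i\<bar>)" by (rule norm_le_l1_cart)
  also have "\<dots> \<le> (\<Sum>i\<in>(UNIV::'n set). 1)" using assms by (intro sum_mono) (simp add: abs_le_iff)
  finally show ?thesis by simp
qed

lemma lborel_integral_translate:
  fixes f :: "'a::euclidean_space \<Rightarrow> real"
  assumes "f \<in> borel_measurable borel"
  shows "(\<integral>x. f x \<partial>lborel) = (\<integral>x. f (c + x) \<partial>lborel)"
  using integral_distr[of "(+) c" lborel borel f] assms by (simp add: lborel_distr_plus)

text \<open>The integral is the mean over the unit cell of the periodised function
  \<open>S0\<close>, and the lattice sum is its value at 0. So the error is at most the oscillation
  of \<open>S0\<close>, which is controlled along one axis at a time; hence derivatives
  \<open>G i\<close> along the axes suffice.\<close>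

lemma lattice_sum_minus_integral:
  fixes f :: "real^'n \<Rightarrow> real" and G :: "'n \<Rightarrow> nat \<Rightarrow> real^'n \<Rightarrow> real" and K R :: real
  assumes G0: "\<And>i. G i 0 = f"
    and deriv: "\<And>i j x u. j < m \<Longrightarrow>
      ((\<lambda>u. G i j (x + u *\<^sub>R axis i 1)) has_real_derivative G i (Suc j) (x + u *\<^sub>R axis i 1)) (at u)"
    and supp: "\<And>i j x. j \<le> m \<Longrightarrow> norm x > R \<Longrightarrow> G i j x = 0"
    and bd: "\<And>i x. \<bar>G i m x\<bar> \<le> K"
    and m: "m \<ge> 1" and R: "R \<ge> 0" and f: "continuous_on UNIV f"
    and Y: "finite Y" "Y \<subseteq> int_lattice" "\<And>x. x \<in> int_lattice - Y \<Longrightarrow> f x = 0"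
  shows "integrable lborel f"
    and "\<bar>(\<Sum>x\<in>Y. f x) - (\<integral>x. f x \<partial>lborel)\<bar> \<le> CARD('n) * (2 * (R + CARD('n)) + 1) ^ CARD('n) * K"
proof -
  let ?n = "real CARD('n)"
  \<comment> \<open>The margin \<open>?n\<close> bounds the norm on the closed unit cube, so
    \<open>X\<close> contains every lattice point \<omega> for which \<omega> + y can meet the
    support with y in that cube.\<close>
  define X where "X = {x\<in>int_lattice. norm (x::real^'n) \<le> R + ?n}"
  have X: "finite X" "X \<subseteq> int_lattice" and cardX: "real (card X) \<le> (2 * (R + ?n) + 1) ^ CARD('n)"
    unfolding X_def using int_lattice_ball[of "R + ?n", where 'n='n] R by auto
  define K' where "K' = (2 * (R + ?n) + 1) ^ CARD('n) * K"
  have K: "K \<ge> 0" using bd[of undefined 0] by linarith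
  have fsupp: "f x = 0" if "norm x > R" for x using supp[of 0 x undefined] that G0 by simp
  define S where "S i j y = (\<Sum>\<omega>\<in>X. G i j (\<omega> + y))" for i j y
  define S0 where "S0 y = (\<Sum>\<omega>\<in>X. f (\<omega> + y))" for y
  have S_0: "S i 0 y = S0 y" for i y unfolding S_def S0_def G0 ..
  have step: "\<bar>S0 (y + u *\<^sub>R axis i 1) - S0 y\<bar> \<le> K'"
    if y: "\<And>k. 0 \<le> y $ k \<and> y $ k \<le> 1" "y $ i = 0" and u: "0 \<le> u" "u \<le> 1" for y u i
  proof -
    have "\<bar>S i 0 (y + u *\<^sub>R axis i 1) - S i 0 (y + 0 *\<^sub>R axis i 1)\<bar> \<le> K'"
    proof (rule periodic_oscillation[where s = "\<lambda>j u. S i j (y + u *\<^sub>R axis i 1)", OF _ _ _ m u])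
      fix j u assume j: "j < m"
      show "((\<lambda>u. S i j (y + u *\<^sub>R axis i 1)) has_real_derivative S i (Suc j) (y + u *\<^sub>R axis i 1)) (at u)"
        unfolding S_def using deriv[OF j, of i] by (intro DERIV_sum) (simp add: add.assoc[symmetric])
    next
      fix j assume j: "j < m"
      have y1: "norm y \<le> ?n" "norm (y + axis i 1) \<le> ?n"
        using y by (auto intro!: norm_unit_cube_le simp: axis_def)
      let ?g = "\<lambda>\<omega>. G i j (\<omega> + y)" and ?X = "(\<lambda>\<omega>. \<omega> + axis i 1) ` X"
      \<comment> \<open>Periodicity of a finite sum: \<open>X\<close> and its translate
        \<open>?X\<close> each give the sum over their union, since all terms outside either of them
        vanish by the support condition.\<close>
      have "(\<Sum>\<omega>\<in>?X. ?g \<omega>) = (\<Sum>\<omega>\<in>X \<union> ?X. ?g \<omega>)"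
      proof (rule sum.mono_neutral_left)
        show "\<forall>\<omega>\<in>X \<union> ?X - ?X. ?g \<omega> = 0"
        proof
          fix \<omega> assume \<omega>: "\<omega> \<in> X \<union> ?X - ?X"
          then have "\<omega> - axis i 1 \<notin> X" by force
          moreover have "\<omega> - axis i 1 \<in> int_lattice" using \<omega> X by (intro int_lattice_diff) auto
          ultimately have "norm (\<omega> - axis i 1) > R + ?n" by (simp add: X_def)
          moreover have "norm (\<omega> - axis i 1) \<le> norm (\<omega> + y) + norm (y + axis i 1)"
            using norm_triangle_ineq4[of "\<omega> + y" "y + axis i 1"] by simp
          ultimately show "?g \<omega> = 0" using y1 j by (intro supp) auto
        qed
      qed (use X in auto)
      also have "\<dots> = (\<Sum>\<omega>\<in>X. ?g \<omega>)"
      proof (rule sum.mono_neutral_right)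
        show "\<forall>\<omega>\<in>X \<union> ?X - X. ?g \<omega> = 0"
        proof
          fix \<omega> assume \<omega>: "\<omega> \<in> X \<union> ?X - X"
          then have "\<omega> \<in> int_lattice" using X by (auto intro!: int_lattice_add)
          then have "norm \<omega> > R + ?n" using \<omega> by (simp add: X_def)
          moreover have "norm \<omega> \<le> norm (\<omega> + y) + norm y"
            using norm_triangle_ineq4[of "\<omega> + y" y] by simp
          ultimately show "?g \<omega> = 0" using y1 j by (intro supp) auto
        qed
      qed (use X in auto)
      also have "(\<Sum>\<omega>\<in>?X. ?g \<omega>) = (\<Sum>\<omega>\<in>X. ?g (\<omega> + axis i 1))"
        by (subst sum.reindex) (auto simp: inj_on_def)
      finally show "S i j (y + 0 *\<^sub>R axis i 1) = S i j (y + 1 *\<^sub>R axis i 1)"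
        by (simp add: S_def add_ac)
    next
      fix u
      have "\<bar>S i m (y + u *\<^sub>R axis i 1)\<bar> \<le> (\<Sum>\<omega>\<in>X. K)"
        unfolding S_def by (rule order_trans[OF sum_abs]) (intro sum_mono bd)
      also have "\<dots> \<le> K'" unfolding K'_def using cardX K by (simp add: mult_right_mono)
      finally show "\<bar>S i m (y + u *\<^sub>R axis i 1)\<bar> \<le> K'" .
    qed
    then show ?thesis by (simp add: S_0)
  qed
  have osc: "\<bar>S0 y - S0 0\<bar> \<le> ?n * K'" if y: "\<And>k. 0 \<le> y $ k \<and> y $ k \<le> 1" for y
  proof -
    \<comment> \<open>The path from 0 to \<open>y\<close> switches on one coordinate at a time, each
      at the cost \<open>K'\<close>.\<close>
    have "\<bar>S0 (\<chi> k. if k \<in> I then y $ k else 0) - S0 0\<bar> \<le> real (card I) * K'" for I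
      using finite[of I]
    proof (induction I rule: finite_induct)
      case empty
      have "(\<chi> k. if k \<in> {} then y $ k else 0) = 0" by (simp add: vec_eq_iff)
      then show ?case by simp
    next
      case (insert i I)
      let ?z = "\<chi> k. if k \<in> I then y $ k else 0"
      have "(\<chi> k. if k \<in> insert i I then y $ k else 0) = ?z + (y $ i) *\<^sub>R axis i 1"
        using insert.hyps by (auto simp: vec_eq_iff axis_def)
      moreover have "\<bar>S0 (?z + (y $ i) *\<^sub>R axis i 1) - S0 ?z\<bar> \<le> K'"
        by (rule step) (use y insert.hyps in auto)
      ultimately show ?case using insert by (simp add: algebra_simps)
    qed
    from this[of UNIV] show ?thesis by simp
  qed
  have meas: "f \<in> borel_measurable borel" using f by (rule borel_measurable_continuous_onI)
  note meas [measurable]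
  have "integrable lborel (\<lambda>x. indicator (cball 0 R) x *\<^sub>R f x)"
    by (rule borel_integrable_compact) (auto intro: continuous_on_subset[OF f])
  also have "(\<lambda>x. indicator (cball 0 R) x *\<^sub>R f x) = f"
    using fsupp by (auto simp: indicator_def fun_eq_iff)
  finally show int: "integrable lborel f" .
  have int_cell: "integrable lborel (\<lambda>x. indicator unit_cell (x - \<omega>) * f x)" for \<omega>
    by (rule Bochner_Integration.integrable_bound[OF int]) (auto simp: indicator_def)
  \<comment> \<open>Exactly one cell contains \<open>x\<close>, the one at the vector of floors;
    when \<open>f x\<close> is nonzero, that vector lies in \<open>X\<close>.\<close>
  have f_eq: "f x = (\<Sum>\<omega>\<in>X. indicator unit_cell (x - \<omega>) * f x)" for x
  proof (cases "f x = 0")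
    case False
    define \<omega> :: "real^'n" where "\<omega> = (\<chi> i. of_int \<lfloor>x $ i\<rfloor>)"
    have cell: "indicator unit_cell (x - \<omega>') = (if \<omega>' = \<omega> then 1 else (0::real))" if "\<omega>' \<in> X" for \<omega>'
    proof -
      have "\<forall>i. \<exists>z. \<omega>' $ i = of_int z" using that X(2) by (auto simp: int_lattice_def elim!: Ints_cases)
      then obtain z where z: "\<And>i. \<omega>' $ i = of_int (z i)" by metis
      have "x - \<omega>' \<in> unit_cell \<longleftrightarrow> (\<forall>i. \<lfloor>x $ i\<rfloor> = z i)"
        unfolding unit_cell_def floor_eq_iff by (simp add: z less_diff_eq algebra_simps)
      also have "\<dots> \<longleftrightarrow> \<omega>' = \<omega>" by (auto simp: \<omega>_def vec_eq_iff z)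
      finally show ?thesis by (simp add: indicator_def)
    qed
    have "norm (x - \<omega>) \<le> ?n"
      by (rule norm_unit_cube_le) (auto simp: \<omega>_def intro: less_imp_le of_int_floor_le, linarith)
    moreover have "norm x \<le> R" using False fsupp by force
    ultimately have "norm \<omega> \<le> R + ?n" using norm_triangle_ineq4[of x "x - \<omega>"] by simp
    then have "\<omega> \<in> X" by (auto simp: X_def \<omega>_def int_lattice_def)
    have "(\<Sum>\<omega>\<in>X. indicator unit_cell (x - \<omega>) * f x) = (\<Sum>\<omega>'\<in>X. if \<omega>' = \<omega> then f x else 0)"
      by (intro sum.cong) (auto simp: cell)
    then show ?thesis using \<open>\<omega> \<in> X\<close> X(1) by simp
  qed simp
  have tr: "(\<integral>x. indicator unit_cell (x - \<omega>) * f x \<partial>lborel) = (\<integral>y. indicator unit_cell y * f (\<omega> + y) \<partial>lborel)" for \<omega>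
    by (subst lborel_integral_translate[where c = \<omega>]) auto
  have int_tr: "integrable lborel (\<lambda>y. indicator unit_cell y * f (\<omega> + y))" for \<omega>
  proof -
    have "integrable (distr lborel borel ((+) \<omega>)) (\<lambda>x. indicator unit_cell (x - \<omega>) * f x)"
      using int_cell by (simp add: lborel_distr_plus)
    then show ?thesis by (subst (asm) integrable_distr_eq) auto
  qed
  have "(\<integral>x. f x \<partial>lborel) = (\<integral>x. (\<Sum>\<omega>\<in>X. indicator unit_cell (x - \<omega>) * f x) \<partial>lborel)"
    using f_eq by simp
  also have "\<dots> = (\<Sum>\<omega>\<in>X. (\<integral>x. indicator unit_cell (x - \<omega>) * f x \<partial>lborel))"
    by (intro Bochner_Integration.integral_sum int_cell)
  also have "\<dots> = (\<integral>y. (\<Sum>\<omega>\<in>X. indicator unit_cell y * f (\<omega> + y)) \<partial>lborel)"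
    unfolding tr by (intro Bochner_Integration.integral_sum[symmetric] int_tr)
  also have "\<dots> = (\<integral>y. indicator unit_cell y * S0 y \<partial>lborel)"
    by (simp add: S0_def sum_distrib_left)
  finally have I1: "(\<integral>x. f x \<partial>lborel) = (\<integral>y. indicator unit_cell y * S0 y \<partial>lborel)" .
  have intS: "integrable lborel (\<lambda>y. indicator unit_cell y * S0 y)"
    unfolding S0_def sum_distrib_left by (intro Bochner_Integration.integrable_sum int_tr)
  have int1: "integrable lborel (indicator (unit_cell :: (real^'n) set) :: _ \<Rightarrow> real)"
    by (rule integrable_real_indicator) (auto simp: emeasure_unit_cell)
  have m1: "(\<integral>y. indicator (unit_cell :: (real^'n) set) y \<partial>lborel) = (1::real)"
    by (simp add: emeasure_unit_cell measure_def)
  have "(\<integral>x. f x \<partial>lborel) - S0 0 = (\<integral>y. indicator unit_cell y * S0 y \<partial>lborel) - (\<integral>y. indicator (unit_cell :: (real^'n) set) y * S0 0 \<partial>lborel)"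
    using I1 m1 by simp
  also have "\<dots> = (\<integral>y. indicator unit_cell y * S0 y - indicator (unit_cell :: (real^'n) set) y * S0 0 \<partial>lborel)"
    by (intro Bochner_Integration.integral_diff[symmetric] intS integrable_mult_left int1)
  finally have "\<bar>(\<integral>x. f x \<partial>lborel) - S0 0\<bar> \<le> (\<integral>y. \<bar>indicator unit_cell y * S0 y - indicator (unit_cell :: (real^'n) set) y * S0 0\<bar> \<partial>lborel)"
    using integral_abs_bound by metis
  also have "\<dots> \<le> (\<integral>y. indicator (unit_cell :: (real^'n) set) y * (?n * K') \<partial>lborel)"
  proof (rule integral_mono)
    show "integrable lborel (\<lambda>y. \<bar>indicator unit_cell y * S0 y - indicator (unit_cell :: (real^'n) set) y * S0 0\<bar>)"
      by (intro integrable_abs Bochner_Integration.integrable_diff intS integrable_mult_left int1)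
    show "\<bar>indicator unit_cell y * S0 y - indicator (unit_cell :: (real^'n) set) y * S0 0\<bar> \<le> indicator unit_cell y * (?n * K')" for y
      using osc[of y] by (auto simp: indicator_def unit_cell_def less_imp_le)
  qed (intro integrable_mult_left int1)
  also have "\<dots> = ?n * K'" using m1 by simp
  finally have "\<bar>(\<integral>x. f x \<partial>lborel) - S0 0\<bar> \<le> ?n * K'" .
  moreover have "S0 0 = (\<Sum>x\<in>Y. f x)"
  proof -
    \<comment> \<open>\<open>Y\<close> is any finite set of lattice points carrying all nonzero
      values, so it is compared with \<open>X\<close> through the union.\<close>
    have "(\<Sum>x\<in>X. f x) = (\<Sum>x\<in>X \<union> Y. f x)"
      by (rule sum.mono_neutral_left) (use X Y in \<open>auto simp: X_def intro!: fsupp\<close>)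
    also have "\<dots> = (\<Sum>x\<in>Y. f x)" by (rule sum.mono_neutral_right) (use X Y in auto)
    finally show ?thesis by (simp add: S0_def)
  qed
  ultimately show "\<bar>(\<Sum>x\<in>Y. f x) - (\<integral>x. f x \<partial>lborel)\<bar> \<le> ?n * (2 * (R + ?n) + 1) ^ CARD('n) * K"
    by (simp add: K'_def abs_minus_commute mult.assoc)
qed

subsection \<open>A smooth cutoff\<close>

text \<open>The standard flat function exp (- 1 / x) with powers of x in the denominator: the span
  of this family is closed under differentiation, so all derivatives are explicit.\<close>

definition flat :: "nat \<Rightarrow> real \<Rightarrow> real" where
  "flat n x = (if x > 0 then exp (- (1 / x)) / x ^ n else 0)"

lemma flat_tendsto_0: "(flat n \<longlongrightarrow> 0) (at 0)"
proof (rule filterlim_split_at)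
  have "((\<lambda>x::real. inverse x ^ n / exp (inverse x)) \<longlongrightarrow> 0) (at_right 0)"
    by (rule filterlim_compose[OF tendsto_power_div_exp_0 filterlim_inverse_at_top_right])
  then show "(flat n \<longlongrightarrow> 0) (at_right 0)"
    by (rule Lim_transform_eventually)
      (auto simp: flat_def eventually_at_filter exp_minus field_simps intro!: always_eventually)
  have "eventually (\<lambda>x. 0 = flat n x) (at_left 0)" by (auto simp: flat_def eventually_at_filter)
  then show "(flat n \<longlongrightarrow> 0) (at_left 0)" by (rule Lim_transform_eventually[OF tendsto_const])
qed

lemma flat_has_real_derivative:
  "(flat n has_real_derivative - real n * flat (Suc n) x + flat (Suc (Suc n)) x) (at x)"
proof (cases x "0::real" rule: linorder_cases)
  case less
  have "((\<lambda>x. 0) has_real_derivative 0) (at x)" by simp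
  then have "(flat n has_real_derivative 0) (at x)"
    by (rule has_field_derivative_transform_within_open[of _ _ _ "{..<0}"]) (use less in \<open>auto simp: flat_def\<close>)
  then show ?thesis using less by (simp add: flat_def)
next
  case equal
  \<comment> \<open>At the origin the difference quotient is itself the next member of the family,
    whose limit is known.\<close>
  have "(\<lambda>h. (flat n (0 + h) - flat n 0) / h) = flat (Suc n)"
    by (auto simp: flat_def fun_eq_iff field_simps)
  then have "(flat n has_real_derivative 0) (at 0)" unfolding DERIV_def using flat_tendsto_0[of "Suc n"] by simp
  then show ?thesis using equal by (simp add: flat_def)
next
  case greater
  have "((\<lambda>x. exp (- (1 / x)) / x ^ n) has_real_derivative - real n * flat (Suc n) x + flat (Suc (Suc n)) x) (at x)"
  proof -
    \<comment> \<open>Removes the truncated subtraction; for \<open>n = 0\<close> both sides are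
      0.\<close>
    have r: "real n * x ^ (n - 1) = real n * x ^ n / x" using greater by (cases n) auto
    have "((\<lambda>x. exp (- (1 / x))) has_real_derivative exp (- (1 / x)) * (1 / x ^ 2)) (at x)"
      using greater by (auto intro!: derivative_eq_intros simp: power2_eq_square)
    moreover have "((\<lambda>x. x ^ n) has_real_derivative real n * x ^ (n - 1)) (at x)"
      by (auto intro!: derivative_eq_intros)
    ultimately have "((\<lambda>x. exp (- (1 / x)) / x ^ n) has_real_derivative
        (exp (- (1 / x)) * (1 / x ^ 2) * x ^ n - exp (- (1 / x)) * (real n * x ^ (n - 1))) / (x ^ n * x ^ n)) (at x)"
      by (rule DERIV_divide) (use greater in simp)
    moreover have "(exp (- (1 / x)) * (1 / x ^ 2) * x ^ n - exp (- (1 / x)) * (real n * x ^ (n - 1))) / (x ^ n * x ^ n)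
        = - real n * flat (Suc n) x + flat (Suc (Suc n)) x"
      unfolding r using greater by (simp add: flat_def divide_simps power2_eq_square) (simp add: algebra_simps)
    ultimately show ?thesis by simp
  qed
  then show ?thesis
    by (rule has_field_derivative_transform_within_open[of _ _ _ "{0<..}"]) (use greater in \<open>auto simp: flat_def\<close>)
qed

primrec flat_deriv :: "nat \<Rightarrow> nat \<Rightarrow> real \<Rightarrow> real" where
  "flat_deriv 0 n x = flat n x"
| "flat_deriv (Suc k) n x = - real n * flat_deriv k (Suc n) x + flat_deriv k (Suc (Suc n)) x"

lemma flat_deriv_has_real_derivative: "(flat_deriv k n has_real_derivative flat_deriv (Suc k) n x) (at x)"
proof (induction k arbitrary: n)
  case 0
  have "flat_deriv 0 n = flat n" by auto
  then show ?case using flat_has_real_derivative[of n x] by simp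
next
  case (Suc k)
  have "flat_deriv (Suc k) n = (\<lambda>x. - real n * flat_deriv k (Suc n) x + flat_deriv k (Suc (Suc n)) x)" by auto
  then show ?case unfolding flat_deriv.simps(2)[of "Suc k"]
    by (simp only:) (rule DERIV_add[OF DERIV_cmult[OF Suc.IH] Suc.IH])
qed

lemma flat_deriv_eq_0: "x \<le> 0 \<Longrightarrow> flat_deriv k n x = 0"
  by (induction k arbitrary: n) (auto simp: flat_def)

text \<open>\<open>bump_deriv k 0 0\<close> is the k-th derivative of exp (- 1 / (x - 1)) exp (- 1 /
  (2 - x)) on (1, 2), extended by 0. The indices \<open>i\<close> and \<open>j\<close> count the
  derivatives already spent on the two factors, and the sign comes from the inner derivative of 2 -
  x.\<close>

primrec bump_deriv :: "nat \<Rightarrow> nat \<Rightarrow> nat \<Rightarrow> real \<Rightarrow> real" where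
  "bump_deriv 0 i j x = flat_deriv i 0 (x - 1) * ((- 1) ^ j * flat_deriv j 0 (2 - x))"
| "bump_deriv (Suc k) i j x = bump_deriv k (Suc i) j x + bump_deriv k i (Suc j) x"

lemma bump_deriv_has_real_derivative:
  "(bump_deriv k i j has_real_derivative bump_deriv (Suc k) i j x) (at x)"
proof (induction k arbitrary: i j)
  case 0
  have 1: "((\<lambda>x. flat_deriv i 0 (x - 1)) has_real_derivative flat_deriv (Suc i) 0 (x - 1) * 1) (at x)"
    by (rule DERIV_chain2[OF flat_deriv_has_real_derivative]) (auto intro!: derivative_eq_intros)
  have "((\<lambda>x. flat_deriv j 0 (2 - x)) has_real_derivative flat_deriv (Suc j) 0 (2 - x) * (- 1)) (at x)"
    by (rule DERIV_chain2[OF flat_deriv_has_real_derivative]) (auto intro!: derivative_eq_intros)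
  from DERIV_mult[OF 1 DERIV_cmult[OF this, of "(- 1) ^ j"]]
  have "((\<lambda>x. flat_deriv i 0 (x - 1) * ((- 1) ^ j * flat_deriv j 0 (2 - x))) has_real_derivative
     bump_deriv (Suc 0) i j x) (at x)" by (simp add: mult_ac del: flat_deriv.simps)
  moreover have "bump_deriv 0 i j = (\<lambda>x. flat_deriv i 0 (x - 1) * ((- 1) ^ j * flat_deriv j 0 (2 - x)))" by auto
  ultimately show ?case by simp
next
  case (Suc k)
  have "bump_deriv (Suc k) i j = (\<lambda>x. bump_deriv k (Suc i) j x + bump_deriv k i (Suc j) x)" by auto
  then show ?case unfolding bump_deriv.simps(2)[of "Suc k"]
    by (simp only:) (rule DERIV_add[OF Suc.IH Suc.IH])
qed

lemma bump_deriv_eq_0: "x \<le> 1 \<or> x \<ge> 2 \<Longrightarrow> bump_deriv k i j x = 0"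
  by (induction k arbitrary: i j) (auto simp: flat_deriv_eq_0)

text \<open>One minus the normalised primitive of the bump. All derivatives are delivered as one
  sequence, because the estimates below take functions in the form of explicit derivative
  families.\<close>

lemma smooth_cutoff:
  obtains c :: "nat \<Rightarrow> real \<Rightarrow> real" where
    "\<And>j u. (c j has_real_derivative c (Suc j) u) (at u)"
    "\<And>u. u \<le> 1 \<Longrightarrow> c 0 u = 1" "\<And>u. u \<ge> 2 \<Longrightarrow> c 0 u = 0" "\<And>u. 0 \<le> c 0 u" "\<And>u. c 0 u \<le> 1"
    "\<And>j u. u \<le> 1 \<or> u \<ge> 2 \<Longrightarrow> c (Suc j) u = 0"
proof -
  define b where "b k = bump_deriv k 0 0" for k
  have b_deriv: "(b k has_real_derivative b (Suc k) x) (at x)" for k x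
    unfolding b_def by (rule bump_deriv_has_real_derivative)
  have b0: "x \<le> 1 \<or> x \<ge> 2 \<Longrightarrow> b k x = 0" for x k
    unfolding b_def by (rule bump_deriv_eq_0)
  have bnn: "b 0 x \<ge> 0" and bpos: "1 < x \<Longrightarrow> x < 2 \<Longrightarrow> b 0 x > 0" for x
    by (auto simp: b_def flat_def)
  have bcont: "continuous_on S (b 0)" for S
    using b_deriv[of 0] by (intro continuous_at_imp_continuous_on ballI) (rule DERIV_isCont)
  define F where "F u = integral {0..u} (b 0)" for u
  have F0: "F u = 0" if "u \<le> 1" for u
  proof -
    have "F u = integral {0..u} (\<lambda>x. 0)" unfolding F_def
      by (rule Henstock_Kurzweil_Integration.integral_cong) (use that b0 in auto)
    then show ?thesis by simp
  qed
  have F_deriv: "(F has_real_derivative b 0 u) (at u)" for u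
  proof (cases "u < 1")
    case True
    have "((\<lambda>x. 0) has_real_derivative 0) (at u)" by simp
    then have "(F has_real_derivative 0) (at u)"
      by (rule has_field_derivative_transform_within_open[of _ _ _ "{..<1}"]) (use True F0 in auto)
    then show ?thesis using b0 True by simp
  next
    case False
    then have "(F has_real_derivative b 0 u) (at u within {0..u + 1})"
      unfolding F_def by (intro integral_has_real_derivative bcont) auto
    then show ?thesis using False by (simp add: at_within_Icc_at)
  qed
  have mono: "F x \<le> F y" if "x \<le> y" for x y
    using F_deriv bnn that by (intro DERIV_nonneg_imp_nondecreasing[OF that]) blast
  have Fpos: "F 2 > 0"
  proof -
    have "F 1 < F 2" by (rule DERIV_pos_imp_increasing_open)
      (use F_deriv bpos in \<open>auto intro!: continuous_at_imp_continuous_on DERIV_isCont\<close>)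
    then show ?thesis using F0 by simp
  qed
  have F2: "F u = F 2" if "u \<ge> 2" for u
  proof (cases "u = 2")
    case False
    then have "\<exists>z. 2 < z \<and> z < u \<and> F u - F 2 = (u - 2) * b 0 z"
      using that F_deriv by (intro MVT2) auto
    then show ?thesis using b0 by auto
  qed simp
  \<comment> \<open>Dividing by the total mass \<open>F 2\<close> makes \<open>c 0\<close> fall from
    1 to 0. Since the bump is already the first derivative of \<open>F\<close>, order
    \<open>Suc k\<close> uses \<open>b k\<close>.\<close>
  define c where "c j = (case j of 0 \<Rightarrow> (\<lambda>u. 1 - F u / F 2) | Suc k \<Rightarrow> (\<lambda>u. - b k u / F 2))" for j
  show thesis
  proof (rule that[of c])
    fix j u
    show "(c j has_real_derivative c (Suc j) u) (at u)"
    proof (cases j)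
      case 0
      have "((\<lambda>u. 1 - F u / F 2) has_real_derivative 0 - b 0 u / F 2) (at u)"
        by (intro DERIV_diff DERIV_const DERIV_cdivide F_deriv)
      then show ?thesis using 0 by (simp add: c_def)
    next
      case (Suc k)
      have "((\<lambda>u. - b k u / F 2) has_real_derivative - b (Suc k) u / F 2) (at u)"
        by (intro DERIV_minus DERIV_cdivide b_deriv)
      then show ?thesis using Suc by (simp add: c_def)
    qed
  next
    fix u
    have F: "F u \<le> F 2" "0 \<le> F u"
      using mono[of u 2] F2[of u] mono[of 1 u] F0[of u] F0[of 1] by linarith+
    then show "0 \<le> c 0 u" "c 0 u \<le> 1" using Fpos by (auto simp: c_def)
    show "u \<le> 1 \<Longrightarrow> c 0 u = 1" using F0[of u] by (simp add: c_def)
    show "u \<ge> 2 \<Longrightarrow> c 0 u = 0" using F2[of u] Fpos by (simp add: c_def)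
    show "u \<le> 1 \<or> u \<ge> 2 \<Longrightarrow> c (Suc j) u = 0" for j using b0[of u j] by (simp add: c_def)
  qed
qed

subsection \<open>Lattice sums of functions of \<open>\<phi>\<close>\<close>

text \<open>Successive derivatives of a function that is constant left of \<open>c1\<close> and zero
  right of \<open>c2\<close>. The constant is left open so as to cover both the weights of the
  shells (constant 0) and the cutoff itself (constant 1).\<close>

definition cutoff_family :: "real \<Rightarrow> real \<Rightarrow> (nat \<Rightarrow> real \<Rightarrow> real) \<Rightarrow> bool" where
  "cutoff_family c1 c2 H \<longleftrightarrow> (\<forall>j u. (H j has_real_derivative H (Suc j) u) (at u)) \<and>
     (\<forall>u<c1. H 0 u = H 0 0) \<and> (\<forall>j. \<forall>u<c1. H (Suc j) u = 0) \<and> (\<forall>j. \<forall>u>c2. H j u = 0)"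

lemma cutoff_familyD:
  assumes "cutoff_family c1 c2 H"
  shows "(H j has_real_derivative H (Suc j) u) (at u)" "u < c1 \<Longrightarrow> H 0 u = H 0 0"
    "u < c1 \<Longrightarrow> H (Suc j) u = 0" "u > c2 \<Longrightarrow> H j u = 0"
  using assms unfolding cutoff_family_def by blast+

context dilation
begin

abbreviation "D H v m x \<equiv> dir_deriv \<phi> H v m (\<lambda>_. 1) 0 x"

text \<open>Starting from the coefficient 1, the first derivative either differentiates 1, which
  gives 0, or raises the index of \<open>H\<close> to at least 1, where \<open>H\<close> vanishes
  left of \<open>c1\<close>.\<close>

lemma D_near_0:
  assumes H: "cutoff_family c1 c2 H" and x: "\<phi> x < c1" shows "D H v (Suc m) x = 0"
proof -
  have "dir_deriv \<phi> H v m a (Suc 0) x = 0" for a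
  proof (rule dir_deriv_eq_0)
    fix i :: nat assume "Suc 0 \<le> i"
    then obtain k where "i = Suc k" by (cases i) auto
    then show "H i (\<phi> x) = 0" using cutoff_familyD(3)[OF H x] by simp
  qed
  then show ?thesis by (simp add: dir_deriv_zero)
qed

lemma D_far: "cutoff_family c1 c2 H \<Longrightarrow> \<phi> x > c2 \<Longrightarrow> D H v m x = 0"
  by (rule dir_deriv_eq_0) (rule cutoff_familyD(4))

text \<open>Away from the origin this is the chain rule. At the origin \<phi> may fail to be
  differentiable, but nearby \<phi> stays below \<open>c1\<close>, so the function is locally
  constant.\<close>

lemma D_has_real_derivative:
  assumes H: "cutoff_family c1 c2 H" and c1: "c1 > 0"
  shows "((\<lambda>u. D H v m (p + u *\<^sub>R v)) has_real_derivative D H v (Suc m) (p + u *\<^sub>R v)) (at u)"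
proof (cases "p + u *\<^sub>R v = 0")
  case False
  show ?thesis
  proof (rule dir_deriv_has_real_derivative[OF _ smooth])
    show "(H j has_real_derivative H (Suc j) u) (at u)" for j u by (rule cutoff_familyD(1)[OF H])
  qed (use False in \<open>auto intro: Cinf_on_const\<close>)
next
  case True
  let ?U = "{w. \<phi> (p + w *\<^sub>R v) < c1}"
  have op: "open ?U"
    by (intro open_Collect_less continuous_intros continuous_on_compose2[OF cont_on[of UNIV]]) auto
  have const: "D H v m (p + u *\<^sub>R v) = D H v m (p + w *\<^sub>R v)" if "w \<in> ?U" for w
  proof (cases m)
    case 0
    then show ?thesis using cutoff_familyD(2)[OF H, of "\<phi> (p + w *\<^sub>R v)"] that True by simp
  next
    case (Suc k)
    have "\<phi> (p + u *\<^sub>R v) < c1" using True c1 by simp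
    moreover have "\<phi> (p + w *\<^sub>R v) < c1" using that by simp
    ultimately show ?thesis unfolding Suc by (simp only: D_near_0[OF H])
  qed
  have "((\<lambda>_. D H v m (p + u *\<^sub>R v)) has_real_derivative 0) (at u)" by simp
  then have "((\<lambda>u. D H v m (p + u *\<^sub>R v)) has_real_derivative 0) (at u)"
    by (rule has_field_derivative_transform_within_open[OF _ op]) (use True c1 in simp, erule const)
  moreover have "D H v (Suc m) (p + u *\<^sub>R v) = 0" by (rule D_near_0[OF H]) (simp add: True c1)
  ultimately show ?thesis by (simp only:)
qed

text \<open>From order 1 on, the derivatives are supported in the shell where \<phi> lies between
  \<open>c1\<close> and \<open>c2\<close>, a compact set avoiding the origin, so the general bound
  applies there.\<close>

lemma D_bound:
  assumes c1: "c1 > 0" and m: "m \<ge> 1"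
  shows "\<exists>C\<ge>0. \<forall>H B v x. cutoff_family c1 c2 H \<longrightarrow> (\<forall>i\<le>m. \<forall>u. \<bar>H i u\<bar> \<le> B) \<longrightarrow>
    \<bar>D H v m x\<bar> \<le> C * norm v ^ m * B"
proof -
  let ?K = "{x. \<phi> x \<le> c2} \<inter> {x. c1 \<le> \<phi> x}"
  have "compact ?K"
    by (intro compact_Int_closed compact_sublevel closed_Collect_le continuous_intros cont_on)
  moreover have "?K \<subseteq> UNIV - {0}" using c1 by auto
  ultimately obtain C where C: "C \<ge> 0" "\<And>H B v x. x \<in> ?K \<Longrightarrow> (\<forall>i\<le>0 + m. \<forall>u. \<bar>H i u\<bar> \<le> B) \<Longrightarrow>
     \<bar>D H v m x\<bar> \<le> C * norm v ^ m * B"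
    using dir_deriv_bound[OF smooth _ _ _ Cinf_on_const, of ?K 0 m 1] by blast
  have "\<bar>D H v m x\<bar> \<le> C * norm v ^ m * B"
    if H: "cutoff_family c1 c2 H" and B: "\<forall>i\<le>m. \<forall>u. \<bar>H i u\<bar> \<le> B" for H B v x
  proof (cases "x \<in> ?K")
    case False
    then have "\<phi> x > c2 \<or> \<phi> x < c1" by auto
    then have "D H v m x = 0"
      using D_far[OF H] D_near_0[OF H, of x v "m - 1"] m by auto
    moreover have "B \<ge> 0" using B abs_ge_zero order_trans by blast
    ultimately show ?thesis using C(1) by simp
  qed (use C(2) B in auto)
  with C(1) show ?thesis by blast
qed

text \<open>Dividing \<phi> by \<open>T ^ J\<close> is composing it with
  \<open>P (1 / T ^ J)\<close>, which shortens axis vectors by \<open>q ^ J\<close>; so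
  \<open>m\<close> derivatives gain \<open>(q ^ m) ^ J\<close>. The support has radius of order
  \<open>Q ^ J\<close>, so the number of lattice points costs
  \<open>(Q ^ CARD('n)) ^ J\<close>.\<close>

lemma lattice_estimate_power:
  assumes c1: "c1 > 0" and m: "m \<ge> 1"
  shows "\<exists>C\<ge>0. \<forall>H B J Y. cutoff_family c1 c2 H \<longrightarrow> (\<forall>i\<le>m. \<forall>u. \<bar>H i u\<bar> \<le> B) \<longrightarrow>
    finite Y \<longrightarrow> Y \<subseteq> int_lattice \<longrightarrow> (\<forall>x\<in>int_lattice - Y. H 0 (\<phi> x / T ^ J) = 0) \<longrightarrow>
    integrable lborel (\<lambda>x. H 0 (\<phi> x / T ^ J)) \<and>
    \<bar>(\<Sum>x\<in>Y. H 0 (\<phi> x / T ^ J)) - (\<integral>x. H 0 (\<phi> x / T ^ J) \<partial>lborel)\<bar> \<le> C * B * (Q ^ CARD('n) * q ^ m) ^ J"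
proof -
  let ?n = "CARD('n)"
  obtain C where C: "C \<ge> 0" "\<And>H B v x. cutoff_family c1 c2 H \<Longrightarrow> (\<forall>i\<le>m. \<forall>u. \<bar>H i u\<bar> \<le> B) \<Longrightarrow>
    \<bar>D H v m x\<bar> \<le> C * norm v ^ m * B" using D_bound[OF c1 m, of c2] by blast
  obtain r where r: "r \<ge> 1" "\<And>j x. \<phi> x \<le> c2 * T ^ j \<Longrightarrow> norm x \<le> r * Q ^ j"
    using sublevel_norm_le by blast
  define C' where "C' = real ?n * (2 * (r + real ?n) + 1) ^ ?n * C"
  have C': "C' \<ge> 0" unfolding C'_def using C(1) r by simp
  have "integrable lborel (\<lambda>x. H 0 (\<phi> x / T ^ J)) \<and>
    \<bar>(\<Sum>x\<in>Y. H 0 (\<phi> x / T ^ J)) - (\<integral>x. H 0 (\<phi> x / T ^ J) \<partial>lborel)\<bar> \<le> C' * B * (Q ^ ?n * q ^ m) ^ J"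
    if H: "cutoff_family c1 c2 H" and B: "\<forall>i\<le>m. \<forall>u. \<bar>H i u\<bar> \<le> B"
      and Y: "finite Y" "Y \<subseteq> int_lattice" "\<forall>x\<in>int_lattice - Y. H 0 (\<phi> x / T ^ J) = 0" for H B J Y
  proof -
    let ?t = "1 / T ^ J"
    let ?f = "\<lambda>x. H 0 (\<phi> x / T ^ J)"
    \<comment> \<open>Differentiating the dilated function along an axis is differentiating
      \<open>H 0\<close> composed with \<phi> along the dilated axis vector, at the dilated
      point.\<close>
    let ?G = "\<lambda>i j x. D H (P ?t *v axis i 1) j (P ?t *v x)"
    let ?K = "C * (q ^ J) ^ m * B"
    have Bnn: "B \<ge> 0" using B abs_ge_zero order_trans by blast
    have G0: "?G i 0 = ?f" for i by auto
    have deriv: "((\<lambda>u. ?G i j (x + u *\<^sub>R axis i 1)) has_real_derivative ?G i (Suc j) (x + u *\<^sub>R axis i 1)) (at u)" for i j x u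
      using D_has_real_derivative[OF H c1, of "P ?t *v axis i 1" j "P ?t *v x" u]
      by (simp add: matrix_vector_right_distrib matrix_vector_mult_scaleR del: dir_deriv.simps)
    have supp: "?G i j x = 0" if "norm x > r * Q ^ J" for i j x
    proof -
      have "\<not> \<phi> x \<le> c2 * T ^ J" using r(2)[of x J] that by auto
      then show ?thesis by (intro D_far[OF H]) (simp add: field_simps)
    qed
    have bd: "\<bar>?G i m x\<bar> \<le> ?K" for i x
    proof -
      have "\<bar>?G i m x\<bar> \<le> C * norm (P ?t *v axis i 1) ^ m * B" by (rule C(2)[OF H B])
      also have "\<dots> \<le> ?K"
        using contract_power[of J "axis i 1"] Bnn C(1)
        by (intro mult_right_mono mult_left_mono power_mono) auto
      finally show ?thesis .
    qed
    have contf: "continuous_on UNIV ?f"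
    proof -
      have "continuous_on UNIV (H 0)"
        by (intro continuous_at_imp_continuous_on ballI DERIV_isCont) (rule cutoff_familyD(1)[OF H])
      then show ?thesis by (rule continuous_on_compose2) (auto intro!: continuous_intros cont_on)
    qed
    have "0 \<le> r * Q ^ J" using r Q by simp
    note L = lattice_sum_minus_integral[where G = ?G, OF G0 deriv supp bd m this contf Y(1,2) bspec[OF Y(3)]]
    \<comment> \<open>As \<open>Q ^ J \<ge> 1\<close>, it may be attached to the additive constants
      too; the point count becomes a constant times a pure power.\<close>
    have "real ?n * (2 * (r * Q ^ J + real ?n) + 1) ^ ?n * ?K \<le> real ?n * ((2 * (r + real ?n) + 1) * Q ^ J) ^ ?n * ?K"
    proof (intro mult_right_mono mult_left_mono power_mono)
      have "1 \<le> Q ^ J" using Q by simp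
      then have "2 * real ?n + 1 \<le> (2 * real ?n + 1) * Q ^ J" by (simp add: mult_le_cancel_left1)
      then show "2 * (r * Q ^ J + real ?n) + 1 \<le> (2 * (r + real ?n) + 1) * Q ^ J" by (simp add: algebra_simps)
    qed (use r Q q C Bnn in auto)
    also have "\<dots> = C' * B * (Q ^ ?n * q ^ m) ^ J"
      by (simp add: C'_def power_mult_distrib power_mult[symmetric] mult_ac)
    finally show ?thesis using L by linarith
  qed
  with C' show ?thesis by blast
qed

text \<open>The order \<open>m\<close> is taken so large that \<open>Q ^ CARD('n) * q ^ m\<close>
  drops below \<open>1 / (2 * T ^ M)\<close>. The part \<open>T ^ M\<close> is reserved for the
  scaling factor of the zeta terms when |Re s| \<le> M, and the 2 for geometric convergence.\<close>

lemma lattice_estimate: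
  assumes c1: "c1 > 0"
  shows "\<exists>m C. C \<ge> 0 \<and> (\<forall>H B J Y. cutoff_family c1 c2 H \<longrightarrow> (\<forall>i\<le>m. \<forall>u. \<bar>H i u\<bar> \<le> B) \<longrightarrow>
    finite Y \<longrightarrow> Y \<subseteq> int_lattice \<longrightarrow> (\<forall>x\<in>int_lattice - Y. H 0 (\<phi> x / T ^ J) = 0) \<longrightarrow>
    integrable lborel (\<lambda>x. H 0 (\<phi> x / T ^ J)) \<and>
    \<bar>(\<Sum>x\<in>Y. H 0 (\<phi> x / T ^ J)) - (\<integral>x. H 0 (\<phi> x / T ^ J) \<partial>lborel)\<bar> \<le> C * B * (1 / (2 * T ^ M)) ^ J)"
proof -
  have "(\<lambda>m. q ^ m) \<longlonglongrightarrow> 0" using q by (intro LIMSEQ_power_zero) auto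
  then have "(\<lambda>m. Q ^ CARD('n) * q ^ m) \<longlonglongrightarrow> Q ^ CARD('n) * 0" by (intro tendsto_mult tendsto_const)
  then have "eventually (\<lambda>m. Q ^ CARD('n) * q ^ m < 1 / (2 * T ^ M)) sequentially"
    by (rule order_tendstoD) simp
  then obtain m0 where "\<And>m. m \<ge> m0 \<Longrightarrow> Q ^ CARD('n) * q ^ m < 1 / (2 * T ^ M)"
    by (auto simp: eventually_sequentially)
  then have m: "Q ^ CARD('n) * q ^ Suc m0 < 1 / (2 * T ^ M)" using le_SucI by blast
  obtain C where C: "C \<ge> 0" "\<And>H B J Y. cutoff_family c1 c2 H \<Longrightarrow> (\<forall>i\<le>Suc m0. \<forall>u. \<bar>H i u\<bar> \<le> B) \<Longrightarrow>
    finite Y \<Longrightarrow> Y \<subseteq> int_lattice \<Longrightarrow> (\<forall>x\<in>int_lattice - Y. H 0 (\<phi> x / T ^ J) = 0) \<Longrightarrow>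
    integrable lborel (\<lambda>x. H 0 (\<phi> x / T ^ J)) \<and>
    \<bar>(\<Sum>x\<in>Y. H 0 (\<phi> x / T ^ J)) - (\<integral>x. H 0 (\<phi> x / T ^ J) \<partial>lborel)\<bar> \<le> C * B * (Q ^ CARD('n) * q ^ Suc m0) ^ J"
    using lattice_estimate_power[OF c1, of "Suc m0" c2] by auto
  have le: "C * B * (Q ^ CARD('n) * q ^ Suc m0) ^ J \<le> C * B * (1 / (2 * T ^ M)) ^ J" if "B \<ge> 0" for B J
    using m that C(1) q Q by (intro mult_left_mono power_mono mult_nonneg_nonneg) auto
  show ?thesis
  proof (intro exI[of _ "Suc m0"] exI[of _ C] conjI allI impI, goal_cases)
    case (2 H B J Y)
    then show ?case using C(2)[of H B Y J] by blast
  next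
    case (3 H B J Y)
    have "B \<ge> 0" using 3(2) abs_ge_zero order_trans by blast
    from le[OF this, of J] C(2)[OF 3] show ?case by linarith
  qed (rule C(1))
qed

end

subsection \<open>Continuation of the zeta function\<close>

lemma has_vector_derivative_of_real_powr:
  assumes "u > (0::real)"
  shows "((\<lambda>u. complex_of_real u powr z) has_vector_derivative z * complex_of_real u powr (z - 1)) (at u)"
proof -
  have "((\<lambda>w. w powr z) has_field_derivative z * complex_of_real u powr (z - 1)) (at (complex_of_real u))"
    by (rule has_field_derivative_powr) (use assms in \<open>auto simp: complex_nonpos_Reals_iff\<close>)
  from has_vector_derivative_real_field[OF this] show ?thesis .
qed

lemma norm_of_real_powr: "u > 0 \<Longrightarrow> norm (complex_of_real u powr z) = u powr Re z"
  by (simp add: norm_powr_real_powr)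

locale cutoff_dilation = dilation A \<phi> T q Q
  for A :: "real^'n^'n" and \<phi> :: "real^'n \<Rightarrow> real" and T q Q :: real +
  fixes c :: "nat \<Rightarrow> real \<Rightarrow> real"
  assumes c_deriv: "\<And>j u. (c j has_real_derivative c (Suc j) u) (at u)"
    and c_1: "\<And>u. u \<le> 1 \<Longrightarrow> c 0 u = 1" and c_2: "\<And>u. u \<ge> 2 \<Longrightarrow> c 0 u = 0"
    and c_nonneg: "\<And>u. 0 \<le> c 0 u" and c_le_1: "\<And>u. c 0 u \<le> 1"
    and c_Suc: "\<And>j u. u \<le> 1 \<or> u \<ge> 2 \<Longrightarrow> c (Suc j) u = 0"
begin

abbreviation "\<alpha> \<equiv> trace A"

lemma T_nonneg [simp]: "0 \<le> T" "0 \<le> T ^ j" using T by auto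

lemma c_cont: "continuous_on S (c j)"
  by (intro continuous_at_imp_continuous_on ballI DERIV_isCont) (rule c_deriv)

lemma c_bounded: "\<exists>E\<ge>0. \<forall>u. \<bar>c j u\<bar> \<le> E"
proof (cases j)
  case 0
  then show ?thesis using c_nonneg c_le_1 by (intro exI[of _ 1]) (simp add: abs_le_iff)
next
  case (Suc k)
  have "bounded (c j ` {1..2})"
    by (intro compact_imp_bounded compact_continuous_image c_cont) auto
  then obtain E where "\<forall>y\<in>c j ` {1..2}. norm y \<le> E" unfolding bounded_iff by blast
  then have E: "\<And>u. u \<in> {1..2} \<Longrightarrow> \<bar>c j u\<bar> \<le> E" by simp
  have "\<bar>c j u\<bar> \<le> \<bar>E\<bar>" for u
  proof (cases "u \<in> {1..2}")
    case False
    then show ?thesis using c_Suc[of u k] Suc by auto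
  qed (use E[of u] in auto)
  then show ?thesis by (intro exI[of _ "\<bar>E\<bar>"]) auto
qed

text \<open>Derivatives of the smooth shell function c (u / T) - c u, supported in [1, 2 T]. Its
  rescalings by powers of \<open>T\<close> telescope to differences of cutoffs.\<close>

definition eta :: "nat \<Rightarrow> real \<Rightarrow> real" where
  "eta k u = c k (u / T) / T ^ k - c k u"

lemma eta_deriv: "(eta k has_real_derivative eta (Suc k) u) (at u)"
proof -
  have "((\<lambda>u. c k (u / T)) has_real_derivative c (Suc k) (u / T) * (1 / T)) (at u)"
    by (rule DERIV_chain2[OF c_deriv]) (auto intro!: derivative_eq_intros)
  from DERIV_diff[OF DERIV_cdivide[OF this, of "T ^ k"] c_deriv[of k u]]
  have "((\<lambda>u. c k (u / T) / T ^ k - c k u) has_real_derivative eta (Suc k) u) (at u)"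
    by (simp add: eta_def)
  moreover have "eta k = (\<lambda>u. c k (u / T) / T ^ k - c k u)" by (auto simp: eta_def)
  ultimately show ?thesis by simp
qed

lemma eta_eq_0: assumes "u \<le> 1 \<or> u \<ge> 2 * T" shows "eta k u = 0"
proof -
  have "u \<le> 1 \<Longrightarrow> u / T \<le> 1" "u \<ge> 2 * T \<Longrightarrow> u \<ge> 2 \<and> u / T \<ge> 2"
    using T by (auto simp: field_simps)
  then show ?thesis using assms
    by (cases k) (auto simp: eta_def c_1 c_2 c_Suc)
qed

lemma eta_bounded: "\<exists>E\<ge>0. \<forall>u. \<bar>eta k u\<bar> \<le> E"
proof -
  obtain E where E: "E \<ge> 0" "\<And>u. \<bar>c k u\<bar> \<le> E" using c_bounded[of k] by blast
  have "\<bar>eta k u\<bar> \<le> E / T ^ k + E" for u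
  proof -
    have "\<bar>eta k u\<bar> \<le> \<bar>c k (u / T) / T ^ k\<bar> + \<bar>c k u\<bar>" unfolding eta_def by (rule abs_triangle_ineq4)
    also have "\<bar>c k (u / T) / T ^ k\<bar> \<le> E / T ^ k" 
      using E(2)[of "u / T"] divide_right_mono[of "\<bar>c k (u / T)\<bar>" E "T ^ k"] T by (simp add: abs_divide power_abs)
    finally show ?thesis using E(2)[of u] by simp
  qed
  then show ?thesis using E(1) by (intro exI[of _ "E / T ^ k + E"]) auto
qed

text \<open>\<open>weight i k s\<close> is the \<open>i\<close>-th derivative of \<open>u \<mapsto> eta k u \<cdot> u\<^sup>-\<^sup>s\<close>.\<close>

primrec weight :: "nat \<Rightarrow> nat \<Rightarrow> complex \<Rightarrow> real \<Rightarrow> complex" where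
  "weight 0 k s u = complex_of_real (eta k u) * complex_of_real u powr (- s)"
| "weight (Suc i) k s u = weight i (Suc k) s u - s * weight i k (s + 1) u"

lemma weight_eq_0: "u \<le> 1 \<or> u \<ge> 2 * T \<Longrightarrow> weight i k s u = 0"
  by (induction i arbitrary: k s) (simp_all add: eta_eq_0)

lemma weight_deriv: "(weight i k s has_vector_derivative weight (Suc i) k s u) (at u)"
proof (induction i arbitrary: k s)
  case 0
  show ?case
  proof (cases "u < 1")
    case True
    have "((\<lambda>_. 0) has_vector_derivative 0) (at u)" by simp
    then have "(weight 0 k s has_vector_derivative 0) (at u)"
      by (rule has_vector_derivative_transform_within_open[of _ _ _ "{..<1}"]) (use True in \<open>auto simp: eta_eq_0\<close>)
    moreover have "weight (Suc 0) k s u = 0" using True by (intro weight_eq_0) simp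
    ultimately show ?thesis by (simp only:)
  next
    case False
    have 1: "((\<lambda>u. complex_of_real (eta k u)) has_vector_derivative complex_of_real (eta (Suc k) u)) (at u)"
      using eta_deriv[of k u] by (intro has_vector_derivative_of_real) (simp add: has_real_derivative_iff_has_vector_derivative)
    have "((\<lambda>u. complex_of_real (eta k u) * complex_of_real u powr (- s)) has_vector_derivative
        complex_of_real (eta k u) * (- s * complex_of_real u powr (- s - 1)) + complex_of_real (eta (Suc k) u) * complex_of_real u powr (- s)) (at u)"
      by (rule has_vector_derivative_mult[OF 1 has_vector_derivative_of_real_powr]) (use False in simp)
    moreover have "weight 0 k s = (\<lambda>u. complex_of_real (eta k u) * complex_of_real u powr (- s))" by auto
    moreover have "complex_of_real (eta k u) * (- s * complex_of_real u powr (- s - 1)) +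
        complex_of_real (eta (Suc k) u) * complex_of_real u powr (- s) = weight (Suc 0) k s u"
    proof -
      have "a * (- s * x) + b * y = b * y - s * (a * x)" for a b x y :: complex
        by (simp add: algebra_simps)
      moreover have "- s - 1 = - (s + 1)" by simp
      ultimately show ?thesis by (simp only: weight.simps)
    qed
    ultimately show ?thesis by (simp only:)
  qed
next
  case (Suc i)
  have eq: "weight (Suc i) k s = (\<lambda>u. weight i (Suc k) s u - s * weight i k (s + 1) u)" by auto
  show ?case unfolding eq weight.simps(2)[of "Suc i"]
    by (intro has_vector_derivative_diff has_vector_derivative_mult_right Suc.IH)
qed

text \<open>Each derivative either hits \<open>eta\<close> or brings down a factor \<open>s\<close>
  and replaces \<open>s\<close> by \<open>s + 1\<close>. Hence the degree \<open>i\<close> in the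
  norm of \<open>s\<close>, and an induction over all strips, since the strip widens by 1 at each
  step.\<close>

lemma weight_bound:
  assumes "M \<ge> 0"
  shows "\<exists>C\<ge>0. \<forall>s u. \<bar>Re s\<bar> \<le> M \<longrightarrow> norm (weight i k s u) \<le> C * (1 + norm s) ^ i"
  using assms
proof (induction i arbitrary: k M)
  case 0
  obtain E where E: "E \<ge> 0" "\<And>u. \<bar>eta k u\<bar> \<le> E" using eta_bounded[of k] by blast
  have "norm (weight 0 k s u) \<le> E * (2 * T) powr M" if "\<bar>Re s\<bar> \<le> M" for s u
  proof (cases "u \<le> 1 \<or> u \<ge> 2 * T")
    case True
    then show ?thesis using E(1) by (simp only: weight_eq_0) simp
  next
    case False
    \<comment> \<open>Only arguments strictly between 1 and 2 T remain here, so the power is largest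
      for exponent \<open>M\<close> at the right end.\<close>
    have "u powr (- Re s) \<le> u powr M" using False that by (intro powr_mono) auto
    also have "\<dots> \<le> (2 * T) powr M" using False 0 by (intro powr_mono2) auto
    finally show ?thesis using E False
      by (auto simp: norm_mult norm_of_real_powr intro!: mult_mono)
  qed
  then show ?case using E(1) by (intro exI[of _ "E * (2 * T) powr M"]) auto
next
  case (Suc i)
  obtain C1 where C1: "C1 \<ge> 0" "\<And>s u. \<bar>Re s\<bar> \<le> M \<Longrightarrow> norm (weight i (Suc k) s u) \<le> C1 * (1 + norm s) ^ i"
    using Suc.IH[OF Suc.prems, of "Suc k"] by blast
  obtain C2 where C2: "C2 \<ge> 0" "\<And>s u. \<bar>Re s\<bar> \<le> M + 1 \<Longrightarrow> norm (weight i k s u) \<le> C2 * (1 + norm s) ^ i"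
    using Suc.IH[of "M + 1" k] Suc.prems by auto
  have "norm (weight (Suc i) k s u) \<le> (C1 + C2 * 2 ^ i) * (1 + norm s) ^ Suc i" if s: "\<bar>Re s\<bar> \<le> M" for s u
  proof -
    have "norm (weight i (Suc k) s u) \<le> C1 * (1 + norm s) ^ i" by (rule C1(2)[OF s])
    also have "\<dots> \<le> C1 * (1 + norm s) ^ Suc i" using C1(1) by (intro mult_left_mono power_increasing) auto
    finally have 1: "norm (weight i (Suc k) s u) \<le> C1 * (1 + norm s) ^ Suc i" .
    have "norm (s + 1) \<le> norm s + 1" using norm_triangle_ineq[of s 1] by simp
    have "norm (weight i k (s + 1) u) \<le> C2 * (1 + norm (s + 1)) ^ i" by (rule C2(2)) (use s in auto)
    also have "\<dots> \<le> C2 * (2 * (1 + norm s)) ^ i"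
    proof (intro mult_left_mono power_mono)
      have "1 + a \<le> 2 * (1 + b)" if "a \<le> b + 1" "0 \<le> b" for a b :: real using that by simp
      from this[OF \<open>norm (s + 1) \<le> norm s + 1\<close> norm_ge_zero] show "1 + norm (s + 1) \<le> 2 * (1 + norm s)" .
    qed (use C2(1) in auto)
    finally have "norm s * norm (weight i k (s + 1) u) \<le> (1 + norm s) * (C2 * (2 * (1 + norm s)) ^ i)"
      by (intro mult_mono) auto
    then have 2: "norm (s * weight i k (s + 1) u) \<le> C2 * 2 ^ i * (1 + norm s) ^ Suc i"
      by (simp only: norm_mult power_mult_distrib power_Suc mult_ac)
    show ?thesis using norm_triangle_ineq4[of "weight i (Suc k) s u" "s * weight i k (s + 1) u"] 1 2
      by (simp add: algebra_simps)
  qed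
  moreover have "C1 + C2 * 2 ^ i \<ge> 0" using C1 C2 by simp
  ultimately show ?case by blast
qed

text \<open>The lattice estimate is about real functions, so the complex weights enter through their
  real and imaginary parts.\<close>

lemma weight_cutoff_family:
  "cutoff_family 1 (2 * T) (\<lambda>i u. Re (weight i 0 s u))" "cutoff_family 1 (2 * T) (\<lambda>i u. Im (weight i 0 s u))"
proof -
  have "((\<lambda>u. Re (weight i 0 s u)) has_real_derivative Re (weight (Suc i) 0 s u)) (at u)"
    "((\<lambda>u. Im (weight i 0 s u)) has_real_derivative Im (weight (Suc i) 0 s u)) (at u)" for i u
    using weight_deriv[of i 0 s u] unfolding has_vector_derivative_complex_iff by simp_all
  moreover have "weight i 0 s u = 0" if "u < 1 \<or> u > 2 * T" for i u using that by (intro weight_eq_0) auto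
  ultimately show "cutoff_family 1 (2 * T) (\<lambda>i u. Re (weight i 0 s u))"
    "cutoff_family 1 (2 * T) (\<lambda>i u. Im (weight i 0 s u))"
    unfolding cutoff_family_def by (simp_all del: weight.simps)
qed

definition lattice_upto :: "real \<Rightarrow> (real^'n) set" where
  "lattice_upto R = {x\<in>int_lattice - {0}. \<phi> x \<le> R}"

lemma finite_lattice_upto [simp]: "finite (lattice_upto R)"
proof -
  obtain r where r: "\<And>x. \<phi> x \<le> R \<Longrightarrow> norm x \<le> r" using bounded_sublevel[of R] by (auto simp: bounded_iff)
  have "lattice_upto R \<subseteq> {x\<in>int_lattice. norm x \<le> \<bar>r\<bar>}" using r by (force simp: lattice_upto_def)
  then show ?thesis using int_lattice_ball(1)[of "\<bar>r\<bar>"] finite_subset by (metis abs_ge_zero)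
qed

lemma lattice_upto_pos: "x \<in> lattice_upto R \<Longrightarrow> \<phi> x > 0"
  by (auto simp: lattice_upto_def intro: phi_pos)

text \<open>The lattice estimate is linear in the bound on the derivatives, so the polynomial bounds
  for the weights pass directly to the error. This is the origin of the polynomial growth of the
  continued zeta function on strips.\<close>

lemma weight_lattice_estimate:
  "\<exists>m C. C \<ge> 0 \<and> (\<forall>s J. \<bar>Re s\<bar> \<le> real M \<longrightarrow>
    integrable lborel (\<lambda>x. weight 0 0 s (\<phi> x / T ^ J)) \<and>
    norm ((\<Sum>x\<in>lattice_upto (2 * T ^ Suc J). weight 0 0 s (\<phi> x / T ^ J)) - (\<integral>x. weight 0 0 s (\<phi> x / T ^ J) \<partial>lborel))
      \<le> C * (1 + norm s) ^ m * (1 / (2 * T ^ M)) ^ J)"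
proof -
  obtain m C where C: "C \<ge> 0" and est: "\<And>H B J Y. cutoff_family 1 (2 * T) H \<Longrightarrow> (\<forall>i\<le>m. \<forall>u. \<bar>H i u\<bar> \<le> B) \<Longrightarrow>
    finite Y \<Longrightarrow> Y \<subseteq> int_lattice \<Longrightarrow> (\<forall>x\<in>int_lattice - Y. H 0 (\<phi> x / T ^ J) = 0) \<Longrightarrow>
    integrable lborel (\<lambda>x. H 0 (\<phi> x / T ^ J)) \<and>
    \<bar>(\<Sum>x\<in>Y. H 0 (\<phi> x / T ^ J)) - (\<integral>x. H 0 (\<phi> x / T ^ J) \<partial>lborel)\<bar> \<le> C * B * (1 / (2 * T ^ M)) ^ J"
    using lattice_estimate[OF zero_less_one, of "2 * T" M] by blast
  have "\<forall>i. \<exists>E\<ge>0. \<forall>s u. \<bar>Re s\<bar> \<le> real M \<longrightarrow> norm (weight i 0 s u) \<le> E * (1 + norm s) ^ i"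
    by (intro allI weight_bound) simp
  then obtain E where E: "\<And>i. E i \<ge> 0" "\<And>i s u. \<bar>Re s\<bar> \<le> real M \<Longrightarrow> norm (weight i 0 s u) \<le> E i * (1 + norm s) ^ i"
    by metis
  define E' where "E' = (\<Sum>i\<le>m. E i)"
  have E': "E' \<ge> 0" "E i \<le> E'" if "i \<le> m" for i
    unfolding E'_def using that E(1) by (auto intro!: sum_nonneg member_le_sum)
  have "integrable lborel (\<lambda>x. weight 0 0 s (\<phi> x / T ^ J)) \<and>
    norm ((\<Sum>x\<in>lattice_upto (2 * T ^ Suc J). weight 0 0 s (\<phi> x / T ^ J)) - (\<integral>x. weight 0 0 s (\<phi> x / T ^ J) \<partial>lborel))
      \<le> 2 * C * E' * (1 + norm s) ^ m * (1 / (2 * T ^ M)) ^ J" if s: "\<bar>Re s\<bar> \<le> real M" for s J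
  proof -
    let ?f = "\<lambda>x. weight 0 0 s (\<phi> x / T ^ J)"
    \<comment> \<open>The weight vanishes as soon as \<phi> x / T ^ J \<ge> 2 T, hence the exponent
      \<open>Suc J\<close>. It also vanishes at x = 0, so omitting the origin changes
      nothing.\<close>
    let ?Y = "lattice_upto (2 * T ^ Suc J)"
    let ?B = "E' * (1 + norm s) ^ m"
    have w: "norm (weight i 0 s u) \<le> ?B" if "i \<le> m" for i u
    proof -
      have "norm (weight i 0 s u) \<le> E i * (1 + norm s) ^ i" by (rule E(2)[OF s])
      also have "\<dots> \<le> ?B" using E(1) E'[OF that] that by (intro mult_mono power_increasing) auto
      finally show ?thesis .
    qed
    have z: "?f x = 0" if "x \<in> int_lattice - ?Y" for x
    proof -
      have "x = 0 \<or> \<phi> x > 2 * T ^ Suc J" using that by (auto simp: lattice_upto_def)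
      then show ?thesis by (intro weight_eq_0) (auto simp: field_simps)
    qed
    have Y: "?Y \<subseteq> int_lattice" by (auto simp: lattice_upto_def)
    have re: "integrable lborel (\<lambda>x. Re (?f x)) \<and>
      \<bar>(\<Sum>x\<in>?Y. Re (?f x)) - (\<integral>x. Re (?f x) \<partial>lborel)\<bar> \<le> C * ?B * (1 / (2 * T ^ M)) ^ J"
      by (rule est[OF weight_cutoff_family(1)]) (use Y z w abs_Re_le_cmod order_trans in \<open>auto simp del: weight.simps, blast\<close>)
    have im: "integrable lborel (\<lambda>x. Im (?f x)) \<and>
      \<bar>(\<Sum>x\<in>?Y. Im (?f x)) - (\<integral>x. Im (?f x) \<partial>lborel)\<bar> \<le> C * ?B * (1 / (2 * T ^ M)) ^ J"
      by (rule est[OF weight_cutoff_family(2)]) (use Y z w abs_Im_le_cmod order_trans in \<open>auto simp del: weight.simps, blast\<close>)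
    have int: "integrable lborel ?f"
    proof -
      have "integrable lborel (\<lambda>x. complex_of_real (Re (?f x)) + \<i> * complex_of_real (Im (?f x)))"
        using re im by (intro Bochner_Integration.integrable_add integrable_of_real integrable_mult_right) auto
      then show ?thesis by (simp only: complex_eq[symmetric])
    qed
    let ?d = "(\<Sum>x\<in>?Y. ?f x) - (\<integral>x. ?f x \<partial>lborel)"
    have "\<bar>Re ?d\<bar> \<le> C * ?B * (1 / (2 * T ^ M)) ^ J" "\<bar>Im ?d\<bar> \<le> C * ?B * (1 / (2 * T ^ M)) ^ J"
      using re im integral_Re[OF int] integral_Im[OF int] by (simp_all add: Re_sum Im_sum del: weight.simps)
    then have "norm ?d \<le> 2 * C * E' * (1 + norm s) ^ m * (1 / (2 * T ^ M)) ^ J"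
      using cmod_le[of ?d] by (simp only: mult.assoc)
    with int show ?thesis by blast
  qed
  moreover have "2 * C * E' \<ge> 0" using C E'(1)[of 0] by simp
  ultimately show ?thesis by blast
qed

end

lemma geometric_increments:
  fixes f :: "nat \<Rightarrow> 'a::banach"
  assumes "\<And>j. norm (f (Suc j) - f j) \<le> K * (1 / 2) ^ j"
  shows "f \<longlonglongrightarrow> lim f" "norm (f j - lim f) \<le> 2 * K * (1 / 2) ^ j"
proof -
  have K: "K \<ge> 0" using order_trans[OF norm_ge_zero assms[of 0]] by simp
  have d: "norm (f (j + d) - f j) \<le> 2 * K * (1 / 2) ^ j * (1 - (1 / 2) ^ d)" for j d
  proof (induction d)
    case (Suc d)
    have "norm (f (j + Suc d) - f j) \<le> norm (f (Suc (j + d)) - f (j + d)) + norm (f (j + d) - f j)"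
      using norm_triangle_ineq[of "f (Suc (j + d)) - f (j + d)" "f (j + d) - f j"] by simp
    also have "\<dots> \<le> K * (1 / 2) ^ (j + d) + 2 * K * (1 / 2) ^ j * (1 - (1 / 2) ^ d)"
      by (intro add_mono assms Suc)
    also have "\<dots> = 2 * K * (1 / 2) ^ j * (1 - (1 / 2) ^ Suc d)"
      by (simp add: power_add algebra_simps)
    finally show ?case .
  qed simp
  have le: "norm (f (j + d) - f j) \<le> 2 * K * (1 / 2) ^ j" for j d
  proof -
    have "2 * K * (1 / 2) ^ j * (1 - (1 / 2) ^ d) \<le> 2 * K * (1 / 2) ^ j * 1" using K by (intro mult_left_mono) auto
    then show ?thesis using d[of j d] by simp
  qed
  have lim0: "(\<lambda>j. 2 * K * (1 / 2) ^ j) \<longlonglongrightarrow> 0"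
    by (intro tendsto_mult_right_zero LIMSEQ_power_zero) simp
  have "Cauchy f"
  proof (rule CauchyI')
    fix e :: real assume "e > 0"
    then obtain M where M: "2 * K * (1 / 2) ^ M < e / 2"
      using order_tendstoD(2)[OF lim0, of "e / 2"] by (auto simp: eventually_sequentially)
    show "\<exists>M. \<forall>m\<ge>M. \<forall>n>m. dist (f m) (f n) < e"
    proof (intro exI[of _ M] allI impI)
      fix m n assume mn: "M \<le> m" "m < n"
      have "norm (f m - f M) < e / 2" using le[of M "m - M"] M mn by simp
      moreover have "norm (f n - f M) < e / 2" using le[of M "n - M"] M mn by simp
      ultimately show "dist (f m) (f n) < e"
        using norm_triangle_ineq4[of "f m - f M" "f n - f M"] by (simp add: dist_norm)
    qed
  qed
  then have "convergent f" by (rule Cauchy_convergent)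
  then show lim: "f \<longlonglongrightarrow> lim f" by (simp only: convergent_LIMSEQ_iff)
  have "(\<lambda>d. norm (f (d + j) - f j)) \<longlonglongrightarrow> norm (lim f - f j)"
    by (intro tendsto_intros LIMSEQ_ignore_initial_segment lim)
  then have "norm (lim f - f j) \<le> 2 * K * (1 / 2) ^ j"
    by (rule LIMSEQ_le_const2) (use le[of j] in \<open>auto simp: add.commute\<close>)
  then show "norm (f j - lim f) \<le> 2 * K * (1 / 2) ^ j" by (simp add: norm_minus_commute)
qed

lemma has_sum_minus:
  fixes f g :: "'a \<Rightarrow> 'b::real_normed_vector"
  assumes "(f has_sum a) A" "(g has_sum b) A"
  shows "((\<lambda>x. f x - g x) has_sum (a - b)) A"
  using has_sum_add[OF assms(1), of "\<lambda>x. - g x" "- b"] assms(2) by (simp add: has_sum_uminus)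

lemma continuous_on_of_real_powr: "(\<And>u. u \<in> S \<Longrightarrow> u > (0::real)) \<Longrightarrow> continuous_on S (\<lambda>u. complex_of_real u powr z)"
  by (intro continuous_at_imp_continuous_on ballI has_vector_derivative_continuous[OF has_vector_derivative_of_real_powr]) blast

context cutoff_dilation
begin

text \<open>The gauge integral over an interval is the form in which the fundamental theorem and
  differentiation under the integral sign are applied below.\<close>

lemma integral_shell_HK:
  fixes k :: "real \<Rightarrow> complex"
  assumes k: "continuous_on {1..b} k" "k \<in> borel_measurable borel" and b: "b \<ge> 1"
  shows "(\<integral>x. indicator {1..b} (\<phi> x) *\<^sub>R k (\<phi> x) \<partial>lborel)
    = integral {1..b} (\<lambda>u. complex_of_real (\<alpha> * vol * u powr (\<alpha> - 1)) * k u)"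
proof -
  let ?g = "\<lambda>u. complex_of_real (\<alpha> * vol * u powr (\<alpha> - 1)) * k u"
  have "continuous_on {1..b} ?g" by (intro continuous_intros k) auto
  then have si: "set_integrable lborel {1..b} ?g" by (rule borel_integrable_atLeastAtMost')
  have "(\<integral>x. indicator {1..b} (\<phi> x) *\<^sub>R k (\<phi> x) \<partial>lborel) = (LINT u:{1..b}|lborel. ?g u)"
    unfolding integral_shell[OF k(2) b] set_lebesgue_integral_def
    by (intro Bochner_Integration.integral_cong refl) (simp add: scaleR_conv_of_real)
  then show ?thesis using set_borel_integral_eq_integral(2)[OF si] by simp
qed

text \<open>The Dirichlet series, smoothly truncated at height T ^ J.\<close>

definition Zpart :: "nat \<Rightarrow> complex \<Rightarrow> complex" where
  "Zpart J s = (\<Sum>x\<in>lattice_upto (2 * T ^ J). complex_of_real (c 0 (\<phi> x / T ^ J)) * complex_of_real (\<phi> x) powr (- s))"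

text \<open>The volume analogue of the truncated series: the integral of the truncated \<phi> ^ (-
  s) over the region \<phi> \<ge> 1, written in the variable u = \<phi> x with its density. Starting
  at 1 keeps the integral finite for every \<open>s\<close>.\<close>

definition Mpart :: "nat \<Rightarrow> complex \<Rightarrow> complex" where
  "Mpart J s = complex_of_real (\<alpha> * vol) *
     integral {1..2 * T ^ J} (\<lambda>u. complex_of_real (c 0 (u / T ^ J)) * complex_of_real u powr (complex_of_real \<alpha> - s - 1))"

definition Dpart :: "nat \<Rightarrow> complex \<Rightarrow> complex" where
  "Dpart J s = Zpart J s - Mpart J s"

definition Dlim :: "complex \<Rightarrow> complex" where
  "Dlim s = lim (\<lambda>J. Dpart J s)"

text \<open>For Re s > \<alpha> the quotient is the limit of \<open>Mpart\<close>, so the sum is the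
  limit of \<open>Zpart\<close>; the right-hand side makes sense for all s \<noteq>
  \<alpha>.\<close>

definition zfun :: "complex \<Rightarrow> complex" where
  "zfun s = complex_of_real (\<alpha> * vol) / (s - complex_of_real \<alpha>) + Dlim s"

lemma one_le_T_power [simp]: "1 \<le> T ^ J" using T by simp

lemma T_power_Suc: "2 * T ^ J \<le> 2 * T ^ Suc J" using T by simp

lemma c_scaled_far: "u > 2 * T ^ J \<Longrightarrow> c 0 (u / T ^ J) = 0"
  by (rule c_2) (simp add: le_divide_eq)

lemma c_scaled_nonzero: "c 0 (u / T ^ J) \<noteq> 0 \<Longrightarrow> u \<le> 2 * T ^ J"
  using c_scaled_far[of J u] by linarith

text \<open>Pulling out the scale turns one fixed weight into the difference of two consecutive
  truncations, so every step of the telescope involves the same function.\<close>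

lemma weight_scale:
  assumes "u > 0"
  shows "complex_of_real (T ^ J) powr (- s) * weight 0 0 s (u / T ^ J) =
    complex_of_real (c 0 (u / T ^ Suc J)) * complex_of_real u powr (- s)
    - complex_of_real (c 0 (u / T ^ J)) * complex_of_real u powr (- s)"
proof -
  have "complex_of_real (T ^ J) powr (- s) * complex_of_real (u / T ^ J) powr (- s) = complex_of_real u powr (- s)"
    using powr_times_real[of "complex_of_real (T ^ J)" "complex_of_real (u / T ^ J)" "- s"] assms by simp
  moreover have "a * ((e - f) * b) = e * (a * b) - f * (a * b)" for a b e f :: complex
    by (simp add: algebra_simps)
  moreover have "weight 0 0 s (u / T ^ J) = (complex_of_real (c 0 (u / T ^ Suc J)) - complex_of_real (c 0 (u / T ^ J))) *
      complex_of_real (u / T ^ J) powr (- s)"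
    by (simp add: eta_def mult.commute)
  ultimately show ?thesis by (simp only:)
qed

lemma Zpart_diff:
  "Zpart (Suc J) s - Zpart J s = complex_of_real (T ^ J) powr (- s) *
    (\<Sum>x\<in>lattice_upto (2 * T ^ Suc J). weight 0 0 s (\<phi> x / T ^ J))"
proof -
  let ?Y = "lattice_upto (2 * T ^ Suc J)"
  have "Zpart J s = (\<Sum>x\<in>?Y. complex_of_real (c 0 (\<phi> x / T ^ J)) * complex_of_real (\<phi> x) powr (- s))"
    unfolding Zpart_def
  proof (rule sum.mono_neutral_left)
    show "lattice_upto (2 * T ^ J) \<subseteq> ?Y" using T_power_Suc[of J] by (auto simp: lattice_upto_def simp del: power_Suc)
    show "\<forall>x\<in>?Y - lattice_upto (2 * T ^ J). complex_of_real (c 0 (\<phi> x / T ^ J)) * complex_of_real (\<phi> x) powr (- s) = 0"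
    proof
      fix x assume "x \<in> ?Y - lattice_upto (2 * T ^ J)"
      then have "2 \<le> \<phi> x / T ^ J" by (auto simp: lattice_upto_def field_simps)
      then show "complex_of_real (c 0 (\<phi> x / T ^ J)) * complex_of_real (\<phi> x) powr (- s) = 0" by (simp add: c_2)
    qed
  qed simp
  then show ?thesis
    unfolding Zpart_def[of "Suc J"] sum_distrib_left
    by (simp only: sum_subtractf[symmetric]) (intro sum.cong refl weight_scale[symmetric] lattice_upto_pos)
qed

lemma Mpart_integrand_cont:
  "continuous_on {1..b} (\<lambda>u. complex_of_real (c 0 (u / T ^ J)) * complex_of_real u powr z)"
  by (intro continuous_intros continuous_on_compose2[OF c_cont[of UNIV]] continuous_on_of_real_powr) auto

text \<open>Same factor and same weight as in \<open>Zpart_diff\<close>, with the lattice sum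
  replaced by the integral. Hence an increment of \<open>Dpart\<close> is exactly the error of the
  lattice estimate, times that factor.\<close>

lemma Mpart_diff:
  "Mpart (Suc J) s - Mpart J s = complex_of_real (T ^ J) powr (- s) * (\<integral>x. weight 0 0 s (\<phi> x / T ^ J) \<partial>lborel)"
proof -
  let ?b = "2 * T ^ Suc J" and ?t = "complex_of_real (T ^ J) powr (- s)"
  let ?z = "complex_of_real \<alpha> - s - 1"
  let ?g = "\<lambda>J u. complex_of_real (c 0 (u / T ^ J)) * complex_of_real u powr ?z"
  have b: "?b \<ge> 1" using one_le_T_power[of "Suc J"] by linarith
  have wcont: "continuous_on UNIV (weight 0 0 s)"
    by (intro continuous_at_imp_continuous_on ballI has_vector_derivative_continuous[OF weight_deriv])
  have wc: "continuous_on UNIV (\<lambda>u. weight 0 0 s (u / T ^ J))"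
    by (rule continuous_on_compose2[OF wcont]) (auto intro!: continuous_intros)
  have "(\<integral>x. weight 0 0 s (\<phi> x / T ^ J) \<partial>lborel) =
     (\<integral>x. indicator {1..?b} (\<phi> x) *\<^sub>R (\<lambda>u. weight 0 0 s (u / T ^ J)) (\<phi> x) \<partial>lborel)"
  proof (intro Bochner_Integration.integral_cong refl)
    fix x
    show "weight 0 0 s (\<phi> x / T ^ J) = indicator {1..?b} (\<phi> x) *\<^sub>R weight 0 0 s (\<phi> x / T ^ J)"
    proof (cases "\<phi> x \<in> {1..?b}")
      case False
      then consider "\<phi> x < 1" | "\<phi> x > 2 * T * T ^ J" by fastforce
      then have "\<phi> x / T ^ J \<le> 1 \<or> \<phi> x / T ^ J \<ge> 2 * T"
      proof cases
        case 1
        then have "\<phi> x \<le> T ^ J" using one_le_T_power[of J] by linarith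
        then show ?thesis by simp
      next
        case 2
        then show ?thesis by (simp add: le_divide_eq)
      qed
      then show ?thesis by (simp only: weight_eq_0) simp
    qed simp
  qed
  also have "\<dots> = integral {1..?b} (\<lambda>u. complex_of_real (\<alpha> * vol * u powr (\<alpha> - 1)) * weight 0 0 s (u / T ^ J))"
    by (rule integral_shell_HK[OF continuous_on_subset[OF wc] borel_measurable_continuous_onI[OF wc] b]) simp
  finally have "?t * (\<integral>x. weight 0 0 s (\<phi> x / T ^ J) \<partial>lborel) =
      integral {1..?b} (\<lambda>u. ?t * (complex_of_real (\<alpha> * vol * u powr (\<alpha> - 1)) * weight 0 0 s (u / T ^ J)))"
    by simp
  also have "\<dots> = integral {1..?b} (\<lambda>u. complex_of_real (\<alpha> * vol) * (?g (Suc J) u - ?g J u))"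
  proof (rule Henstock_Kurzweil_Integration.integral_cong)
    fix u assume "u \<in> {1..?b}"
    then have u: "u > 0" by simp
    have pz: "complex_of_real (u powr (\<alpha> - 1)) * complex_of_real u powr (- s) = complex_of_real u powr ?z"
    proof -
      have "complex_of_real (u powr (\<alpha> - 1)) = complex_of_real u powr complex_of_real (\<alpha> - 1)"
        using u by (intro powr_of_real[symmetric]) simp
      moreover have "complex_of_real (\<alpha> - 1) + - s = ?z" by simp
      ultimately show ?thesis by (simp only: powr_add[symmetric])
    qed
    then show "?t * (complex_of_real (\<alpha> * vol * u powr (\<alpha> - 1)) * weight 0 0 s (u / T ^ J)) =
        complex_of_real (\<alpha> * vol) * (?g (Suc J) u - ?g J u)"
    proof -
      have "t * ((a * p) * w) = a * (e * z - f * z)" if "p * r = z" "t * w = e * r - f * r" for t a p w e f z r :: complex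
      proof -
        have "t * ((a * p) * w) = a * p * (t * w)" by (simp add: mult_ac)
        also have "\<dots> = a * (e * (p * r) - f * (p * r))" unfolding that(2) by (simp add: algebra_simps)
        finally show ?thesis unfolding that(1) .
      qed
      from this[OF pz weight_scale[OF u, of J s]]
      show ?thesis by (simp only: of_real_mult)
    qed
  qed
  also have "\<dots> = complex_of_real (\<alpha> * vol) * (integral {1..?b} (?g (Suc J)) - integral {1..?b} (?g J))"
    by (simp only: Henstock_Kurzweil_Integration.integral_mult_right
      Henstock_Kurzweil_Integration.integral_diff[OF integrable_continuous_real[OF Mpart_integrand_cont] integrable_continuous_real[OF Mpart_integrand_cont]])
  \<comment> \<open>The cutoff at scale \<open>J\<close> vanishes beyond 2 T ^ J, so the longer
    common interval may be shortened.\<close>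
  also have "integral {1..?b} (?g J) = integral {1..2 * T ^ J} (?g J)"
  proof -
    have "integral {1..2 * T ^ J} (?g J) + integral {2 * T ^ J..?b} (?g J) = integral {1..?b} (?g J)"
      by (rule Henstock_Kurzweil_Integration.integral_combine)
        (use one_le_T_power[of J] T_power_Suc[of J] in \<open>auto intro!: integrable_continuous_real Mpart_integrand_cont simp del: power_Suc one_le_T_power\<close>)
    moreover have "integral {2 * T ^ J..?b} (?g J) = integral {2 * T ^ J..?b} (\<lambda>_. 0)"
      by (intro Henstock_Kurzweil_Integration.integral_cong) (auto simp: c_2 field_simps)
    ultimately show ?thesis by simp
  qed
  finally show ?thesis unfolding Mpart_def by (simp add: algebra_simps)
qed

text \<open>The scaling factor is at most \<open>(T ^ M) ^ J\<close> on the strip and cancels the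
  reserve built into the lattice estimate, leaving \<open>(1 / 2) ^ J\<close>.\<close>

lemma Dpart_diff_bound:
  "\<exists>m C. C \<ge> 0 \<and> (\<forall>s J. \<bar>Re s\<bar> \<le> real M \<longrightarrow>
     norm (Dpart (Suc J) s - Dpart J s) \<le> C * (1 + norm s) ^ m * (1 / 2) ^ J)"
proof -
  obtain m C where C: "C \<ge> 0" and est: "\<And>s J. \<bar>Re s\<bar> \<le> real M \<Longrightarrow>
    norm ((\<Sum>x\<in>lattice_upto (2 * T ^ Suc J). weight 0 0 s (\<phi> x / T ^ J)) - (\<integral>x. weight 0 0 s (\<phi> x / T ^ J) \<partial>lborel))
      \<le> C * (1 + norm s) ^ m * (1 / (2 * T ^ M)) ^ J" using weight_lattice_estimate[of M] by blast
  have "norm (Dpart (Suc J) s - Dpart J s) \<le> C * (1 + norm s) ^ m * (1 / 2) ^ J" if s: "\<bar>Re s\<bar> \<le> real M" for s J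
  proof -
    have "Dpart (Suc J) s - Dpart J s = (Zpart (Suc J) s - Zpart J s) - (Mpart (Suc J) s - Mpart J s)"
      by (simp add: Dpart_def)
    also have "\<dots> = complex_of_real (T ^ J) powr (- s) * ((\<Sum>x\<in>lattice_upto (2 * T ^ Suc J). weight 0 0 s (\<phi> x / T ^ J))
        - (\<integral>x. weight 0 0 s (\<phi> x / T ^ J) \<partial>lborel))"
      unfolding Zpart_diff Mpart_diff by (simp only: right_diff_distrib)
    finally have "norm (Dpart (Suc J) s - Dpart J s) = norm (complex_of_real (T ^ J) powr (- s)) *
       norm ((\<Sum>x\<in>lattice_upto (2 * T ^ Suc J). weight 0 0 s (\<phi> x / T ^ J)) - (\<integral>x. weight 0 0 s (\<phi> x / T ^ J) \<partial>lborel))"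
      by (simp only: norm_mult)
    also have "\<dots> \<le> (T ^ M) ^ J * (C * (1 + norm s) ^ m * (1 / (2 * T ^ M)) ^ J)"
    proof (intro mult_mono est s)
      have "norm (complex_of_real (T ^ J) powr (- s)) = (T ^ J) powr (- Re s)"
        by (subst norm_of_real_powr) auto
      also have "\<dots> \<le> (T ^ J) powr real M" using s by (intro powr_mono) auto
      also have "\<dots> = (T ^ M) ^ J" by (simp add: powr_realpow power_mult[symmetric] mult.commute)
      finally show "norm (complex_of_real (T ^ J) powr (- s)) \<le> (T ^ M) ^ J" .
    qed (simp_all del: weight.simps)
    also have "\<dots> = C * (1 + norm s) ^ m * (1 / 2) ^ J"
      by (simp add: power_divide power_mult_distrib)
    finally show ?thesis .
  qed
  with C show ?thesis by blast
qed

lemma Dlim_approx: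
  "\<exists>m C. C \<ge> 0 \<and> (\<forall>s. \<bar>Re s\<bar> \<le> real M \<longrightarrow> ((\<lambda>J. Dpart J s) \<longlonglongrightarrow> Dlim s) \<and>
     (\<forall>J. norm (Dpart J s - Dlim s) \<le> C * (1 + norm s) ^ m * (1 / 2) ^ J))"
proof -
  obtain m C where C: "C \<ge> 0" "\<And>s J. \<bar>Re s\<bar> \<le> real M \<Longrightarrow>
     norm (Dpart (Suc J) s - Dpart J s) \<le> C * (1 + norm s) ^ m * (1 / 2) ^ J" using Dpart_diff_bound[of M] by blast
  have "(\<lambda>J. Dpart J s) \<longlonglongrightarrow> Dlim s \<and> (\<forall>J. norm (Dpart J s - Dlim s) \<le> (2 * C) * (1 + norm s) ^ m * (1 / 2) ^ J)"
    if "\<bar>Re s\<bar> \<le> real M" for s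
    using geometric_increments[of "\<lambda>J. Dpart J s" "C * (1 + norm s) ^ m", OF C(2)[OF that]]
    unfolding Dlim_def by (simp add: mult.assoc)
  then show ?thesis using C(1) by (intro exI[of _ m] exI[of _ "2 * C"]) auto
qed

lemma Dpart_tendsto: "(\<lambda>J. Dpart J s) \<longlonglongrightarrow> Dlim s"
proof -
  have "\<bar>Re s\<bar> \<le> real (nat \<lceil>\<bar>Re s\<bar>\<rceil>)" by (simp add: real_nat_ceiling_ge)
  then show ?thesis using Dlim_approx[of "nat \<lceil>\<bar>Re s\<bar>\<rceil>"] by blast
qed

section \<open>Holomorphy and growth of the limit\<close>

lemma Zpart_holomorphic: "Zpart J holomorphic_on S"
proof -
  have "(\<lambda>s. \<Sum>x\<in>lattice_upto (2 * T ^ J). complex_of_real (c 0 (\<phi> x / T ^ J)) * complex_of_real (\<phi> x) powr (- s)) holomorphic_on S"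
    by (intro holomorphic_intros)
  then show ?thesis unfolding Zpart_def by simp
qed

lemma Mpart_holomorphic: "Mpart J holomorphic_on UNIV"
proof -
  let ?f = "\<lambda>s u. complex_of_real (c 0 (u / T ^ J)) * complex_of_real u powr (complex_of_real \<alpha> - s - 1)"
  let ?f' = "\<lambda>s u. complex_of_real (c 0 (u / T ^ J)) * (complex_of_real u powr (complex_of_real \<alpha> - s - 1) * (- Ln (complex_of_real u)))"
  have "(\<lambda>s. integral (cbox 1 (2 * T ^ J)) (?f s)) holomorphic_on UNIV"
  proof (rule leibniz_rule_holomorphic[of _ _ _ _ ?f'])
    fix s and u :: real assume "u \<in> cbox 1 (2 * T ^ J)"
    then have "complex_of_real u \<noteq> 0" by auto
    then show "((\<lambda>s. ?f s u) has_field_derivative ?f' s u) (at s within UNIV)"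
      by (auto intro!: derivative_eq_intros simp: powr_def)
  next
    fix s
    show "?f s integrable_on cbox 1 (2 * T ^ J)"
      using Mpart_integrand_cont by (auto intro!: integrable_continuous_real)
  next
    \<comment> \<open>Written with \<open>exp\<close> and the real logarithm, the derivative is
      visibly continuous in both variables jointly.\<close>
    have "continuous_on (UNIV \<times> cbox 1 (2 * T ^ J)) (\<lambda>p. complex_of_real (c 0 (snd p / T ^ J)) *
        (exp ((complex_of_real \<alpha> - fst p - 1) * complex_of_real (ln (snd p))) * (- complex_of_real (ln (snd p)))))"
      by (intro continuous_intros continuous_on_compose2[OF c_cont[of UNIV]]) auto
    then show "continuous_on (UNIV \<times> cbox 1 (2 * T ^ J)) (\<lambda>(s, u). ?f' s u)"
      by (rule continuous_on_eq) (auto simp: powr_def Ln_of_real)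
  qed auto
  then have "(\<lambda>s. complex_of_real (\<alpha> * vol) * integral (cbox 1 (2 * T ^ J)) (?f s)) holomorphic_on UNIV"
    by (intro holomorphic_intros)
  then show ?thesis unfolding Mpart_def by (simp add: fun_eq_iff)
qed

lemma Dpart_holomorphic: "Dpart J holomorphic_on UNIV"
proof -
  have "(\<lambda>s. Zpart J s - Mpart J s) holomorphic_on UNIV"
    by (intro holomorphic_on_diff Zpart_holomorphic Mpart_holomorphic)
  then show ?thesis unfolding Dpart_def by simp
qed

text \<open>The rate of convergence is uniform on strips up to a polynomial in the norm of
  \<open>s\<close>, hence uniform on discs.\<close>

lemma Dlim_holomorphic: "Dlim holomorphic_on S"
proof -
  have "Dlim holomorphic_on UNIV"
  proof (rule holomorphic_uniform_sequence[OF open_UNIV Dpart_holomorphic])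
    fix z :: complex
    \<comment> \<open>Large enough for the strip to contain the closed disc of radius 1 about
      \<open>z\<close>.\<close>
    define M where "M = nat \<lceil>\<bar>Re z\<bar> + 1\<rceil>"
    obtain m C where C: "C \<ge> 0" "\<And>s J. \<bar>Re s\<bar> \<le> real M \<Longrightarrow> norm (Dpart J s - Dlim s) \<le> C * (1 + norm s) ^ m * (1 / 2) ^ J"
      using Dlim_approx[of M] by blast
    have "uniform_limit (cball z 1) Dpart Dlim sequentially"
    proof (rule uniform_limitI)
      fix e :: real assume e: "e > 0"
      have "(\<lambda>J. C * (2 + norm z) ^ m * (1 / 2) ^ J) \<longlonglongrightarrow> 0"
        by (intro tendsto_mult_right_zero LIMSEQ_power_zero) simp
      then have "eventually (\<lambda>J. C * (2 + norm z) ^ m * (1 / 2) ^ J < e) sequentially"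
        using e by (rule order_tendstoD)
      then show "\<forall>\<^sub>F J in sequentially. \<forall>s\<in>cball z 1. dist (Dpart J s) (Dlim s) < e"
      proof (eventually_elim, intro ballI)
        fix J s assume J: "C * (2 + norm z) ^ m * (1 / 2) ^ J < e" and s: "s \<in> cball z 1"
        then have nd: "norm (s - z) \<le> 1" by (simp add: dist_norm norm_minus_commute)
        then have "\<bar>Re s - Re z\<bar> \<le> 1" using abs_Re_le_cmod[of "s - z"] by simp
        then have "\<bar>Re s\<bar> \<le> real M" unfolding M_def by linarith
        then have "norm (Dpart J s - Dlim s) \<le> C * (1 + norm s) ^ m * (1 / 2) ^ J" by (rule C(2))
        also have "norm s \<le> norm z + 1" using nd norm_triangle_ineq2[of s z] by linarith
        then have "C * (1 + norm s) ^ m * (1 / 2) ^ J \<le> C * (2 + norm z) ^ m * (1 / 2) ^ J"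
          using C(1) by (intro mult_right_mono mult_left_mono power_mono) auto
        finally show "dist (Dpart J s) (Dlim s) < e" using J by (simp add: dist_norm)
      qed
    qed
    then show "\<exists>d>0. cball z d \<subseteq> UNIV \<and> uniform_limit (cball z d) Dpart Dlim sequentially"
      by (intro exI[of _ 1]) auto
  qed
  then show ?thesis using holomorphic_on_subset by blast
qed

text \<open>\<open>Dpart 0\<close> is a finite sum minus an integral over [1, 2], both bounded on
  the strip; its distance to the limit is already polynomially bounded.\<close>

lemma Dlim_growth: "\<exists>m C. C \<ge> 0 \<and> (\<forall>s. \<bar>Re s\<bar> \<le> real M \<longrightarrow> norm (Dlim s) \<le> C * (1 + norm s) ^ m)"
proof -
  obtain m C where C: "C \<ge> 0" "\<And>s J. \<bar>Re s\<bar> \<le> real M \<Longrightarrow> norm (Dpart J s - Dlim s) \<le> C * (1 + norm s) ^ m * (1 / 2) ^ J"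
    using Dlim_approx[of M] by blast
  let ?L = "lattice_upto (2 * T ^ 0)"
  \<comment> \<open>Both powers occur because \<phi> x may lie on either side of 1 at the lattice
    points in question.\<close>
  define K1 where "K1 = (\<Sum>x\<in>?L. \<phi> x powr real M + \<phi> x powr (- real M))"
  define K2 where "K2 = \<alpha> * vol * 2 powr (\<alpha> + real M)"
  have K: "K1 \<ge> 0" "K2 \<ge> 0" using trace_pos vol_pos by (auto simp: K1_def K2_def intro!: sum_nonneg)
  have "norm (Dlim s) \<le> (C + K1 + K2) * (1 + norm s) ^ m" if s: "\<bar>Re s\<bar> \<le> real M" for s
  proof -
    have "norm (Zpart 0 s) \<le> K1"
      unfolding Zpart_def K1_def
    proof (rule sum_norm_le)
      fix x assume "x \<in> ?L"
      then have p: "\<phi> x > 0" by (rule lattice_upto_pos)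
      have "norm (complex_of_real (c 0 (\<phi> x / T ^ 0)) * complex_of_real (\<phi> x) powr (- s)) \<le> 1 * \<phi> x powr (- Re s)"
        unfolding norm_mult using p c_nonneg c_le_1 by (intro mult_mono) (auto simp: norm_of_real_powr)
      also have "\<dots> \<le> \<phi> x powr real M + \<phi> x powr (- real M)"
      proof (cases "\<phi> x \<ge> 1")
        case True
        then have "\<phi> x powr (- Re s) \<le> \<phi> x powr real M" using s by (intro powr_mono) auto
        then show ?thesis using powr_ge_zero[of "\<phi> x" "- real M"] by linarith
      next
        case False
        then have "\<phi> x powr (- Re s) \<le> \<phi> x powr (- real M)" using s p by (intro powr_mono') auto
        then show ?thesis using powr_ge_zero[of "\<phi> x" "real M"] by linarith
      qed
      finally show "norm (complex_of_real (c 0 (\<phi> x / T ^ 0)) * complex_of_real (\<phi> x) powr (- s)) \<le>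
        \<phi> x powr real M + \<phi> x powr (- real M)" .
    qed
    moreover have "norm (Mpart 0 s) \<le> K2"
    proof -
      have "norm (integral {1..2} (\<lambda>u. complex_of_real (c 0 (u / T ^ 0)) * complex_of_real u powr (complex_of_real \<alpha> - s - 1)))
          \<le> 2 powr (\<alpha> + real M) * (2 - 1)"
      proof (rule integral_bound[OF _ Mpart_integrand_cont])
        fix u :: real assume u: "u \<in> {1..2}"
        have "norm (complex_of_real (c 0 (u / T ^ 0)) * complex_of_real u powr (complex_of_real \<alpha> - s - 1))
            \<le> 1 * u powr (\<alpha> - Re s - 1)"
          unfolding norm_mult using u c_nonneg c_le_1 by (intro mult_mono) (auto simp: norm_of_real_powr)
        also have "u powr (\<alpha> - Re s - 1) \<le> u powr (\<alpha> + real M)" using u s by (intro powr_mono) auto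
        also have "\<dots> \<le> 2 powr (\<alpha> + real M)" using u trace_pos by (intro powr_mono2) auto
        finally show "norm (complex_of_real (c 0 (u / T ^ 0)) * complex_of_real u powr (complex_of_real \<alpha> - s - 1))
          \<le> 2 powr (\<alpha> + real M)" by simp
      qed simp
      then show ?thesis unfolding Mpart_def K2_def norm_mult using trace_pos vol_pos
        by (auto intro!: mult_mono simp: norm_mult)
    qed
    ultimately have "norm (Dpart 0 s) \<le> K1 + K2" unfolding Dpart_def 
      using norm_triangle_ineq4[of "Zpart 0 s" "Mpart 0 s"] by linarith
    moreover have "norm (Dlim s) \<le> norm (Dpart 0 s) + norm (Dpart 0 s - Dlim s)"
      using norm_triangle_ineq4[of "Dpart 0 s" "Dpart 0 s - Dlim s"] by simp
    moreover have "norm (Dpart 0 s - Dlim s) \<le> C * (1 + norm s) ^ m" using C(2)[OF s, of 0] by simp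
    moreover have "(K1 + K2) * 1 \<le> (K1 + K2) * (1 + norm s) ^ m" using K by (intro mult_left_mono) auto
    ultimately show ?thesis by (simp add: algebra_simps)
  qed
  then show ?thesis using C(1) K by (intro exI[of _ m] exI[of _ "C + K1 + K2"]) auto
qed

text \<open>With R = T ^ J the cutoff is 1 on [1, R], where the integral is explicit. The remaining
  terms are of order R ^ (\<alpha> - Re s), which tends to 0.\<close>

lemma Mpart_tendsto:
  assumes s: "Re s > \<alpha>"
  shows "(\<lambda>J. Mpart J s) \<longlonglongrightarrow> complex_of_real (\<alpha> * vol) / (s - complex_of_real \<alpha>)"
proof -
  let ?z = "complex_of_real \<alpha> - s" and ?r = "\<alpha> - Re s"
  have z: "?z \<noteq> 0" using s by (auto simp: complex_eq_iff)
  let ?g = "\<lambda>J u. complex_of_real (c 0 (u / T ^ J)) * complex_of_real u powr (?z - 1)"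
  have bound: "norm (integral {1..2 * T ^ J} (?g J) + 1 / ?z) \<le> (T powr ?r) ^ J * (1 / norm ?z + 1)" for J
  proof -
    let ?R = "T ^ J"
    have R: "?R \<ge> 1" by simp
    have "((\<lambda>u. complex_of_real u powr (?z - 1)) has_integral
        (complex_of_real ?R powr ?z / ?z - complex_of_real 1 powr ?z / ?z)) {1..?R}"
    proof (rule fundamental_theorem_of_calculus[OF R])
      fix u assume u: "u \<in> {1..?R}"
      have "((\<lambda>u. complex_of_real u powr ?z / ?z) has_vector_derivative (?z * complex_of_real u powr (?z - 1)) / ?z) (at u)"
        using u by (intro has_vector_derivative_divide has_vector_derivative_of_real_powr) auto
      then show "((\<lambda>u. complex_of_real u powr ?z / ?z) has_vector_derivative complex_of_real u powr (?z - 1)) (at u within {1..?R})"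
        using z by (auto intro: has_vector_derivative_at_within)
    qed
    then have "integral {1..?R} (\<lambda>u. complex_of_real u powr (?z - 1)) = complex_of_real ?R powr ?z / ?z - 1 / ?z"
      by (simp add: has_integral_iff)
    moreover have "integral {1..?R} (?g J) = integral {1..?R} (\<lambda>u. complex_of_real u powr (?z - 1))"
      by (intro Henstock_Kurzweil_Integration.integral_cong) (auto simp: c_1 field_simps)
    moreover have "integral {1..?R} (?g J) + integral {?R..2 * ?R} (?g J) = integral {1..2 * ?R} (?g J)"
      by (rule Henstock_Kurzweil_Integration.integral_combine[OF R])
        (auto intro!: integrable_continuous_real Mpart_integrand_cont)
    moreover have "g + y = x + g2" if "i1 = x - y" "g1 = i1" "g1 + g2 = g" for g g1 g2 i1 x y :: complex
      unfolding that(3)[symmetric] that(2) that(1) by simp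
    ultimately have eq: "integral {1..2 * ?R} (?g J) + 1 / ?z = complex_of_real ?R powr ?z / ?z + integral {?R..2 * ?R} (?g J)"
      by blast
    have pw: "?R powr ?r = (T powr ?r) ^ J"
      by (simp add: powr_powr powr_realpow[symmetric] mult.commute)
    have n1: "norm (complex_of_real ?R powr ?z / ?z) = (T powr ?r) ^ J / norm ?z"
      using norm_of_real_powr[of ?R ?z] pw by (simp add: norm_divide del: of_real_power)
    \<comment> \<open>The transition interval has length R and the power is decreasing, so its value
      at the left end bounds the integrand.\<close>
    have "norm (integral {?R..2 * ?R} (?g J)) \<le> ?R powr (?r - 1) * (2 * ?R - ?R)"
    proof (rule integral_bound)
      show "continuous_on {?R..2 * ?R} (?g J)"
        by (rule continuous_on_subset[OF Mpart_integrand_cont[of "2 * ?R"]]) auto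
      fix u assume u: "u \<in> {?R..2 * ?R}"
      then have "u > 0" using R by (auto intro: less_le_trans[OF T_pos(2)])
      have "norm (?g J u) \<le> 1 * u powr (?r - 1)"
        unfolding norm_mult using \<open>u > 0\<close> c_nonneg c_le_1 by (intro mult_mono) (auto simp: norm_of_real_powr)
      also have "u powr (?r - 1) \<le> ?R powr (?r - 1)" using u s by (intro powr_mono2') auto
      finally show "norm (?g J u) \<le> ?R powr (?r - 1)" by simp
    qed simp
    also have "\<dots> = (T powr ?r) ^ J" using pw by (simp add: powr_diff)
    finally have "norm (integral {?R..2 * ?R} (?g J)) \<le> (T powr ?r) ^ J" .
    then have "norm (complex_of_real ?R powr ?z / ?z + integral {?R..2 * ?R} (?g J)) \<le> (T powr ?r) ^ J / norm ?z + (T powr ?r) ^ J"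
      using n1 norm_triangle_ineq[of "complex_of_real ?R powr ?z / ?z" "integral {?R..2 * ?R} (?g J)"] by linarith
    then show ?thesis unfolding eq by (simp add: algebra_simps)
  qed
  have "T powr ?r < T powr 0" using s T by (intro powr_less_mono) auto
  then have "(\<lambda>J. (T powr ?r) ^ J * (1 / norm ?z + 1)) \<longlonglongrightarrow> 0"
    by (intro tendsto_mult_left_zero LIMSEQ_power_zero) simp
  then have "(\<lambda>J. integral {1..2 * T ^ J} (?g J) + 1 / ?z) \<longlonglongrightarrow> 0"
    by (rule Lim_null_comparison[rotated]) (use bound in auto)
  then have "(\<lambda>J. complex_of_real (\<alpha> * vol) * (integral {1..2 * T ^ J} (?g J) + 1 / ?z - 1 / ?z)) \<longlonglongrightarrow>
      complex_of_real (\<alpha> * vol) * (0 - 1 / ?z)"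
    by (intro tendsto_intros)
  moreover have "complex_of_real (\<alpha> * vol) * (0 - 1 / ?z) = complex_of_real (\<alpha> * vol) / (s - complex_of_real \<alpha>)"
    using z by (simp add: field_simps)
  ultimately show ?thesis unfolding Mpart_def by simp
qed

section \<open>The Dirichlet series in its half-plane of convergence\<close>

lemma Zpart_tendsto: "Re s > \<alpha> \<Longrightarrow> (\<lambda>J. Zpart J s) \<longlonglongrightarrow> zfun s"
proof -
  assume "Re s > \<alpha>"
  then have "(\<lambda>J. Mpart J s + Dpart J s) \<longlonglongrightarrow> zfun s"
    unfolding zfun_def by (intro tendsto_add Mpart_tendsto Dpart_tendsto)
  then show ?thesis by (simp add: Dpart_def)
qed

lemma T_power_at_top: "filterlim (\<lambda>J. T ^ J) at_top sequentially"
  unfolding filterlim_at_top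
proof
  fix Z
  obtain n where n: "Z < T ^ n" using real_arch_pow[OF T] by blast
  have "Z \<le> T ^ m" if "n \<le> m" for m
    using n power_increasing[OF that, of T] T by linarith
  then show "\<forall>\<^sub>F J in sequentially. Z \<le> T ^ J" unfolding eventually_sequentially by blast
qed

text \<open>Absolute convergence is extracted from convergence of the smoothed sums: at the real
  point Re s all terms are nonnegative, so the limit of the smoothed sums bounds every finite sum
  and is the full sum. The real truncation error then dominates the complex one.\<close>

lemma zfun_series:
  assumes s: "Re s > \<alpha>"
  shows "((\<lambda>x. \<phi> x powr (- Re s)) summable_on (int_lattice - {0}))"
    and "((\<lambda>x. complex_of_real (\<phi> x) powr (- s)) has_sum zfun s) (int_lattice - {0})"
proof -
  let ?L = "int_lattice - {0} :: (real^'n) set"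
  define \<sigma> where "\<sigma> = Re s"
  let ?f = "\<lambda>x. \<phi> x powr (- \<sigma>)"
  let ?zr = "\<lambda>J. \<Sum>x\<in>lattice_upto (2 * T ^ J). c 0 (\<phi> x / T ^ J) * ?f x"
  have pos: "\<phi> x > 0" if "x \<in> ?L" for x using that by (auto intro: phi_pos)
  have Zr: "Zpart J (complex_of_real \<sigma>) = complex_of_real (?zr J)" for J
    unfolding Zpart_def of_real_sum
  proof (intro sum.cong refl)
    fix x assume "x \<in> lattice_upto (2 * T ^ J)"
    from lattice_upto_pos[OF this] show "complex_of_real (c 0 (\<phi> x / T ^ J)) * complex_of_real (\<phi> x) powr (- complex_of_real \<sigma>)
        = complex_of_real (c 0 (\<phi> x / T ^ J) * ?f x)"
      using powr_of_real[of "\<phi> x" "- \<sigma>"] by simp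
  qed
  have "(\<lambda>J. Zpart J (complex_of_real \<sigma>)) \<longlonglongrightarrow> zfun (complex_of_real \<sigma>)"
    using s by (intro Zpart_tendsto) (simp add: \<sigma>_def)
  then have zr: "?zr \<longlonglongrightarrow> Re (zfun (complex_of_real \<sigma>))" unfolding Zr using tendsto_Re by fastforce
  define z where "z = Re (zfun (complex_of_real \<sigma>))"
  \<comment> \<open>Once T ^ J exceeds \<phi> on \<open>X\<close>, the cutoff is 1 there and the
    smoothed sum contains all of \<open>sum ?f X\<close>.\<close>
  have fin_le: "sum ?f X \<le> z" if X: "finite X" "X \<subseteq> ?L" for X
  proof -
    have "eventually (\<lambda>J. T ^ J \<ge> \<phi> x) sequentially" for x
      using T_power_at_top by (auto simp: filterlim_at_top)
    then have "eventually (\<lambda>J. \<forall>x\<in>X. T ^ J \<ge> \<phi> x) sequentially" using X by (intro eventually_ball_finite) auto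
    then have "eventually (\<lambda>J. sum ?f X \<le> ?zr J) sequentially"
    proof eventually_elim
      case (elim J)
      have "sum ?f X = (\<Sum>x\<in>X. c 0 (\<phi> x / T ^ J) * ?f x)"
        using elim by (intro sum.cong refl) (simp add: c_1 field_simps)
      also have "\<dots> \<le> ?zr J"
      proof (rule sum_mono2)
        show "X \<subseteq> lattice_upto (2 * T ^ J)"
        proof
          fix x assume "x \<in> X"
          then have "\<phi> x \<le> T ^ J" "x \<in> ?L" using elim X by auto
          moreover from this have "\<phi> x \<le> 2 * T ^ J" using T_nonneg(2)[of J] by linarith
          ultimately show "x \<in> lattice_upto (2 * T ^ J)" unfolding lattice_upto_def by blast
        qed
      qed (use c_nonneg in auto)
      finally show ?case .
    qed
    then show ?thesis unfolding z_def by (intro tendsto_lowerbound[OF zr]) auto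
  qed
  have summ: "?f summable_on ?L"
    by (rule nonneg_bdd_above_summable_on) (use fin_le in \<open>auto intro!: bdd_aboveI[of _ z]\<close>)
  then show "((\<lambda>x. \<phi> x powr (- Re s)) summable_on ?L)" by (simp add: \<sigma>_def)
  define S where "S = infsum ?f ?L"
  have S: "(?f has_sum S) ?L" unfolding S_def using summ by (rule has_sum_infsum)
  have zr_sum: "((\<lambda>x. c 0 (\<phi> x / T ^ J) * ?f x) has_sum ?zr J) ?L" for J
  proof -
    have "((\<lambda>x. c 0 (\<phi> x / T ^ J) * ?f x) has_sum ?zr J) (lattice_upto (2 * T ^ J))" by (rule has_sum_finite) simp
    then show ?thesis
      by (rule has_sum_cong_neutral[THEN iffD1, rotated -1]) (auto simp: lattice_upto_def c_scaled_far intro: c_scaled_nonzero)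
  qed
  have zrS: "?zr J \<le> S" for J
    by (rule has_sum_mono[OF zr_sum S]) (use c_le_1 in \<open>auto intro: mult_left_le_one_le simp: c_nonneg\<close>)
  have "S \<le> z" unfolding S_def by (rule infsum_le_finite_sums[OF summ fin_le])
  moreover have "z \<le> S" unfolding z_def by (rule LIMSEQ_le_const2[OF zr]) (use zrS in auto)
  ultimately have zrS_lim: "?zr \<longlonglongrightarrow> S" using zr z_def by simp
  let ?g = "\<lambda>x. complex_of_real (\<phi> x) powr (- s)"
  have ng: "norm (?g x) = ?f x" if "x \<in> ?L" for x using norm_of_real_powr[OF pos[OF that], of "- s"] by (simp add: \<sigma>_def)
  have "(\<lambda>x. norm (?g x)) summable_on ?L" using summ by (rule summable_on_cong[THEN iffD1, rotated]) (use ng in simp)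
  then have "?g summable_on ?L" by (rule abs_summable_summable)
  then obtain F where F: "(?g has_sum F) ?L" unfolding summable_on_def by blast
  have Zsum: "((\<lambda>x. complex_of_real (c 0 (\<phi> x / T ^ J)) * ?g x) has_sum Zpart J s) ?L" for J
  proof -
    have "((\<lambda>x. complex_of_real (c 0 (\<phi> x / T ^ J)) * ?g x) has_sum Zpart J s) (lattice_upto (2 * T ^ J))"
      unfolding Zpart_def by (rule has_sum_finite) simp
    then show ?thesis
      by (rule has_sum_cong_neutral[THEN iffD1, rotated -1]) (auto simp: lattice_upto_def c_scaled_far intro: c_scaled_nonzero)
  qed
  \<comment> \<open>The factor 1 - c is nonnegative, so the norms of the omitted parts add up
    exactly to the real truncation error.\<close>
  have diff: "norm (F - Zpart J s) \<le> S - ?zr J" for J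
  proof (rule norm_has_sum_bound)
    show "((\<lambda>x. ?g x - complex_of_real (c 0 (\<phi> x / T ^ J)) * ?g x) has_sum (F - Zpart J s)) ?L"
      by (intro has_sum_minus F Zsum)
    have "((\<lambda>x. ?f x - c 0 (\<phi> x / T ^ J) * ?f x) has_sum (S - ?zr J)) ?L"
      by (intro has_sum_minus S zr_sum)
    then show "((\<lambda>x. norm (?g x - complex_of_real (c 0 (\<phi> x / T ^ J)) * ?g x)) has_sum (S - ?zr J)) ?L"
    proof (rule has_sum_cong[THEN iffD1, rotated])
      fix x assume x: "x \<in> ?L"
      have "?g x - complex_of_real (c 0 (\<phi> x / T ^ J)) * ?g x = complex_of_real (1 - c 0 (\<phi> x / T ^ J)) * ?g x"
        by (simp add: algebra_simps)
      then have "norm (?g x - complex_of_real (c 0 (\<phi> x / T ^ J)) * ?g x) = \<bar>1 - c 0 (\<phi> x / T ^ J)\<bar> * ?f x"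
        by (simp only: norm_mult norm_of_real ng[OF x])
      also have "\<bar>1 - c 0 (\<phi> x / T ^ J)\<bar> = 1 - c 0 (\<phi> x / T ^ J)" using c_le_1[of "\<phi> x / T ^ J"] by simp
      finally show "?f x - c 0 (\<phi> x / T ^ J) * ?f x = norm (?g x - complex_of_real (c 0 (\<phi> x / T ^ J)) * ?g x)"
        by (simp only: left_diff_distrib mult_1)
    qed
  qed
  have "(\<lambda>J. S - ?zr J) \<longlonglongrightarrow> S - S" by (intro tendsto_diff tendsto_const zrS_lim)
  then have "(\<lambda>J. F - Zpart J s) \<longlonglongrightarrow> 0"
    by (intro Lim_null_comparison[of "\<lambda>J. F - Zpart J s" "\<lambda>J. S - ?zr J"]) (use diff in auto)
  moreover have "(\<lambda>J. F - Zpart J s) \<longlonglongrightarrow> F - zfun s" by (intro tendsto_diff tendsto_const Zpart_tendsto s)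
  ultimately have "F = zfun s" using LIMSEQ_unique by fastforce
  with F show "(?g has_sum zfun s) ?L" by simp
qed

lemma zfun_holomorphic: "zfun holomorphic_on (- {complex_of_real \<alpha>})"
  unfolding zfun_def by (intro holomorphic_intros Dlim_holomorphic) auto

text \<open>\<open>zfun\<close> witnesses that an extension exists, so the chosen
  \<open>zeta\<close> is one; both agree on a half-plane and hence on the connected punctured
  plane.\<close>

lemma zeta_eq_zfun:
  assumes "s \<noteq> complex_of_real \<alpha>" shows "zeta \<alpha> \<phi> s = zfun s"
proof -
  have "is_zeta_extension \<alpha> \<phi> zfun"
    unfolding is_zeta_extension_def using zfun_holomorphic zfun_series(2) by blast
  then have "\<exists>Z. is_zeta_extension \<alpha> \<phi> Z" by blast
  then have ext: "is_zeta_extension \<alpha> \<phi> (zeta \<alpha> \<phi>)" unfolding zeta_def by (rule someI_ex)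
  let ?U = "- {complex_of_real \<alpha>}"
  have "zeta \<alpha> \<phi> s - zfun s = 0"
  proof (rule analytic_continuation[of "\<lambda>s. zeta \<alpha> \<phi> s - zfun s" ?U "{s. Re s > \<alpha>}" "complex_of_real (\<alpha> + 1)"])
    show "(\<lambda>s. zeta \<alpha> \<phi> s - zfun s) holomorphic_on ?U"
      using ext zfun_holomorphic unfolding is_zeta_extension_def by (intro holomorphic_intros) auto
    show "connected ?U" by (rule connected_open_delete[of UNIV, unfolded Compl_eq_Diff_UNIV[symmetric]]) auto
    show "{s. Re s > \<alpha>} \<subseteq> ?U" by auto
    show "complex_of_real (\<alpha> + 1) islimpt {s. Re s > \<alpha>}"
      by (intro interior_limit_point) (subst interior_open, auto simp: open_halfspace_Re_gt)
    fix z assume "z \<in> {s. Re s > \<alpha>}"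
    then have "((\<lambda>x. complex_of_real (\<phi> x) powr (- z)) has_sum zeta \<alpha> \<phi> z) (int_lattice - {0})"
      "((\<lambda>x. complex_of_real (\<phi> x) powr (- z)) has_sum zfun z) (int_lattice - {0})"
      using ext zfun_series(2) unfolding is_zeta_extension_def by blast+
    then show "zeta \<alpha> \<phi> z - zfun z = 0" using has_sum_unique by fastforce
  qed (use assms in \<open>auto simp: open_Compl complex_eq_iff\<close>)
  then show ?thesis by simp
qed

text \<open>The cutoff equals 1 near the origin, so the lattice estimate also applies to \<open>c 0 \<circ> \<phi>\<close>; compared
  with the zeta sums, it sees the lattice point \<open>0\<close> and the unit sublevel set in addition.\<close>

lemma zfun_0: "zfun 0 = -1"
proof -
  obtain m C where C: "C \<ge> 0" and est: "\<And>H B J Y. cutoff_family 1 2 H \<Longrightarrow> (\<forall>i\<le>m. \<forall>u. \<bar>H i u\<bar> \<le> B) \<Longrightarrow>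
    finite Y \<Longrightarrow> Y \<subseteq> int_lattice \<Longrightarrow> (\<forall>x\<in>int_lattice - Y. H 0 (\<phi> x / T ^ J) = 0) \<Longrightarrow>
    integrable lborel (\<lambda>x. H 0 (\<phi> x / T ^ J)) \<and>
    \<bar>(\<Sum>x\<in>Y. H 0 (\<phi> x / T ^ J)) - (\<integral>x. H 0 (\<phi> x / T ^ J) \<partial>lborel)\<bar> \<le> C * B * (1 / (2 * T ^ 0)) ^ J"
    using lattice_estimate[OF zero_less_one, of 2 0] by blast
  have fam: "cutoff_family 1 2 c"
    unfolding cutoff_family_def using c_deriv c_1 c_2 c_Suc
    by (auto simp: le_less intro: c_deriv) (metis c_2 c_Suc less_imp_le not0_implies_Suc)
  have "\<forall>j. \<exists>E\<ge>0. \<forall>u. \<bar>c j u\<bar> \<le> E" using c_bounded by blast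
  then obtain E where E: "\<And>j. E j \<ge> 0" "\<And>j u. \<bar>c j u\<bar> \<le> E j" by metis
  define B where "B = (\<Sum>i\<le>m. E i)"
  have B: "\<forall>i\<le>m. \<forall>u. \<bar>c i u\<bar> \<le> B"
  proof (intro allI impI)
    fix i u assume "i \<le> m"
    then have "E i \<le> B" unfolding B_def using E(1) by (intro member_le_sum) auto
    with E(2)[of i u] show "\<bar>c i u\<bar> \<le> B" by linarith
  qed
  have key: "norm (Dpart J 0 + 1 - complex_of_real vol) \<le> C * B * (1 / 2) ^ J" for J
  proof -
    let ?Y = "insert 0 (lattice_upto (2 * T ^ J))" and ?f = "\<lambda>x. c 0 (\<phi> x / T ^ J)"
    have z: "\<forall>x\<in>int_lattice - ?Y. ?f x = 0" by (auto simp: lattice_upto_def c_scaled_far intro: c_scaled_nonzero)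
    have Y: "?Y \<subseteq> int_lattice" by (auto simp: lattice_upto_def)
    have "integrable lborel ?f \<and> \<bar>(\<Sum>x\<in>?Y. ?f x) - (\<integral>x. ?f x \<partial>lborel)\<bar> \<le> C * B * (1 / (2 * T ^ 0)) ^ J"
      by (rule est[OF fam B _ Y z]) simp
    then have int: "integrable lborel ?f" and le: "\<bar>(\<Sum>x\<in>?Y. ?f x) - (\<integral>x. ?f x \<partial>lborel)\<bar> \<le> C * B * (1 / 2) ^ J" by auto
    have "0 \<notin> lattice_upto (2 * T ^ J)" by (simp add: lattice_upto_def)
    then have "(\<Sum>x\<in>?Y. ?f x) = 1 + (\<Sum>x\<in>lattice_upto (2 * T ^ J). ?f x)" by (simp add: c_1)
    moreover have "Zpart J 0 = complex_of_real (\<Sum>x\<in>lattice_upto (2 * T ^ J). ?f x)"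
      unfolding Zpart_def of_real_sum
      by (intro sum.cong refl) (use lattice_upto_pos in \<open>force simp: powr_def\<close>)
    ultimately have sumY: "complex_of_real (\<Sum>x\<in>?Y. ?f x) = 1 + Zpart J 0" by simp
    have i1: "integrable lborel (\<lambda>x. indicator (unit_sublevel \<phi>) x :: real)"
      using lmeasurable_sublevel(1)[of 1] open_sublevel[of 1]
      by (intro integrable_real_indicator) (auto simp: unit_sublevel_def fmeasurable_def)
    have split: "?f x = indicator (unit_sublevel \<phi>) x + indicator {1..2 * T ^ J} (\<phi> x) * ?f x" for x
    proof (cases "\<phi> x < 1")
      case True
      then have "\<phi> x \<le> T ^ J" using one_le_T_power[of J] by linarith
      then show ?thesis using True by (simp add: unit_sublevel_def c_1 field_simps)
    next
      case False
      then show ?thesis by (auto simp: unit_sublevel_def indicator_def c_2 field_simps)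
    qed
    have i2: "integrable lborel (\<lambda>x. indicator {1..2 * T ^ J} (\<phi> x) * ?f x)"
    proof -
      have "integrable lborel (\<lambda>x. ?f x - indicator (unit_sublevel \<phi>) x)" by (intro Bochner_Integration.integrable_diff int i1)
      moreover have "(\<lambda>x. ?f x - indicator (unit_sublevel \<phi>) x) = (\<lambda>x. indicator {1..2 * T ^ J} (\<phi> x) * ?f x)"
      proof
        fix x
        show "?f x - indicator (unit_sublevel \<phi>) x = indicator {1..2 * T ^ J} (\<phi> x) * ?f x" using split[of x] by linarith
      qed
      ultimately show ?thesis by simp
    qed
    have "(\<integral>x. ?f x \<partial>lborel) = (\<integral>x. indicator (unit_sublevel \<phi>) x + indicator {1..2 * T ^ J} (\<phi> x) * ?f x \<partial>lborel)"
      by (intro Bochner_Integration.integral_cong refl split)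
    also have "\<dots> = (\<integral>x. indicator (unit_sublevel \<phi>) x \<partial>lborel) + (\<integral>x. indicator {1..2 * T ^ J} (\<phi> x) * ?f x \<partial>lborel)"
      by (intro Bochner_Integration.integral_add i1 i2)
    also have "(\<integral>x. indicator (unit_sublevel \<phi>) x \<partial>lborel) = vol"
      using open_sublevel[of 1] by (simp add: unit_sublevel_def)
    finally have I: "complex_of_real (\<integral>x. ?f x \<partial>lborel) = complex_of_real vol +
        complex_of_real (\<integral>x. indicator {1..2 * T ^ J} (\<phi> x) * ?f x \<partial>lborel)" by simp
    have "complex_of_real (\<integral>x. indicator {1..2 * T ^ J} (\<phi> x) * ?f x \<partial>lborel) =
        (\<integral>x. indicator {1..2 * T ^ J} (\<phi> x) *\<^sub>R (\<lambda>u. complex_of_real (c 0 (u / T ^ J))) (\<phi> x) \<partial>lborel)"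
      by (simp add: integral_complex_of_real[symmetric] scaleR_conv_of_real del: integral_complex_of_real)
    also have "\<dots> = integral {1..2 * T ^ J} (\<lambda>u. complex_of_real (\<alpha> * vol * u powr (\<alpha> - 1)) * complex_of_real (c 0 (u / T ^ J)))"
    proof (rule integral_shell_HK)
      have cc: "continuous_on S (\<lambda>u. complex_of_real (c 0 (u / T ^ J)))" for S
        by (intro continuous_intros continuous_on_compose2[OF c_cont[of UNIV]]) auto
      show "continuous_on {1..2 * T ^ J} (\<lambda>u. complex_of_real (c 0 (u / T ^ J)))"
        "(\<lambda>u. complex_of_real (c 0 (u / T ^ J))) \<in> borel_measurable borel"
        by (rule cc, rule borel_measurable_continuous_onI[OF cc])
      show "1 \<le> 2 * T ^ J" using one_le_T_power[of J] by linarith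
    qed
    also have "\<dots> = integral {1..2 * T ^ J} (\<lambda>u. complex_of_real (\<alpha> * vol) *
        (complex_of_real (c 0 (u / T ^ J)) * complex_of_real u powr (complex_of_real \<alpha> - 0 - 1)))"
    proof (rule Henstock_Kurzweil_Integration.integral_cong)
      fix u assume "u \<in> {1..2 * T ^ J}"
      then have "complex_of_real (u powr (\<alpha> - 1)) = complex_of_real u powr complex_of_real (\<alpha> - 1)"
        by (intro powr_of_real[symmetric]) simp
      then show "complex_of_real (\<alpha> * vol * u powr (\<alpha> - 1)) * complex_of_real (c 0 (u / T ^ J)) = complex_of_real (\<alpha> * vol) *
        (complex_of_real (c 0 (u / T ^ J)) * complex_of_real u powr (complex_of_real \<alpha> - 0 - 1))" by simp
    qed
    also have "\<dots> = Mpart J 0" unfolding Mpart_def by (rule Henstock_Kurzweil_Integration.integral_mult_right)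
    finally have "complex_of_real (\<integral>x. ?f x \<partial>lborel) = complex_of_real vol + Mpart J 0" unfolding I by simp
    then have "complex_of_real ((\<Sum>x\<in>?Y. ?f x) - (\<integral>x. ?f x \<partial>lborel)) = Dpart J 0 + 1 - complex_of_real vol"
      unfolding of_real_diff sumY by (simp add: Dpart_def)
    then show ?thesis using le by (metis norm_of_real)
  qed
  have "(\<lambda>J. C * B * (1 / 2) ^ J) \<longlonglongrightarrow> 0"
    by (intro tendsto_mult_right_zero LIMSEQ_power_zero) simp
  then have "(\<lambda>J. Dpart J 0 + 1 - complex_of_real vol) \<longlonglongrightarrow> 0"
    by (rule Lim_null_comparison[rotated]) (use key in auto)
  moreover have "(\<lambda>J. Dpart J 0 + 1 - complex_of_real vol) \<longlonglongrightarrow> Dlim 0 + 1 - complex_of_real vol"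
    by (intro tendsto_intros Dpart_tendsto)
  \<comment> \<open>The volume in \<open>Dlim 0\<close> is cancelled by the quotient in
    \<open>zfun\<close>, which equals minus the volume at 0.\<close>
  ultimately have "Dlim 0 + 1 - complex_of_real vol = 0" using LIMSEQ_unique by blast
  moreover have "\<alpha> \<noteq> 0" using trace_pos by simp
  ultimately show ?thesis unfolding zfun_def by (simp add: algebra_simps)
qed

end

subsection \<open>The Gamma function on vertical lines\<close>

text \<open>The quotient |Gamma (x + i t)| / Gamma x increases with x: in Gauss's limit formula it
  is a product of the factors (x + k) / |x + k + i t|, and each of them increases. It moves bounds
  from one vertical line to another on its left.\<close>

lemma norm_Gamma_mono:
  assumes "0 < x" "x \<le> y"
  shows "norm (Gamma (Complex x t)) * Gamma y \<le> Gamma x * norm (Gamma (Complex y t))"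
proof -
  have factor: "(x + real k) * norm (Complex y t + of_nat k) \<le> norm (Complex x t + of_nat k) * (y + real k)" for k
  proof (rule power2_le_imp_le)
    have c: "(x + real k)\<^sup>2 \<le> (y + real k)\<^sup>2" using assms by (intro power_mono) auto
    have "((x + real k) * norm (Complex y t + of_nat k))\<^sup>2 = (x + real k)\<^sup>2 * ((y + real k)\<^sup>2 + t\<^sup>2)"
      by (simp add: power_mult_distrib cmod_power2)
    also have "\<dots> \<le> ((x + real k)\<^sup>2 + t\<^sup>2) * (y + real k)\<^sup>2"
      using mult_left_mono[OF c, of "t\<^sup>2"] by (simp add: algebra_simps)
    also have "\<dots> = (norm (Complex x t + of_nat k) * (y + real k))\<^sup>2"
      by (simp add: power_mult_distrib cmod_power2)
    finally show "((x + real k) * norm (Complex y t + of_nat k))\<^sup>2 \<le> (norm (Complex x t + of_nat k) * (y + real k))\<^sup>2" .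
  qed (use assms in auto)
  have le: "rGamma_series x n * norm (rGamma_series (Complex y t) n) \<le> norm (rGamma_series (Complex x t) n) * rGamma_series y n" for n
  proof -
    let ?d = "fact n * exp (x * ln (real n)) * (fact n * exp (y * ln (real n)))"
    have n: "norm (rGamma_series (Complex z t) n) = (\<Prod>k=0..<n+1. norm (Complex z t + of_nat k)) / (fact n * exp (z * ln (real n)))" for z
      unfolding rGamma_series_def pochhammer_prod by (simp add: norm_divide norm_mult prod_norm)
    have r: "rGamma_series z n = (\<Prod>k=0..<n+1. z + real k) / (fact n * exp (z * ln (real n)))" for z :: real
      unfolding rGamma_series_def pochhammer_prod by simp
    have "(\<Prod>k=0..<n+1. (x + real k) * norm (Complex y t + of_nat k)) / ?d \<le>
        (\<Prod>k=0..<n+1. norm (Complex x t + of_nat k) * (y + real k)) / ?d"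
      using assms factor by (intro divide_right_mono prod_mono) auto
    then show ?thesis unfolding n r by (simp add: prod.distrib mult_ac del: prod.atLeast0_lessThan_Suc)
  qed
  have "rGamma x * norm (rGamma (Complex y t)) \<le> norm (rGamma (Complex x t)) * rGamma y"
  proof (rule LIMSEQ_le)
    show "(\<lambda>n. rGamma_series x n * norm (rGamma_series (Complex y t) n)) \<longlonglongrightarrow> rGamma x * norm (rGamma (Complex y t))"
      "(\<lambda>n. norm (rGamma_series (Complex x t) n) * rGamma_series y n) \<longlonglongrightarrow> norm (rGamma (Complex x t)) * rGamma y"
      by (intro tendsto_intros)+
  qed (use le in auto)
  moreover have "Complex z t \<notin> \<int>\<^sub>\<le>\<^sub>0" if "z > 0" for z using that by (auto elim!: nonpos_Ints_cases simp: complex_eq_iff)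
  then have "Gamma (Complex x t) \<noteq> 0" "Gamma (Complex y t) \<noteq> 0" using assms by (auto simp: Gamma_eq_zero_iff)
  moreover have "Gamma x > 0" "Gamma y > 0" using assms by auto
  moreover have "g * h \<le> e * f" if "inverse e * inverse f \<le> inverse g * inverse h" "e > 0" "f > 0" "g > 0" "h > 0"
    for e f g h :: real using that by (simp add: field_simps)
  ultimately show ?thesis by (simp only: rGamma_inverse_Gamma norm_inverse zero_less_norm_iff not_False_eq_True)
qed

lemma norm_Gamma_half: "norm (Gamma (Complex (1/2) t)) \<le> sqrt (2 * pi) * exp (- (pi / 2) * \<bar>t\<bar>)"
proof (rule power2_le_imp_le)
  let ?z = "Complex (1/2) t"
  have c: "1 - ?z = cnj ?z" by (simp add: complex_eq_iff)
  have "Gamma ?z * cnj (Gamma ?z) = complex_of_real pi / sin (complex_of_real pi * ?z)"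
    using Gamma_reflection_complex[of ?z] by (simp add: c cnj_Gamma)
  moreover have "sin (complex_of_real pi * ?z) = complex_of_real (cosh (pi * t))"
  proof -
    have "complex_of_real pi * ?z = \<i> * complex_of_real (pi * t) + complex_of_real (pi / 2)"
      by (simp add: complex_eq_iff)
    then have "sin (complex_of_real pi * ?z) = sin (\<i> * complex_of_real (pi * t) + complex_of_real (pi / 2))" by (rule arg_cong)
    also have "\<dots> = cos (\<i> * complex_of_real (pi * t))"
      by (simp add: sin_add sin_of_real cos_of_real)
    also have "\<dots> = complex_of_real (cosh (pi * t))"
      by (simp add: cos_exp_eq cosh_def exp_of_real[symmetric] mult.assoc[symmetric] scaleR_conv_of_real add.commute)
    finally show ?thesis .
  qed
  ultimately have "complex_of_real ((norm (Gamma ?z))\<^sup>2) = complex_of_real (pi / cosh (pi * t))"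
    by (simp only: complex_norm_square of_real_divide)
  then have "(norm (Gamma ?z))\<^sup>2 = pi / cosh (pi * t)" by (simp only: of_real_eq_iff)
  also have "\<dots> \<le> pi / (exp (pi * \<bar>t\<bar>) / 2)"
  proof -
    have "exp (pi * \<bar>t\<bar>) / 2 \<le> cosh (pi * \<bar>t\<bar>)" by (simp add: cosh_def)
    also have "cosh (pi * \<bar>t\<bar>) = cosh (pi * t)" by (simp add: abs_if)
    finally show ?thesis by (intro divide_left_mono) auto
  qed
  also have "\<dots> = (sqrt (2 * pi) * exp (- (pi / 2) * \<bar>t\<bar>))\<^sup>2"
    by (simp add: power_mult_distrib exp_double[symmetric] exp_minus field_simps)
  finally show "(norm (Gamma ?z))\<^sup>2 \<le> (sqrt (2 * pi) * exp (- (pi / 2) * \<bar>t\<bar>))\<^sup>2" .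
qed auto

lemma norm_pochhammer_le:
  fixes s :: complex
  shows "norm (pochhammer s k) \<le> (norm s + real k) ^ k"
proof -
  have "norm (pochhammer s k) = (\<Prod>i=0..<k. norm (s + of_nat i))" unfolding pochhammer_prod by (rule prod_norm[symmetric])
  also have "\<dots> \<le> (\<Prod>i=0..<k. norm s + real k)"
    by (intro prod_mono conjI norm_ge_zero order_trans[OF norm_triangle_ineq]) auto
  finally show ?thesis by simp
qed

lemma not_nonpos_Int_Im: "Im s \<noteq> 0 \<Longrightarrow> s \<notin> \<int>\<^sub>\<le>\<^sub>0"
  by (auto elim!: nonpos_Ints_cases)

text \<open>The functional equation moves the strip into Re s \<ge> 1 without loss, since the
  factors have norm at least 1 when |Im s| \<ge> 1. Monotonicity compares with a half-integer
  abscissa further right, and descending from there to 1/2 costs a polynomial.\<close>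

lemma Gamma_strip_bound:
  "\<exists>C m. C \<ge> 0 \<and> (\<forall>s. a \<le> Re s \<longrightarrow> Re s \<le> b \<longrightarrow> \<bar>Im s\<bar> \<ge> 1 \<longrightarrow>
     norm (Gamma s) \<le> C * (1 + \<bar>Im s\<bar>) ^ m * exp (- (pi / 2) * \<bar>Im s\<bar>))"
proof -
  define k where "k = nat \<lceil>1 - a\<rceil>"
  have k: "a + real k \<ge> 1" unfolding k_def by linarith
  \<comment> \<open>An integer to the right of the shifted strip, so that \<open>q + 1/2\<close> is
    an integer number of steps from 1/2, where the decay is known.\<close>
  define q where "q = nat \<lceil>b + real k\<rceil>"
  have q: "b + real k \<le> real q" unfolding q_def by linarith
  have "continuous_on {1..real q} (Gamma :: real \<Rightarrow> real)"
    by (intro continuous_on_Gamma) (auto elim!: nonpos_Ints_cases)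
  then have "bounded ((Gamma :: real \<Rightarrow> real) ` {1..real q})"
    by (intro compact_imp_bounded compact_continuous_image) auto
  then obtain G where "\<forall>y\<in>(Gamma :: real \<Rightarrow> real) ` {1..real q}. norm y \<le> G" unfolding bounded_iff by blast
  then have G: "\<And>x. x \<in> {1..real q} \<Longrightarrow> \<bar>Gamma x\<bar> \<le> G" by simp
  let ?y = "real q + 1/2"
  have Gy: "Gamma ?y > 0" by (intro Gamma_real_pos) auto
  define C where "C = \<bar>G\<bar> / Gamma ?y * (real q + 1) ^ q * sqrt (2 * pi)"
  have C: "C \<ge> 0" unfolding C_def using Gy by simp
  have "norm (Gamma s) \<le> C * (1 + \<bar>Im s\<bar>) ^ q * exp (- (pi / 2) * \<bar>Im s\<bar>)"
    if s: "a \<le> Re s" "Re s \<le> b" "\<bar>Im s\<bar> \<ge> 1" for s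
  proof -
    let ?x = "Re s + real k" and ?t = "Im s"
    have x: "1 \<le> ?x" "?x \<le> real q" using s k q by auto
    have "Gamma (s + of_nat k) = pochhammer s k * Gamma s"
      using pochhammer_Gamma[of s k] not_nonpos_Int_Im[of s] s by (auto simp: Gamma_eq_zero_iff)
    moreover have "1 \<le> norm (pochhammer s k)"
    proof -
      have "1 \<le> norm (s + of_nat i)" for i using abs_Im_le_cmod[of "s + of_nat i"] s by simp
      then have "1 \<le> (\<Prod>i=0..<k. norm (s + of_nat i))" by (intro prod_ge_1) auto
      then show ?thesis unfolding pochhammer_prod by (simp add: prod_norm)
    qed
    ultimately have "norm (Gamma s) \<le> norm (Gamma (s + of_nat k))"
      by (simp add: norm_mult mult_le_cancel_right1)
    also have "s + of_nat k = Complex ?x ?t" by (simp add: complex_eq_iff)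
    also have "norm (Gamma (Complex ?x ?t)) \<le> Gamma ?x * norm (Gamma (Complex ?y ?t)) / Gamma ?y"
      using norm_Gamma_mono[of ?x ?y ?t] x Gy by (simp add: field_simps)
    also have "\<dots> \<le> \<bar>G\<bar> * ((real q + 1) ^ q * (1 + \<bar>?t\<bar>) ^ q * (sqrt (2 * pi) * exp (- (pi / 2) * \<bar>?t\<bar>))) / Gamma ?y"
    proof (intro divide_right_mono mult_mono)
      show "Gamma ?x \<le> \<bar>G\<bar>" using G[of ?x] x by auto
      let ?h = "Complex (1/2) ?t"
      have "Gamma (?h + of_nat q) = pochhammer ?h q * Gamma ?h"
        using pochhammer_Gamma[of ?h q] not_nonpos_Int_Im[of ?h] s by (auto simp: Gamma_eq_zero_iff)
      moreover have "?h + of_nat q = Complex ?y ?t" by (simp add: complex_eq_iff)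
      ultimately have "norm (Gamma (Complex ?y ?t)) = norm (pochhammer ?h q) * norm (Gamma ?h)" by (simp add: norm_mult)
      also have "\<dots> \<le> (norm ?h + real q) ^ q * (sqrt (2 * pi) * exp (- (pi / 2) * \<bar>?t\<bar>))"
        by (intro mult_mono norm_pochhammer_le norm_Gamma_half) auto
      also have "\<dots> \<le> ((real q + 1) * (1 + \<bar>?t\<bar>)) ^ q * (sqrt (2 * pi) * exp (- (pi / 2) * \<bar>?t\<bar>))"
      proof (intro mult_right_mono power_mono)
        have "norm ?h \<le> \<bar>Re ?h\<bar> + \<bar>Im ?h\<bar>" by (rule cmod_le)
        then have "norm ?h \<le> 1 + \<bar>?t\<bar>" by simp
        moreover have "0 \<le> real q * \<bar>?t\<bar>" by simp
        moreover have "(real q + 1) * (1 + \<bar>?t\<bar>) = real q + 1 + \<bar>?t\<bar> + real q * \<bar>?t\<bar>" by (simp add: algebra_simps)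
        ultimately show "norm ?h + real q \<le> (real q + 1) * (1 + \<bar>?t\<bar>)" by linarith
      qed auto
      finally show "norm (Gamma (Complex ?y ?t)) \<le> (real q + 1) ^ q * (1 + \<bar>?t\<bar>) ^ q * (sqrt (2 * pi) * exp (- (pi / 2) * \<bar>?t\<bar>))"
        by (simp add: power_mult_distrib)
    qed (use Gy in auto)
    also have "\<dots> = C * (1 + \<bar>?t\<bar>) ^ q * exp (- (pi / 2) * \<bar>?t\<bar>)" by (simp add: C_def)
    finally show ?thesis .
  qed
  with C show ?thesis by blast
qed

text \<open>The inequality y < exp y at y = d (1 + x) / k, raised to the power k = m + 2; the two
  extra powers pay for 1 + x^2.\<close>

lemma power_times_exp_bound:
  assumes d: "d > (0::real)"
  shows "\<exists>C\<ge>0. \<forall>x\<ge>0. (1 + x) ^ m * exp (- d * x) \<le> C / (1 + x\<^sup>2)"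
proof -
  define k where "k = m + 2"
  let ?k = k
  have k: "k > 0" by (simp add: k_def)
  define C where "C = (real ?k / d) ^ ?k * exp d"
  have "(1 + x) ^ m * exp (- d * x) \<le> C / (1 + x\<^sup>2)" if x: "x \<ge> 0" for x
  proof -
    have "(d * (1 + x) / real ?k) ^ ?k \<le> exp (d * (1 + x) / real ?k) ^ ?k"
      using d x by (intro power_mono less_imp_le[OF exp_gt_self]) auto
    also have "\<dots> = exp (real ?k * (d * (1 + x) / real ?k))" by (rule exp_of_nat_mult[symmetric])
    also have "\<dots> = exp (d * (1 + x))" using k by simp
    also have "exp (d * (1 + x)) = exp d * exp (d * x)" by (simp add: distrib_left exp_add)
    finally have "d ^ k * (1 + x) ^ k / real k ^ k \<le> exp d * exp (d * x)"
      by (simp only: power_mult_distrib power_divide)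
    then have "(1 + x) ^ k \<le> C * exp (d * x)"
      using d k by (simp add: C_def power_divide field_simps)
    then have "(1 + x) ^ ?k * exp (- d * x) \<le> C" by (simp add: exp_minus field_simps)
    moreover have "(1 + x) ^ m * exp (- d * x) * (1 + x\<^sup>2) \<le> (1 + x) ^ m * exp (- d * x) * (1 + x)\<^sup>2"
      using x by (intro mult_left_mono) (auto simp: power2_eq_square algebra_simps)
    moreover have "(1 + x) ^ m * exp (- d * x) * (1 + x)\<^sup>2 = (1 + x) ^ ?k * exp (- d * x)"
      by (simp add: power_add k_def power2_eq_square)
    ultimately have "(1 + x) ^ m * exp (- d * x) * (1 + x\<^sup>2) \<le> C" by linarith
    moreover have "1 + x\<^sup>2 > 0" by (rule add_pos_nonneg) auto
    ultimately show ?thesis by (simp only: le_divide_eq if_True)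
  qed
  moreover have "C \<ge> 0" using d by (simp add: C_def)
  ultimately show ?thesis by blast
qed

subsection \<open>Integrals along vertical lines\<close>

lemma integrable_inverse_one_plus_square: "integrable lborel (\<lambda>t::real. 1 / (1 + t\<^sup>2))"
proof -
  let ?f = "\<lambda>t::real. 1 / (1 + t\<^sup>2)"
  have meas[measurable]: "?f \<in> borel_measurable borel" by measurable
  have pos: "1 + t\<^sup>2 > (0::real)" for t by (rule add_pos_nonneg) auto
  have "(\<integral>\<^sup>+ t. ennreal (?f t) * indicator {0..} t \<partial>lborel) = ennreal (pi / 2 - arctan 0)"
  proof (rule nn_integral_FTC_atLeast)
    show "DERIV arctan t :> ?f t" for t
      using DERIV_arctan[of t] by (simp add: inverse_eq_divide)
    show "(arctan \<longlongrightarrow> pi / 2) at_top" by (rule tendsto_arctan_at_top)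
  qed (use pos in \<open>auto intro: less_imp_le\<close>)
  also have "(\<integral>\<^sup>+ t. ennreal (?f t) * indicator {0..} t \<partial>lborel) = (\<integral>\<^sup>+ t. ennreal (indicator {0..} t * ?f t) \<partial>lborel)"
    by (intro nn_integral_cong) (auto simp: indicator_def)
  finally have i: "integrable lborel (\<lambda>t. indicator {0..} t * ?f t)"
    by (intro integrableI_nonneg) (auto intro!: mult_nonneg_nonneg divide_nonneg_nonneg less_imp_le[OF pos])
  have "integrable lborel (\<lambda>t. indicator {0..} (0 + (-1) * t) * ?f (0 + (-1) * t))"
    using i by (intro lborel_integrable_real_affine) auto
  then have "integrable lborel (\<lambda>t. indicator {0..} t * ?f t + indicator {0..} (- t) * ?f t)"
    using i by (intro Bochner_Integration.integrable_add) auto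
  then show ?thesis
    by (rule Bochner_Integration.integrable_bound) (auto simp: indicator_def less_imp_le[OF pos])
qed

text \<open>Integrates over the ordinate, so the factor i of ds = i dt is absent and reappears when
  passing to \<open>vline_integral\<close>.\<close>

definition line_integral :: "real \<Rightarrow> (complex \<Rightarrow> complex) \<Rightarrow> complex" where
  "line_integral \<sigma> f = (\<integral>t. f (Complex \<sigma> t) \<partial>lborel)"

text \<open>One integrable majorant for all kernels in use. It makes the principal-value limit an
  absolutely convergent integral and carries an explicit constant for norm bounds.\<close>

definition line_decay :: "real \<Rightarrow> (complex \<Rightarrow> complex) \<Rightarrow> real \<Rightarrow> bool" where
  "line_decay \<sigma> f C \<longleftrightarrow> continuous_on UNIV (\<lambda>t. f (Complex \<sigma> t)) \<and> (\<forall>t. norm (f (Complex \<sigma> t)) \<le> C / (1 + t\<^sup>2))"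

lemma line_decay_integrable:
  assumes "line_decay \<sigma> f C"
  shows "integrable lborel (\<lambda>t. f (Complex \<sigma> t))"
proof (rule Bochner_Integration.integrable_bound)
  show "integrable lborel (\<lambda>t. C * (1 / (1 + t\<^sup>2)))"
    by (intro integrable_mult_right integrable_inverse_one_plus_square)
  show "(\<lambda>t. f (Complex \<sigma> t)) \<in> borel_measurable lborel"
    using assms by (simp add: line_decay_def borel_measurable_continuous_onI)
  have "norm (f (Complex \<sigma> t)) \<le> norm (C * (1 / (1 + t\<^sup>2)))" for t
  proof -
    have "norm (f (Complex \<sigma> t)) \<le> C / (1 + t\<^sup>2)" using assms by (simp add: line_decay_def)
    also have "\<dots> \<le> \<bar>C\<bar> / (1 + t\<^sup>2)" by (intro divide_right_mono) auto
    also have "\<dots> = norm (C * (1 / (1 + t\<^sup>2)))" by (simp add: abs_mult)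
    finally show ?thesis .
  qed
  then show "AE t in lborel. norm (f (Complex \<sigma> t)) \<le> norm (C * (1 / (1 + t\<^sup>2)))" by simp
qed

lemma line_decay_contour:
  assumes f: "line_decay \<sigma> f C"
  shows "T > 0 \<Longrightarrow> (f has_contour_integral \<i> * integral {-T..T} (\<lambda>t. f (Complex \<sigma> t))) (vline_segment \<sigma> T)"
    and "((\<lambda>T. contour_integral (vline_segment \<sigma> T) f) \<longlongrightarrow> \<i> * line_integral \<sigma> f) at_top"
proof -
  have cont: "continuous_on S (\<lambda>t. f (Complex \<sigma> t))" for S
    using f continuous_on_subset unfolding line_decay_def by blast
  have has: "(f has_contour_integral \<i> * integral {-T..T} (\<lambda>t. f (Complex \<sigma> t))) (vline_segment \<sigma> T)" if "T > 0" for T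
    unfolding vline_segment_def using that
    by (subst has_contour_integral_linepath_same_Re_iff[of _ \<sigma> _ "- T" T])
      (auto intro!: integrable_integral integrable_continuous_real cont simp: mult.assoc[symmetric])
  then show "T > 0 \<Longrightarrow> (f has_contour_integral \<i> * integral {-T..T} (\<lambda>t. f (Complex \<sigma> t))) (vline_segment \<sigma> T)" .
  have int: "integrable lborel (\<lambda>t. f (Complex \<sigma> t))" by (rule line_decay_integrable[OF f])
  have "((\<lambda>T. \<integral>t. indicator {-T..T} t *\<^sub>R f (Complex \<sigma> t) \<partial>lborel) \<longlongrightarrow> (\<integral>t. f (Complex \<sigma> t) \<partial>lborel)) at_top"
  proof (rule integral_dominated_convergence_at_top[where w = "\<lambda>t. norm (f (Complex \<sigma> t))"])
    show "integrable lborel (\<lambda>t. norm (f (Complex \<sigma> t)))" using int by simp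
    show "(\<lambda>t. f (Complex \<sigma> t)) \<in> borel_measurable lborel" using int by simp
    show "(\<lambda>t. indicator {-T..T} t *\<^sub>R f (Complex \<sigma> t)) \<in> borel_measurable lborel" for T
      using int by (intro borel_measurable_scaleR borel_measurable_indicator) auto
    show "AE t in lborel. ((\<lambda>T. indicator {-T..T} t *\<^sub>R f (Complex \<sigma> t)) \<longlongrightarrow> f (Complex \<sigma> t)) at_top"
    proof (rule AE_I2)
      fix t :: real
      have "eventually (\<lambda>T. f (Complex \<sigma> t) = indicator {-T..T} t *\<^sub>R f (Complex \<sigma> t)) at_top"
        using eventually_ge_at_top[of "\<bar>t\<bar>"] by eventually_elim (auto simp: indicator_def)
      then show "((\<lambda>T. indicator {-T..T} t *\<^sub>R f (Complex \<sigma> t)) \<longlongrightarrow> f (Complex \<sigma> t)) at_top"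
        by (rule Lim_transform_eventually[OF tendsto_const])
    qed
    show "\<forall>\<^sub>F T in at_top. AE t in lborel. norm (indicator {-T..T} t *\<^sub>R f (Complex \<sigma> t)) \<le> norm (f (Complex \<sigma> t))"
      by (auto simp: indicator_def)
  qed
  moreover have "(\<integral>t. indicator {-T..T} t *\<^sub>R f (Complex \<sigma> t) \<partial>lborel) = integral {-T..T} (\<lambda>t. f (Complex \<sigma> t))" for T
    using set_borel_integral_eq_integral(2)[OF borel_integrable_atLeastAtMost'[OF cont, of "-T" T]]
    unfolding set_lebesgue_integral_def .
  ultimately have "((\<lambda>T. \<i> * integral {-T..T} (\<lambda>t. f (Complex \<sigma> t))) \<longlongrightarrow> \<i> * line_integral \<sigma> f) at_top"
    unfolding line_integral_def by (intro tendsto_mult tendsto_const) simp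
  moreover have "eventually (\<lambda>T. \<i> * integral {-T..T} (\<lambda>t. f (Complex \<sigma> t)) = contour_integral (vline_segment \<sigma> T) f) at_top"
    using eventually_gt_at_top[of 0] by eventually_elim (simp add: contour_integral_unique[OF has])
  ultimately show "((\<lambda>T. contour_integral (vline_segment \<sigma> T) f) \<longlongrightarrow> \<i> * line_integral \<sigma> f) at_top"
    by (rule Lim_transform_eventually)
qed

lemma line_decay_vline:
  assumes "line_decay \<sigma> f C"
  shows "vline_integrable \<sigma> f" "vline_integral \<sigma> f = \<i> * line_integral \<sigma> f"
proof -
  show "vline_integrable \<sigma> f"
    unfolding vline_integrable_def using line_decay_contour[OF assms] unfolding contour_integrable_on_def by blast
  show "vline_integral \<sigma> f = \<i> * line_integral \<sigma> f"
    unfolding vline_integral_def by (rule tendsto_Lim[OF _ line_decay_contour(2)[OF assms]]) simp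
qed

abbreviation "cauchy_mass \<equiv> (\<integral>t. 1 / (1 + t\<^sup>2) \<partial>lborel) :: real"

lemma line_decay_norm_le:
  assumes "line_decay \<sigma> f C" shows "norm (line_integral \<sigma> f) \<le> C * cauchy_mass"
proof -
  have int: "integrable lborel (\<lambda>t. f (Complex \<sigma> t))" by (rule line_decay_integrable[OF assms])
  have "norm (line_integral \<sigma> f) \<le> (\<integral>t. norm (f (Complex \<sigma> t)) \<partial>lborel)"
    unfolding line_integral_def by (rule integral_norm_bound)
  also have "\<dots> \<le> (\<integral>t. C * (1 / (1 + t\<^sup>2)) \<partial>lborel)"
    by (rule integral_mono[OF integrable_norm[OF int] integrable_mult_right[OF integrable_inverse_one_plus_square]])
      (use assms in \<open>simp add: line_decay_def\<close>)
  also have "\<dots> = C * cauchy_mass" by (rule Bochner_Integration.integral_mult_right_zero)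
  finally show ?thesis .
qed

lemma continuous_on_line:
  assumes "continuous_on S f" "\<And>t. Complex \<sigma> t \<in> S"
  shows "continuous_on UNIV (\<lambda>t. f (Complex \<sigma> t))"
  using assms by (intro continuous_on_compose2[OF assms(1)]) (auto intro!: continuous_intros simp: Complex_eq)

text \<open>The Gamma and zeta bounds are available only for |Im s| \<ge> 1; the middle piece is
  covered by compactness.\<close>

lemma line_decayI:
  assumes cont: "continuous_on UNIV (\<lambda>t. f (Complex \<sigma> t))"
    and bd: "\<And>t. \<bar>t\<bar> \<ge> 1 \<Longrightarrow> norm (f (Complex \<sigma> t)) \<le> C / (1 + t\<^sup>2)"
  shows "\<exists>C'. line_decay \<sigma> f C'"
proof -
  have "bounded ((\<lambda>t. f (Complex \<sigma> t)) ` {-1..1})"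
    by (intro compact_imp_bounded compact_continuous_image continuous_on_subset[OF cont]) auto
  then obtain M where "\<forall>y\<in>(\<lambda>t. f (Complex \<sigma> t)) ` {-1..1}. norm y \<le> M" unfolding bounded_iff by blast
  then have M: "\<And>t. t \<in> {-1..1} \<Longrightarrow> norm (f (Complex \<sigma> t)) \<le> M" by simp
  have "norm (f (Complex \<sigma> t)) \<le> (\<bar>C\<bar> + 2 * \<bar>M\<bar>) / (1 + t\<^sup>2)" for t
  proof (cases "\<bar>t\<bar> \<ge> 1")
    case True
    have "norm (f (Complex \<sigma> t)) \<le> C / (1 + t\<^sup>2)" by (rule bd[OF True])
    also have "\<dots> \<le> (\<bar>C\<bar> + 2 * \<bar>M\<bar>) / (1 + t\<^sup>2)" by (intro divide_right_mono add_nonneg_nonneg) auto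
    finally show ?thesis .
  next
    case False
    then have t: "t\<^sup>2 \<le> 1" by (simp add: abs_square_le_1)
    have "t \<in> {-1..1}" using False by auto
    then have "norm (f (Complex \<sigma> t)) \<le> \<bar>M\<bar>" using M[of t] by linarith
    then have "norm (f (Complex \<sigma> t)) * (1 + t\<^sup>2) \<le> \<bar>M\<bar> * 2"
      using t by (intro mult_mono) auto
    moreover have "1 + t\<^sup>2 > 0" by (rule add_pos_nonneg) auto
    ultimately have "norm (f (Complex \<sigma> t)) \<le> \<bar>M\<bar> * 2 / (1 + t\<^sup>2)" by (simp add: le_divide_eq)
    also have "\<dots> \<le> (\<bar>C\<bar> + 2 * \<bar>M\<bar>) / (1 + t\<^sup>2)" by (intro divide_right_mono add_nonneg_nonneg) auto
    finally show ?thesis .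
  qed
  with cont show ?thesis unfolding line_decay_def by blast
qed

text \<open>Residue theorem on rectangles of height 2 T. The poles are real and strictly between the
  lines, so they are enclosed for every T > 1, and the horizontal sides contribute O (1 / (1 +
  T^2)).\<close>

lemma line_integral_shift:
  assumes ab: "a < b" and S: "open S" "convex S" "{s. a \<le> Re s \<and> Re s \<le> b} \<subseteq> S" and P: "finite P"
    and G: "G holomorphic_on S - P" and P_in: "\<And>p. p \<in> P \<Longrightarrow> a < Re p \<and> Re p < b \<and> Im p = 0"
    and bd: "\<And>s. a \<le> Re s \<Longrightarrow> Re s \<le> b \<Longrightarrow> \<bar>Im s\<bar> \<ge> 1 \<Longrightarrow> norm (G s) \<le> C / (1 + (Im s)\<^sup>2)"
  shows "\<exists>C'. line_decay a G C'" "\<exists>C'. line_decay b G C'"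
    "line_integral b G = line_integral a G + 2 * pi * (\<Sum>p\<in>P. residue G p)"
proof -
  have contG: "continuous_on (S - P) G" using G by (rule holomorphic_on_imp_continuous_on)
  have lineSP: "Complex \<sigma> t \<in> S - P" if "\<sigma> = a \<or> \<sigma> = b" for \<sigma> t
    using that S(3) P_in[of "Complex \<sigma> t"] ab by auto
  have dec: "\<exists>C'. line_decay \<sigma> G C'" if "\<sigma> = a \<or> \<sigma> = b" for \<sigma>
  proof (rule line_decayI)
    show "continuous_on UNIV (\<lambda>t. G (Complex \<sigma> t))" using lineSP[OF that] by (intro continuous_on_line[OF contG]) blast
    show "norm (G (Complex \<sigma> t)) \<le> C / (1 + t\<^sup>2)" if "\<bar>t\<bar> \<ge> 1" for t
      using bd[of "Complex \<sigma> t"] that \<open>\<sigma> = a \<or> \<sigma> = b\<close> ab by auto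
  qed
  then show "\<exists>C'. line_decay a G C'" "\<exists>C'. line_decay b G C'" by auto
  then obtain Ca Cb where da: "line_decay a G Ca" and db: "line_decay b G Cb" by blast
  let ?R = "2 * pi * \<i> * (\<Sum>p\<in>P. residue G p)"
  \<comment> \<open>By the residue theorem this is minus the sum of the integrals over the two
    horizontal sides.\<close>
  let ?D = "\<lambda>T. contour_integral (vline_segment b T) G - contour_integral (vline_segment a T) G - ?R"
  have C: "C \<ge> 0"
  proof -
    have "0 \<le> norm (G (Complex a 1))" by simp
    also have "\<dots> \<le> C / (1 + 1\<^sup>2)" using bd[of "Complex a 1"] ab by simp
    finally show ?thesis by simp
  qed
  have est: "norm (?D T) \<le> 2 * (b - a) * C * (1 / (1 + T\<^sup>2))" if T: "T > 1" for T
  proof -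
    let ?a1 = "Complex a (- T)" and ?a2 = "Complex b (- T)" and ?a3 = "Complex b T" and ?a4 = "Complex a T"
    let ?g = "rectpath ?a1 ?a3"
    have box: "cbox ?a1 ?a3 \<subseteq> S" using S(3) by (auto simp: in_cbox_complex_iff)
    have img: "path_image ?g \<subseteq> S - P"
    proof
      fix z assume z: "z \<in> path_image ?g"
      have "z \<in> cbox ?a1 ?a3" using path_image_rectpath_subset_cbox[of ?a1 ?a3] z ab T by auto
      moreover have "z \<notin> box ?a1 ?a3" using path_image_rectpath_inter_box[of ?a1 ?a3] z ab T by auto
      moreover have "p \<in> box ?a1 ?a3" if "p \<in> P" for p using P_in[OF that] T by (auto simp: in_box_complex_iff)
      ultimately show "z \<in> S - P" using box by blast
    qed
    have "contour_integral ?g G = 2 * pi * \<i> * (\<Sum>p\<in>P. winding_number ?g p * residue G p)"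
    proof (rule Residue_theorem[OF S(1) convex_connected[OF S(2)] P G _ _ img])
      show "\<forall>z. z \<notin> S \<longrightarrow> winding_number ?g z = 0"
        using box ab T by (auto intro!: winding_number_rectpath_outside)
    qed auto
    also have "(\<Sum>p\<in>P. winding_number ?g p * residue G p) = (\<Sum>p\<in>P. residue G p)"
    proof (intro sum.cong refl)
      fix p assume "p \<in> P"
      then have "p \<in> box ?a1 ?a3" using P_in T by (auto simp: in_box_complex_iff)
      then show "winding_number ?g p * residue G p = residue G p" by (simp add: winding_number_rectpath)
    qed
    finally have res: "contour_integral ?g G = ?R" .
    have im: "path_image ?g = closed_segment ?a1 ?a2 \<union> closed_segment ?a2 ?a3 \<union> closed_segment ?a3 ?a4 \<union> closed_segment ?a4 ?a1"
      by (simp add: rectpath_def Let_def path_image_join Un_assoc)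
    have c: "continuous_on (closed_segment ?a1 ?a2) G" "continuous_on (closed_segment ?a2 ?a3) G"
      "continuous_on (closed_segment ?a3 ?a4) G" "continuous_on (closed_segment ?a4 ?a1) G"
      by (rule continuous_on_subset[OF contG], use img im in blast)+
    note ci = c[THEN contour_integrable_continuous_linepath]
    have split: "contour_integral ?g G = contour_integral (linepath ?a1 ?a2) G + (contour_integral (linepath ?a2 ?a3) G +
        (contour_integral (linepath ?a3 ?a4) G + contour_integral (linepath ?a4 ?a1) G))"
      unfolding rectpath_def Let_def
      using ci by (simp add: contour_integral_join contour_integrable_joinI valid_path_join)
    have left: "contour_integral (linepath ?a4 ?a1) G = - contour_integral (vline_segment a T) G"
      unfolding vline_segment_def by (rule contour_integral_reverse_linepath[OF c(4)])
    have hor: "norm (contour_integral (linepath (Complex x y) (Complex x' y)) G) \<le> (b - a) * C * (1 / (1 + T\<^sup>2))"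
      if xy: "\<bar>y\<bar> = T" "{x, x'} = {a, b}" and ci: "G contour_integrable_on (linepath (Complex x y) (Complex x' y))" for x x' y
    proof -
      have "norm (contour_integral (linepath (Complex x y) (Complex x' y)) G) \<le> C / (1 + T\<^sup>2) * norm (Complex x' y - Complex x y)"
      proof (rule contour_integral_bound_linepath[OF ci])
        show "0 \<le> C / (1 + T\<^sup>2)" using C by (intro divide_nonneg_nonneg) auto
        fix s assume "s \<in> closed_segment (Complex x y) (Complex x' y)"
        then have "Im s = y" "Re s \<in> closed_segment x x'" by (auto simp: closed_segment_same_Im)
        moreover have "closed_segment x x' = {a..b}"
          using xy(2) ab by (auto simp: doubleton_eq_iff closed_segment_eq_real_ivl)
        ultimately have "norm (G s) \<le> C / (1 + (Im s)\<^sup>2)" using xy T by (intro bd) auto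
        also have "(Im s)\<^sup>2 = T\<^sup>2" using \<open>Im s = y\<close> xy(1) by (metis power2_abs)
        finally show "norm (G s) \<le> C / (1 + T\<^sup>2)" .
      qed
      also have "Complex x' y - Complex x y = complex_of_real (x' - x)" by (simp add: complex_eq_iff)
      also have "norm (complex_of_real (x' - x)) = b - a"
      proof -
        have "x = a \<and> x' = b \<or> x = b \<and> x' = a" using xy(2) by (auto simp: doubleton_eq_iff)
        then show ?thesis using ab unfolding norm_of_real by linarith
      qed
      finally show ?thesis by (simp add: mult_ac)
    qed
    have "norm (contour_integral (linepath ?a1 ?a2) G) \<le> (b - a) * C * (1 / (1 + T\<^sup>2))"
      by (rule hor) (use T ci(1) in auto)
    moreover have "norm (contour_integral (linepath ?a3 ?a4) G) \<le> (b - a) * C * (1 / (1 + T\<^sup>2))"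
      by (rule hor) (use T ci(3) in auto)
    moreover have "?D T = - (contour_integral (linepath ?a1 ?a2) G + contour_integral (linepath ?a3 ?a4) G)"
      using res split left by (simp add: vline_segment_def algebra_simps)
    moreover have "norm z \<le> k + k" if "norm u \<le> k" "norm v \<le> k" "z = - (u + v)" for u v z :: complex and k
      unfolding that(3) norm_minus_cancel using norm_triangle_ineq[of u v] that by linarith
    ultimately have "norm (?D T) \<le> (b - a) * C * (1 / (1 + T\<^sup>2)) + (b - a) * C * (1 / (1 + T\<^sup>2))"
      by blast
    then show ?thesis by (simp only: mult_2[symmetric] mult.assoc)
  qed
  have "((\<lambda>T::real. 2 * (b - a) * C * (1 / (1 + T\<^sup>2))) \<longlongrightarrow> 2 * (b - a) * C * 0) at_top"
  proof (intro tendsto_mult tendsto_const)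
    have "filterlim (\<lambda>T::real. 1 + T\<^sup>2) at_top at_top"
      by (intro filterlim_tendsto_add_at_top[OF tendsto_const] filterlim_pow_at_top filterlim_ident) auto
    then show "((\<lambda>T::real. 1 / (1 + T\<^sup>2)) \<longlongrightarrow> 0) at_top"
      using tendsto_inverse_0_at_top by (simp add: inverse_eq_divide)
  qed
  then have lim: "((\<lambda>T::real. 2 * (b - a) * C * (1 / (1 + T\<^sup>2))) \<longlongrightarrow> 0) at_top" by simp
  have "eventually (\<lambda>T. norm (?D T) \<le> 2 * (b - a) * C * (1 / (1 + T\<^sup>2))) at_top"
    using eventually_gt_at_top[of 1] by (rule eventually_mono) (rule est)
  then have "(?D \<longlongrightarrow> 0) at_top" using lim by (rule Lim_null_comparison)
  moreover have "(?D \<longlongrightarrow> \<i> * line_integral b G - \<i> * line_integral a G - ?R) at_top"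
    by (intro tendsto_diff tendsto_const line_decay_contour(2)[OF da] line_decay_contour(2)[OF db])
  ultimately have "\<i> * line_integral b G - \<i> * line_integral a G - ?R = 0"
    by (intro tendsto_unique[of at_top ?D]) auto
  then have "\<i> * (line_integral b G - (line_integral a G + 2 * pi * (\<Sum>p\<in>P. residue G p))) = 0"
    by (simp add: algebra_simps)
  then show "line_integral b G = line_integral a G + 2 * pi * (\<Sum>p\<in>P. residue G p)" by simp
qed

section \<open>Residues and decay of the Mellin kernels\<close>

lemma residue_Gamma_mult:
  assumes S: "open S" "- of_nat k \<in> S" and h: "h holomorphic_on S"
  shows "residue (\<lambda>s. Gamma s * h s) (- of_nat k) = (-1) ^ k / fact k * h (- of_nat k)"
proof (rule residue_simple')
  let ?S = "S \<inter> - (\<int>\<^sub>\<le>\<^sub>0 - {- of_nat k})"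
  show "open ?S" using S by (intro open_Int open_Compl closed_subset_Ints) auto
  show "- of_nat k \<in> ?S" using S by auto
  show "(\<lambda>s. Gamma s * h s) holomorphic_on ?S - {- of_nat k}"
    by (intro holomorphic_on_mult holomorphic_Gamma holomorphic_on_subset[OF h]) auto
  have "isCont h (- of_nat k)"
    using h S by (intro continuous_on_interior[OF holomorphic_on_imp_continuous_on[OF h]]) (simp add: interior_open)
  then have "(h \<longlongrightarrow> h (- of_nat k)) (at (- of_nat k))" by (simp add: isCont_def)
  then have "((\<lambda>s. Gamma s * (s + of_nat k) * h s) \<longlongrightarrow> (-1) ^ k / fact k * h (- of_nat k)) (at (- of_nat k))"
    by (intro tendsto_mult Gamma_residues)
  then show "((\<lambda>s. Gamma s * h s * (s - - of_nat k)) \<longlongrightarrow> (-1) ^ k / fact k * h (- of_nat k)) (at (- of_nat k))"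
    by (simp add: mult_ac)
qed

lemma norm_powr_minus_le:
  assumes "w \<noteq> 0"
  shows "norm (w powr (- s)) \<le> norm w powr (- Re s) * exp (\<bar>Arg w\<bar> * \<bar>Im s\<bar>)"
proof -
  have "norm (w powr (- s)) = exp (- Re s * ln (norm w) + Im s * Arg w)"
    using assms by (simp add: powr_def Re_Ln Arg_eq_Im_Ln)
  also have "\<dots> \<le> exp (- Re s * ln (norm w) + \<bar>Arg w\<bar> * \<bar>Im s\<bar>)"
    using abs_ge_self[of "Im s * Arg w"] by (simp add: abs_mult mult.commute)
  also have "\<dots> = norm w powr (- Re s) * exp (\<bar>Arg w\<bar> * \<bar>Im s\<bar>)"
  proof -
    have "norm w powr (- Re s) = exp (- Re s * ln (norm w))" using assms by (simp add: powr_def)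
    then show ?thesis by (simp only: exp_add)
  qed
  finally show ?thesis .
qed

lemma abs_Arg_less: "Re w > 0 \<Longrightarrow> \<bar>Arg w\<bar> < pi / 2"
  using Re_Ln_pos_lt[of w] by (cases "w = 0") (auto simp: Arg_eq_Im_Ln)

lemma Gamma_strip_bound_mult:
  assumes F: "\<And>s. a \<le> Re s \<Longrightarrow> Re s \<le> b \<Longrightarrow> \<bar>Im s\<bar> \<ge> 1 \<Longrightarrow> norm (F s) \<le> D * (1 + norm s) ^ p" and D: "D \<ge> 0"
  shows "\<exists>C m. C \<ge> 0 \<and> (\<forall>s. a \<le> Re s \<longrightarrow> Re s \<le> b \<longrightarrow> \<bar>Im s\<bar> \<ge> 1 \<longrightarrow>
     norm (Gamma s * F s) \<le> C * (1 + \<bar>Im s\<bar>) ^ m * exp (- (pi / 2) * \<bar>Im s\<bar>))"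
proof -
  obtain C m where C: "C \<ge> 0" "\<And>s. a \<le> Re s \<Longrightarrow> Re s \<le> b \<Longrightarrow> \<bar>Im s\<bar> \<ge> 1 \<Longrightarrow>
     norm (Gamma s) \<le> C * (1 + \<bar>Im s\<bar>) ^ m * exp (- (pi / 2) * \<bar>Im s\<bar>)" using Gamma_strip_bound[of a b] by blast
  define R where "R = \<bar>a\<bar> + \<bar>b\<bar>"
  have R: "R \<ge> 0" by (simp add: R_def)
  have "norm (Gamma s * F s) \<le> (C * D * (1 + R) ^ p) * (1 + \<bar>Im s\<bar>) ^ (m + p) * exp (- (pi / 2) * \<bar>Im s\<bar>)"
    if s: "a \<le> Re s" "Re s \<le> b" "\<bar>Im s\<bar> \<ge> 1" for s
  proof -
    have "norm s \<le> \<bar>Re s\<bar> + \<bar>Im s\<bar>" by (rule cmod_le)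
    moreover have "\<bar>Re s\<bar> \<le> R" using s by (auto simp: R_def)
    moreover have "0 \<le> R * \<bar>Im s\<bar>" using R by simp
    moreover have "(1 + R) * (1 + \<bar>Im s\<bar>) = 1 + R + \<bar>Im s\<bar> + R * \<bar>Im s\<bar>" by (simp add: algebra_simps)
    ultimately have "1 + norm s \<le> (1 + R) * (1 + \<bar>Im s\<bar>)" by linarith
    then have "D * (1 + norm s) ^ p \<le> D * ((1 + R) * (1 + \<bar>Im s\<bar>)) ^ p"
      using D by (intro mult_left_mono power_mono) auto
    then have "norm (F s) \<le> D * ((1 + R) * (1 + \<bar>Im s\<bar>)) ^ p" using F[OF s] by linarith
    then have "norm (Gamma s * F s) \<le> (C * (1 + \<bar>Im s\<bar>) ^ m * exp (- (pi / 2) * \<bar>Im s\<bar>)) * (D * ((1 + R) * (1 + \<bar>Im s\<bar>)) ^ p)"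
      unfolding norm_mult using C s by (intro mult_mono) auto
    then show ?thesis by (simp add: power_mult_distrib power_add mult_ac)
  qed
  moreover have "C * D * (1 + R) ^ p \<ge> 0" using C D R by simp
  ultimately show ?thesis by blast
qed

text \<open>For Re w > 0 the decay of Gamma exceeds the growth of w ^ (- s) by exp (- d |Im s|) with
  d = pi / 2 - |arg w| > 0, and this absorbs the polynomial factor.\<close>

lemma strip_decay:
  assumes B: "\<And>s. a \<le> Re s \<Longrightarrow> Re s \<le> b \<Longrightarrow> \<bar>Im s\<bar> \<ge> 1 \<Longrightarrow>
      norm (B s) \<le> C * (1 + \<bar>Im s\<bar>) ^ m * exp (- (pi / 2) * \<bar>Im s\<bar>)" and C: "C \<ge> 0" and w: "Re w > 0"
  shows "\<exists>C'. \<forall>s. a \<le> Re s \<longrightarrow> Re s \<le> b \<longrightarrow> \<bar>Im s\<bar> \<ge> 1 \<longrightarrow> norm (B s * w powr (- s)) \<le> C' / (1 + (Im s)\<^sup>2)"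
proof -
  define d where "d = pi / 2 - \<bar>Arg w\<bar>"
  have d: "d > 0" using abs_Arg_less[OF w] by (simp add: d_def)
  have w0: "w \<noteq> 0" using w by auto
  obtain E where E: "E \<ge> 0" "\<And>x. x \<ge> 0 \<Longrightarrow> (1 + x) ^ m * exp (- d * x) \<le> E / (1 + x\<^sup>2)"
    using power_times_exp_bound[OF d, of m] by blast
  \<comment> \<open>The power of |w| is largest at one end of the strip or the other, depending on
    whether |w| is at least 1.\<close>
  let ?W = "norm w powr (- a) + norm w powr (- b)"
  have "norm (B s * w powr (- s)) \<le> (C * ?W * E) / (1 + (Im s)\<^sup>2)"
    if s: "a \<le> Re s" "Re s \<le> b" "\<bar>Im s\<bar> \<ge> 1" for s
  proof -
    have "norm w powr (- Re s) \<le> ?W"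
    proof (cases "norm w \<ge> 1")
      case True
      then have "norm w powr (- Re s) \<le> norm w powr (- a)" using s by (intro powr_mono) auto
      then show ?thesis using powr_ge_zero[of "norm w" "- b"] by linarith
    next
      case False
      then have "norm w powr (- Re s) \<le> norm w powr (- b)" using s w0 by (intro powr_mono') auto
      then show ?thesis using powr_ge_zero[of "norm w" "- a"] by linarith
    qed
    then have "norm (w powr (- s)) \<le> ?W * exp (\<bar>Arg w\<bar> * \<bar>Im s\<bar>)"
      by (intro order_trans[OF norm_powr_minus_le[OF w0]] mult_right_mono) auto
    then have "norm (B s * w powr (- s)) \<le> (C * (1 + \<bar>Im s\<bar>) ^ m * exp (- (pi / 2) * \<bar>Im s\<bar>)) * (?W * exp (\<bar>Arg w\<bar> * \<bar>Im s\<bar>))"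
      unfolding norm_mult using B[OF s] C by (intro mult_mono) auto
    also have "\<dots> = C * ?W * ((1 + \<bar>Im s\<bar>) ^ m * (exp (- (pi / 2) * \<bar>Im s\<bar>) * exp (\<bar>Arg w\<bar> * \<bar>Im s\<bar>)))"
      by (simp only: mult_ac)
    also have "exp (- (pi / 2) * \<bar>Im s\<bar>) * exp (\<bar>Arg w\<bar> * \<bar>Im s\<bar>) = exp (- d * \<bar>Im s\<bar>)"
      unfolding exp_add[symmetric] d_def by (simp add: algebra_simps)
    also have "C * ?W * ((1 + \<bar>Im s\<bar>) ^ m * exp (- d * \<bar>Im s\<bar>)) \<le> C * ?W * (E / (1 + \<bar>Im s\<bar>\<^sup>2))"
      using C by (intro mult_left_mono E(2)) auto
    finally show ?thesis by simp
  qed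
  then show ?thesis by blast
qed

subsection \<open>The Cahen--Mellin integral\<close>

lemma powr_minus_neg_nat:
  assumes "w \<noteq> (0::complex)" shows "w powr (- (- of_nat k)) = w ^ k"
  using assms by (simp add: powr_nat)

lemma prod_half_ge: "(\<Prod>i<Suc K. real i + 1 / 2) \<ge> fact K / 2"
proof (induction K)
  case (Suc K)
  have "fact (Suc K) / 2 = (real (Suc K)) * (fact K / 2)" by simp
  also have "\<dots> \<le> (real (Suc K) + 1 / 2) * (\<Prod>i<Suc K. real i + 1 / 2)" using Suc by (intro mult_mono) auto
  finally show ?case by (simp add: mult.commute)
qed simp

lemma norm_Gamma_neg_half:
  "norm (Gamma (Complex (- real K - 1/2) t)) \<le> 2 * sqrt (2 * pi) / fact K * exp (- (pi / 2) * \<bar>t\<bar>)"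
proof -
  let ?s = "Complex (- real K - 1/2) t"
  have ni: "?s \<notin> \<int>\<^sub>\<le>\<^sub>0"
  proof
    assume "?s \<in> \<int>\<^sub>\<le>\<^sub>0"
    then obtain n where "?s = of_int n" by (elim nonpos_Ints_cases)
    then have "- real K - 1/2 = of_int n" by (simp add: complex_eq_iff)
    then have "of_int (2 * n) = (of_int (- 2 * int K - 1) :: real)" by simp
    then have "2 * n = - 2 * int K - 1" by (simp only: of_int_eq_iff)
    then show False by presburger
  qed
  have "pochhammer ?s (Suc K) = Gamma (?s + of_nat (Suc K)) / Gamma ?s" by (rule pochhammer_Gamma[OF ni])
  moreover have "?s + of_nat (Suc K) = Complex (1/2) t" by (simp add: complex_eq_iff)
  moreover have "Gamma ?s \<noteq> 0" using ni by (simp add: Gamma_eq_zero_iff)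
  ultimately have eq: "norm (Gamma (Complex (1/2) t)) = norm (pochhammer ?s (Suc K)) * norm (Gamma ?s)"
    by (simp add: norm_mult[symmetric])
  have "fact K / 2 \<le> (\<Prod>i<Suc K. real i + 1 / 2)" by (rule prod_half_ge)
  also have "\<dots> = (\<Prod>i<Suc K. real (Suc K - Suc i) + 1 / 2)"
    by (rule prod.nat_diff_reindex[symmetric])
  also have "\<dots> \<le> (\<Prod>i<Suc K. norm (?s + of_nat i))"
  proof (intro prod_mono conjI)
    fix i assume "i \<in> {..<Suc K}"
    then have "real (Suc K - Suc i) + 1 / 2 = \<bar>Re (?s + of_nat i)\<bar>" by (simp add: of_nat_diff)
    then show "real (Suc K - Suc i) + 1 / 2 \<le> norm (?s + of_nat i)" using abs_Re_le_cmod by metis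
  qed auto
  also have "\<dots> = norm (pochhammer ?s (Suc K))"
    unfolding pochhammer_prod by (simp only: prod_norm atLeast0LessThan)
  finally have "fact K / 2 * norm (Gamma ?s) \<le> norm (Gamma (Complex (1/2) t))"
    unfolding eq by (intro mult_right_mono) auto
  also have "\<dots> \<le> sqrt (2 * pi) * exp (- (pi / 2) * \<bar>t\<bar>)" by (rule norm_Gamma_half)
  finally show ?thesis by (simp add: field_simps)
qed

lemma Gamma_line_decay:
  assumes b: "b > 0" and w: "Re w > 0"
  shows "\<exists>C. line_decay b (\<lambda>s. Gamma s * w powr (- s)) C"
proof -
  have w0: "w \<noteq> 0" using w by auto
  obtain C m where C: "C \<ge> 0" "\<And>s. b \<le> Re s \<Longrightarrow> Re s \<le> b \<Longrightarrow> \<bar>Im s\<bar> \<ge> 1 \<Longrightarrow>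
     norm (Gamma s) \<le> C * (1 + \<bar>Im s\<bar>) ^ m * exp (- (pi / 2) * \<bar>Im s\<bar>)" using Gamma_strip_bound[of b b] by blast
  obtain C' where C': "\<And>s. b \<le> Re s \<Longrightarrow> Re s \<le> b \<Longrightarrow> \<bar>Im s\<bar> \<ge> 1 \<Longrightarrow> norm (Gamma s * w powr (- s)) \<le> C' / (1 + (Im s)\<^sup>2)"
    using strip_decay[of b b Gamma, OF C(2) C(1) w] by blast
  show ?thesis
  proof (rule line_decayI)
    have "(\<lambda>s. Gamma s * w powr (- s)) holomorphic_on {s. Re s > 0}"
      using w0 by (intro holomorphic_intros) (auto elim!: nonpos_Ints_cases)
    then show "continuous_on UNIV (\<lambda>t. Gamma (Complex b t) * w powr (- Complex b t))"
      using b by (intro continuous_on_line[OF holomorphic_on_imp_continuous_on]) auto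
    show "norm (Gamma (Complex b t) * w powr (- Complex b t)) \<le> C' / (1 + t\<^sup>2)" if "\<bar>t\<bar> \<ge> 1" for t
      using C'[of "Complex b t"] that by simp
  qed
qed

text \<open>Moving the line to the left past the poles 0, ..., - K leaves the Taylor polynomial of
  exp (- w) as sum of residues; the integral over the new line is of order |w| ^ (K + 1/2) / K! and
  tends to 0.\<close>

lemma cahen_mellin:
  fixes w :: complex
  assumes b: "b > 0" and w: "Re w > 0"
  shows "line_integral b (\<lambda>s. Gamma s * w powr (- s)) = 2 * pi * exp (- w)"
proof -
  let ?G = "\<lambda>s. Gamma s * w powr (- s)"
  have w0: "w \<noteq> 0" using w by auto
  define d where "d = pi / 2 - \<bar>Arg w\<bar>"
  have d: "d > 0" using abs_Arg_less[OF w] by (simp add: d_def)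
  obtain E where E: "E \<ge> 0" "\<And>x. x \<ge> 0 \<Longrightarrow> (1 + x) ^ 0 * exp (- d * x) \<le> E / (1 + x\<^sup>2)"
    using power_times_exp_bound[OF d, of 0] by blast
  have key: "norm (line_integral b ?G - 2 * pi * (\<Sum>k<Suc K. (- w) ^ k /\<^sub>R fact k))
      \<le> 2 * sqrt (2 * pi) * E * cauchy_mass * norm w powr (1/2) * (norm w ^ K / fact K)" for K
  proof -
    \<comment> \<open>Midway between the poles - K and - K - 1, so that exactly K + 1 poles are
      crossed.\<close>
    let ?a = "- real K - 1/2"
    let ?S = "{s. Re s > - real K - 1}" and ?P = "(\<lambda>k. - of_nat k :: complex) ` {..<Suc K}"
    have hol_pow: "(\<lambda>s. w powr (- s)) holomorphic_on X" for X by (intro holomorphic_intros)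
    have hol: "?G holomorphic_on ?S - ?P"
    proof (intro holomorphic_on_mult holomorphic_Gamma hol_pow)
      show "(?S - ?P) \<inter> \<int>\<^sub>\<le>\<^sub>0 = {}"
      proof (intro equals0I)
        fix s assume s: "s \<in> (?S - ?P) \<inter> \<int>\<^sub>\<le>\<^sub>0"
        then obtain n where n: "s = - of_nat n" by (auto elim!: nonpos_Ints_cases')
        with s have "n < Suc K" by auto
        with n s show False by auto
      qed
    qed
    obtain C m where C: "C \<ge> 0" "\<And>s. ?a \<le> Re s \<Longrightarrow> Re s \<le> b \<Longrightarrow> \<bar>Im s\<bar> \<ge> 1 \<Longrightarrow>
      norm (Gamma s) \<le> C * (1 + \<bar>Im s\<bar>) ^ m * exp (- (pi / 2) * \<bar>Im s\<bar>)" using Gamma_strip_bound[of ?a b] by blast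
    obtain C' where C': "\<And>s. ?a \<le> Re s \<Longrightarrow> Re s \<le> b \<Longrightarrow> \<bar>Im s\<bar> \<ge> 1 \<Longrightarrow> norm (?G s) \<le> C' / (1 + (Im s)\<^sup>2)"
      using strip_decay[of ?a b Gamma, OF C(2) C(1) w] by blast
    have ab: "?a < b" using b by simp
    have opS: "open ?S" "convex ?S" using open_halfspace_Re_gt convex_halfspace_Re_gt by auto
    have sub: "{s. ?a \<le> Re s \<and> Re s \<le> b} \<subseteq> ?S" by auto
    have Pin: "?a < Re p \<and> Re p < b \<and> Im p = 0" if "p \<in> ?P" for p using that b by auto
    have "line_integral b ?G = line_integral ?a ?G + 2 * pi * (\<Sum>p\<in>?P. residue ?G p)"
      by (rule line_integral_shift(3)[OF ab opS sub _ hol Pin C']) auto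
    also have "(\<Sum>p\<in>?P. residue ?G p) = (\<Sum>k<Suc K. residue ?G (- of_nat k))"
      by (rule sum.reindex_cong[of "\<lambda>k. - of_nat k"]) (auto simp: inj_on_def)
    also have "\<dots> = (\<Sum>k<Suc K. (- w) ^ k /\<^sub>R fact k)"
    proof (intro sum.cong refl)
      fix k
      have "residue ?G (- of_nat k) = (-1) ^ k / fact k * w powr (- (- of_nat k))"
        by (rule residue_Gamma_mult[OF open_UNIV]) (auto intro: hol_pow)
      then show "residue ?G (- of_nat k) = (- w) ^ k /\<^sub>R fact k"
        using w0 by (simp add: powr_minus_neg_nat power_minus[of w] scaleR_conv_of_real field_simps)
    qed
    finally have shift: "line_integral b ?G - 2 * pi * (\<Sum>k<Suc K. (- w) ^ k /\<^sub>R fact k) = line_integral ?a ?G" by simp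
    have cont: "continuous_on UNIV (\<lambda>t. ?G (Complex ?a t))"
      using line_integral_shift(1)[OF ab opS sub _ hol Pin C'] unfolding line_decay_def by auto
    let ?C = "2 * sqrt (2 * pi) / fact K * norm w powr (real K + 1/2) * E"
    have "line_decay ?a ?G ?C"
      unfolding line_decay_def
    proof (intro conjI cont allI)
      fix t
      have "norm (?G (Complex ?a t)) \<le> (2 * sqrt (2 * pi) / fact K * exp (- (pi / 2) * \<bar>t\<bar>)) *
          (norm w powr (real K + 1/2) * exp (\<bar>Arg w\<bar> * \<bar>t\<bar>))"
        unfolding norm_mult
        using norm_powr_minus_le[OF w0, of "Complex ?a t"] by (intro mult_mono norm_Gamma_neg_half) (auto simp: add.commute)
      also have "\<dots> = 2 * sqrt (2 * pi) / fact K * norm w powr (real K + 1/2) * (exp (- (pi / 2) * \<bar>t\<bar>) * exp (\<bar>Arg w\<bar> * \<bar>t\<bar>))"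
        by (simp only: mult_ac times_divide_eq_left times_divide_eq_right)
      also have "exp (- (pi / 2) * \<bar>t\<bar>) * exp (\<bar>Arg w\<bar> * \<bar>t\<bar>) = exp (- d * \<bar>t\<bar>)"
        unfolding exp_add[symmetric] d_def by (simp add: algebra_simps)
      also have "2 * sqrt (2 * pi) / fact K * norm w powr (real K + 1/2) * exp (- d * \<bar>t\<bar>) \<le>
          2 * sqrt (2 * pi) / fact K * norm w powr (real K + 1/2) * (E / (1 + \<bar>t\<bar>\<^sup>2))"
        using E(2)[of "\<bar>t\<bar>"] by (intro mult_left_mono) auto
      finally show "norm (?G (Complex ?a t)) \<le> ?C / (1 + t\<^sup>2)" by simp
    qed
    from line_decay_norm_le[OF this] have "norm (line_integral ?a ?G) \<le> ?C * cauchy_mass" .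
    also have "?C * cauchy_mass = 2 * sqrt (2 * pi) * E * cauchy_mass * norm w powr (1/2) * (norm w ^ K / fact K)"
      using w0 by (simp add: powr_add powr_realpow mult_ac)
    finally show ?thesis unfolding shift .
  qed
  let ?c = "2 * sqrt (2 * pi) * E * cauchy_mass * norm w powr (1/2)"
  have "(\<lambda>K. norm w ^ K / fact K) \<longlonglongrightarrow> 0"
    using summable_LIMSEQ_zero[OF summable_exp_generic[of "norm w"]] by (simp add: divide_inverse mult.commute)
  then have "(\<lambda>K. ?c * (norm w ^ K / fact K)) \<longlonglongrightarrow> 0" by (rule tendsto_mult_right_zero)
  then have "(\<lambda>K. line_integral b ?G - 2 * pi * (\<Sum>k<Suc K. (- w) ^ k /\<^sub>R fact k)) \<longlonglongrightarrow> 0"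
    by (rule Lim_null_comparison[rotated]) (use key in auto)
  moreover have "(\<lambda>K. \<Sum>k<Suc K. (- w) ^ k /\<^sub>R fact k) \<longlonglongrightarrow> exp (- w)"
    using exp_converges[of "- w"] unfolding sums_def by (rule LIMSEQ_Suc)
  then have "(\<lambda>K. line_integral b ?G - 2 * pi * (\<Sum>k<Suc K. (- w) ^ k /\<^sub>R fact k)) \<longlonglongrightarrow>
      line_integral b ?G - 2 * pi * exp (- w)"
    by (intro tendsto_diff tendsto_mult tendsto_const)
  ultimately have "line_integral b ?G - 2 * pi * exp (- w) = 0" using LIMSEQ_unique by blast
  then show ?thesis by simp
qed

text \<open>True for the principal branch because a positive factor does not change the
  argument.\<close>

lemma powr_of_real_mult:
  assumes "w \<noteq> 0" "r > 0"
  shows "(w * complex_of_real r) powr z = w powr z * complex_of_real r powr z"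
proof -
  have "Ln (w * complex_of_real r) = Ln w + Ln (complex_of_real r)"
  proof -
    have "Ln (complex_of_real r * w) = Ln (complex_of_real r) + Ln w" using Ln_times_of_real[of r w] assms by simp
    then show ?thesis by (simp only: mult.commute add.commute)
  qed
  then show ?thesis using assms by (simp add: powr_def exp_add[symmetric] distrib_left)
qed

subsection \<open>The theta function\<close>

context cutoff_dilation
begin

abbreviation "mellin_kernel w s \<equiv> Gamma s * zfun s * w powr (- s)"

text \<open>Integrating the Dirichlet series termwise is justified through finite partial sums: on
  the line Re s = b the tail of the series is bounded by a real tail that does not depend on the
  ordinate, while Gamma times the power of w is integrable.\<close>

lemma theta_mellin:
  assumes w: "Re w > 0" and b: "b > \<alpha>"
  shows "((\<lambda>x. exp (- (w * complex_of_real (\<phi> x)))) has_sum line_integral b (mellin_kernel w) / (2 * pi)) (int_lattice - {0})"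
proof -
  let ?L = "int_lattice - {0} :: (real^'n) set"
  let ?G = "\<lambda>s. Gamma s * w powr (- s)"
  have b0: "b > 0" using b trace_pos by linarith
  have w0: "w \<noteq> 0" using w by auto
  obtain C where C: "line_decay b ?G C" using Gamma_line_decay[OF b0 w] by blast
  define f where "f x = \<phi> x powr (- b)" for x
  have fsum: "f summable_on ?L" unfolding f_def using zfun_series(1)[of "complex_of_real b"] b by simp
  define S where "S = infsum f ?L"
  have S: "(f has_sum S) ?L" unfolding S_def using fsum by (rule has_sum_infsum)
  have contG: "continuous_on UNIV (\<lambda>t. ?G (Complex b t))" using C by (simp add: line_decay_def)
  have contz: "continuous_on UNIV (\<lambda>t. zfun (Complex b t))"
    using b by (intro continuous_on_line[OF holomorphic_on_imp_continuous_on[OF zfun_holomorphic]]) (auto simp: complex_eq_iff)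
  have contp: "continuous_on UNIV (\<lambda>t. complex_of_real (\<phi> x) powr (- Complex b t))" for x
    by (cases "x = 0") (auto intro!: continuous_on_line[OF holomorphic_on_imp_continuous_on, of _ UNIV] holomorphic_intros dest: phi_pos)
  define g where "g x s = complex_of_real (\<phi> x) powr (- s)" for x s
  have bound: "norm (line_integral b (mellin_kernel w) / (2 * pi) - (\<Sum>x\<in>X. exp (- (w * complex_of_real (\<phi> x)))))
      \<le> C * cauchy_mass / (2 * pi) * (S - sum f X)" if X: "finite X" "X \<subseteq> ?L" for X
  proof -
    have pos: "\<phi> x > 0" if "x \<in> X" for x using that X by (intro phi_pos) auto
    \<comment> \<open>The kernel minus its finitely many terms from \<open>X\<close>; each of those
      terms is a Cahen-Mellin integral with w \<phi> x in place of w.\<close>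
    let ?r = "\<lambda>s. ?G s * (zfun s - (\<Sum>x\<in>X. g x s))"
    have rem: "norm (zfun (Complex b t) - (\<Sum>x\<in>X. g x (Complex b t))) \<le> S - sum f X" for t
    proof (rule norm_has_sum_bound)
      show "((\<lambda>x. g x (Complex b t)) has_sum (zfun (Complex b t) - (\<Sum>x\<in>X. g x (Complex b t)))) (?L - X)"
        unfolding g_def using b X by (intro has_sum_Diff zfun_series(2) has_sum_finite) auto
      have "(f has_sum (S - sum f X)) (?L - X)" using X by (intro has_sum_Diff S has_sum_finite) auto
      then show "((\<lambda>x. norm (g x (Complex b t))) has_sum (S - sum f X)) (?L - X)"
        by (rule has_sum_cong[THEN iffD1, rotated]) (auto simp: f_def g_def norm_of_real_powr phi_pos)
    qed
    have dec_r: "line_decay b ?r (C * (S - sum f X))"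
      unfolding line_decay_def
    proof (intro conjI allI)
      show "continuous_on UNIV (\<lambda>t. ?r (Complex b t))"
        unfolding g_def by (intro continuous_on_mult continuous_on_diff continuous_on_sum contG contz contp)
      fix t
      have "norm (?r (Complex b t)) \<le> C / (1 + t\<^sup>2) * (S - sum f X)"
        unfolding norm_mult[of "?G (Complex b t)"]
      proof (intro mult_mono rem)
        show "norm (?G (Complex b t)) \<le> C / (1 + t\<^sup>2)" using C by (simp add: line_decay_def)
        then show "0 \<le> C / (1 + t\<^sup>2)" using norm_ge_zero order_trans by blast
      qed simp
      then show "norm (?r (Complex b t)) \<le> C * (S - sum f X) / (1 + t\<^sup>2)" by simp
    qed
    have each: "integrable lborel (\<lambda>t. ?G (Complex b t) * g x (Complex b t))"
      "(\<integral>t. ?G (Complex b t) * g x (Complex b t) \<partial>lborel) = 2 * pi * exp (- (w * complex_of_real (\<phi> x)))" if "x \<in> X" for x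
    proof -
      have wx: "Re (w * complex_of_real (\<phi> x)) > 0" using w pos[OF that] by simp
      have eq: "Gamma s * (w * complex_of_real (\<phi> x)) powr (- s) = ?G s * g x s" for s
        unfolding g_def by (simp add: powr_of_real_mult[OF w0 pos[OF that]])
      obtain C2 where "line_decay b (\<lambda>s. Gamma s * (w * complex_of_real (\<phi> x)) powr (- s)) C2"
        using Gamma_line_decay[OF b0 wx] by blast
      from line_decay_integrable[OF this] show "integrable lborel (\<lambda>t. ?G (Complex b t) * g x (Complex b t))" unfolding eq .
      show "(\<integral>t. ?G (Complex b t) * g x (Complex b t) \<partial>lborel) = 2 * pi * exp (- (w * complex_of_real (\<phi> x)))"
        using cahen_mellin[OF b0 wx] unfolding line_integral_def eq .
    qed
    have "line_integral b (mellin_kernel w) = (\<integral>t. ?r (Complex b t) + (\<Sum>x\<in>X. ?G (Complex b t) * g x (Complex b t)) \<partial>lborel)"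
      unfolding line_integral_def
    proof (intro Bochner_Integration.integral_cong refl)
      fix t
      have gen: "u * z * v = u * v * (z - r) + u * v * r" for u v z r :: complex
      proof -
        have "u * v * (z - r) + u * v * r = u * v * (z - r + r)" by (rule distrib_left[symmetric])
        then show ?thesis by (simp add: mult.commute mult.left_commute)
      qed
      show "mellin_kernel w (Complex b t) = ?r (Complex b t) + (\<Sum>x\<in>X. ?G (Complex b t) * g x (Complex b t))"
      proof -
        have "(\<Sum>x\<in>X. ?G (Complex b t) * g x (Complex b t)) = ?G (Complex b t) * (\<Sum>x\<in>X. g x (Complex b t))"
          by (rule sum_distrib_left[symmetric])
        then show ?thesis using gen[of "Gamma (Complex b t)" "zfun (Complex b t)" "w powr (- Complex b t)" "\<Sum>x\<in>X. g x (Complex b t)"]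
          by (simp only:)
      qed
    qed
    also have "\<dots> = line_integral b ?r + (\<Sum>x\<in>X. \<integral>t. ?G (Complex b t) * g x (Complex b t) \<partial>lborel)"
      unfolding line_integral_def
    proof (subst Bochner_Integration.integral_add)
      show "integrable lborel (\<lambda>t. ?r (Complex b t))" by (rule line_decay_integrable[OF dec_r])
      show "integrable lborel (\<lambda>t. \<Sum>x\<in>X. ?G (Complex b t) * g x (Complex b t))"
        by (intro Bochner_Integration.integrable_sum each(1))
      show "(\<integral>t. ?r (Complex b t) \<partial>lborel) + (\<integral>t. (\<Sum>x\<in>X. ?G (Complex b t) * g x (Complex b t)) \<partial>lborel) =
          (\<integral>t. ?r (Complex b t) \<partial>lborel) + (\<Sum>x\<in>X. \<integral>t. ?G (Complex b t) * g x (Complex b t) \<partial>lborel)"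
        by (rule arg_cong[where f = "\<lambda>z. (\<integral>t. ?r (Complex b t) \<partial>lborel) + z"])
          (intro Bochner_Integration.integral_sum each(1))
    qed
    also have "(\<Sum>x\<in>X. \<integral>t. ?G (Complex b t) * g x (Complex b t) \<partial>lborel) = 2 * pi * (\<Sum>x\<in>X. exp (- (w * complex_of_real (\<phi> x))))"
      unfolding sum_distrib_left by (intro sum.cong refl each(2))
    finally have "line_integral b (mellin_kernel w) / (2 * pi) - (\<Sum>x\<in>X. exp (- (w * complex_of_real (\<phi> x)))) = line_integral b ?r / (2 * pi)"
      by (simp add: field_simps)
    also have "norm \<dots> \<le> (C * (S - sum f X) * cauchy_mass) / (2 * pi)"
      using line_decay_norm_le[OF dec_r] by (simp add: norm_divide norm_mult divide_right_mono)
    finally show ?thesis by (simp add: mult_ac)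
  qed
  have "((\<lambda>X. C * cauchy_mass / (2 * pi) * (S - sum f X)) \<longlongrightarrow> C * cauchy_mass / (2 * pi) * (S - S)) (finite_subsets_at_top ?L)"
    using S unfolding has_sum_def by (intro tendsto_mult tendsto_diff tendsto_const)
  then have lim: "((\<lambda>X. C * cauchy_mass / (2 * pi) * (S - sum f X)) \<longlongrightarrow> 0) (finite_subsets_at_top ?L)" by simp
  have "eventually (\<lambda>X. norm (line_integral b (mellin_kernel w) / (2 * pi) - (\<Sum>x\<in>X. exp (- (w * complex_of_real (\<phi> x)))))
      \<le> C * cauchy_mass / (2 * pi) * (S - sum f X)) (finite_subsets_at_top ?L)"
    by (rule eventually_finite_subsets_at_top_weakI) (rule bound)
  then have "((\<lambda>X. line_integral b (mellin_kernel w) / (2 * pi) - (\<Sum>x\<in>X. exp (- (w * complex_of_real (\<phi> x))))) \<longlongrightarrow> 0) (finite_subsets_at_top ?L)"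
    using lim by (rule Lim_null_comparison)
  then have "((\<lambda>X. line_integral b (mellin_kernel w) / (2 * pi) - (line_integral b (mellin_kernel w) / (2 * pi) - (\<Sum>x\<in>X. exp (- (w * complex_of_real (\<phi> x))))))
      \<longlongrightarrow> line_integral b (mellin_kernel w) / (2 * pi) - 0) (finite_subsets_at_top ?L)"
    by (intro tendsto_diff tendsto_const)
  then show ?thesis unfolding has_sum_def by simp
qed

text \<open>The condition |Im s| \<ge> 1 keeps \<open>s\<close> at distance at least 1 from the
  pole, so the polar part is bounded by \<alpha> vol.\<close>

lemma zfun_growth:
  "\<exists>D p. D \<ge> 0 \<and> (\<forall>s. a \<le> Re s \<longrightarrow> Re s \<le> b \<longrightarrow> \<bar>Im s\<bar> \<ge> 1 \<longrightarrow> norm (zfun s) \<le> D * (1 + norm s) ^ p)"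
proof -
  define M where "M = nat \<lceil>\<bar>a\<bar> + \<bar>b\<bar>\<rceil>"
  have M: "\<bar>a\<bar> + \<bar>b\<bar> \<le> real M" unfolding M_def by linarith
  obtain p C where C: "C \<ge> 0" "\<And>s. \<bar>Re s\<bar> \<le> real M \<Longrightarrow> norm (Dlim s) \<le> C * (1 + norm s) ^ p"
    using Dlim_growth[of M] by blast
  have v: "\<alpha> * vol \<ge> 0" using trace_pos vol_pos by simp
  have "norm (zfun s) \<le> (\<alpha> * vol + C) * (1 + norm s) ^ p" if s: "a \<le> Re s" "Re s \<le> b" "\<bar>Im s\<bar> \<ge> 1" for s
  proof -
    have "1 \<le> norm (s - complex_of_real \<alpha>)" using abs_Im_le_cmod[of "s - complex_of_real \<alpha>"] s by simp
    then have "norm (complex_of_real (\<alpha> * vol)) / norm (s - complex_of_real \<alpha>) \<le> \<alpha> * vol / 1"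
      unfolding norm_of_real using v by (intro frac_le) auto
    moreover have "\<alpha> * vol * 1 \<le> \<alpha> * vol * (1 + norm s) ^ p" using v by (intro mult_left_mono) auto
    moreover have "\<bar>Re s\<bar> \<le> real M" using s M by linarith
    then have "norm (Dlim s) \<le> C * (1 + norm s) ^ p" by (rule C(2))
    ultimately have "norm (complex_of_real (\<alpha> * vol) / (s - complex_of_real \<alpha>)) + norm (Dlim s) \<le> (\<alpha> * vol + C) * (1 + norm s) ^ p"
      by (simp only: norm_divide) (simp add: distrib_right)
    then show ?thesis unfolding zfun_def using norm_triangle_ineq order_trans by blast
  qed
  then show ?thesis using v C(1) by (intro exI[of _ "\<alpha> * vol + C"] exI[of _ p]) auto
qed

lemma Gamma_zfun_strip:
  "\<exists>C m. C \<ge> 0 \<and> (\<forall>s. a \<le> Re s \<longrightarrow> Re s \<le> b \<longrightarrow> \<bar>Im s\<bar> \<ge> 1 \<longrightarrow>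
     norm (Gamma s * zfun s) \<le> C * (1 + \<bar>Im s\<bar>) ^ m * exp (- (pi / 2) * \<bar>Im s\<bar>))"
proof -
  obtain D p where "D \<ge> 0" "\<And>s. a \<le> Re s \<Longrightarrow> Re s \<le> b \<Longrightarrow> \<bar>Im s\<bar> \<ge> 1 \<Longrightarrow> norm (zfun s) \<le> D * (1 + norm s) ^ p"
    using zfun_growth[of a b] by blast
  from Gamma_strip_bound_mult[of a b zfun D p, OF this(2,1)] show ?thesis by blast
qed

text \<open>The new line lies between the poles - N - 1 and - N, so the residues at \<alpha> and at
  0, -1, ..., - N are collected. At \<alpha> the residue of zeta is \<alpha> vol, which combines
  with Gamma \<alpha> to Gamma (\<alpha> + 1) vol.\<close>

lemma theta_shift:
  assumes w: "Re w > 0" and e: "0 < e" "e < 1"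
  shows "\<exists>C. line_decay (- real N - 1 + e) (mellin_kernel w) C"
    and "line_integral (\<alpha> + 1) (mellin_kernel w) = line_integral (- real N - 1 + e) (mellin_kernel w)
      + 2 * pi * (Gamma (complex_of_real \<alpha> + 1) * complex_of_real vol * w powr (- complex_of_real \<alpha>)
        + (\<Sum>k=0..N. (-1) ^ k * zfun (- of_nat k) / fact k * w ^ k))"
proof -
  let ?a = "- real N - 1 + e" and ?b = "\<alpha> + 1"
  let ?S = "{s. Re s > - real N - 1}" and ?N = "(\<lambda>k. - of_nat k :: complex) ` {0..N}"
  let ?\<alpha> = "complex_of_real \<alpha>"
  let ?P = "insert ?\<alpha> ?N"
  have w0: "w \<noteq> 0" using w by auto
  have ap: "\<alpha> > 0" by (rule trace_pos)
  have ab: "?a < ?b" using e ap by simp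
  have opS: "open ?S" "convex ?S" using open_halfspace_Re_gt convex_halfspace_Re_gt by auto
  have nN: "?\<alpha> \<notin> ?N"
  proof
    assume "?\<alpha> \<in> ?N"
    then obtain k :: nat where "?\<alpha> = - of_nat k" by auto
    then have "\<alpha> = - real k" by (simp add: complex_eq_iff)
    with ap show False by simp
  qed
  have nonpos: "s \<in> ?N" if "s \<in> ?S" "s \<in> \<int>\<^sub>\<le>\<^sub>0" for s
  proof -
    obtain n where n: "s = - of_nat n" using \<open>s \<in> \<int>\<^sub>\<le>\<^sub>0\<close> by (auto elim!: nonpos_Ints_cases')
    with that(1) have "n < Suc N" by auto
    then show ?thesis using n by auto
  qed
  have hol_pow: "(\<lambda>s. w powr (- s)) holomorphic_on X" for X by (intro holomorphic_intros)
  have hol: "mellin_kernel w holomorphic_on ?S - ?P"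
    by (intro holomorphic_on_mult holomorphic_Gamma hol_pow holomorphic_on_subset[OF zfun_holomorphic]) (use nonpos in blast)+
  obtain C m where C: "C \<ge> 0" "\<And>s. ?a \<le> Re s \<Longrightarrow> Re s \<le> ?b \<Longrightarrow> \<bar>Im s\<bar> \<ge> 1 \<Longrightarrow>
    norm (Gamma s * zfun s) \<le> C * (1 + \<bar>Im s\<bar>) ^ m * exp (- (pi / 2) * \<bar>Im s\<bar>)" using Gamma_zfun_strip[of ?a ?b] by blast
  obtain C' where C': "\<And>s. ?a \<le> Re s \<Longrightarrow> Re s \<le> ?b \<Longrightarrow> \<bar>Im s\<bar> \<ge> 1 \<Longrightarrow> norm (mellin_kernel w s) \<le> C' / (1 + (Im s)\<^sup>2)"
    using strip_decay[of ?a ?b "\<lambda>s. Gamma s * zfun s", OF C(2) C(1) w] by blast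
  have sub: "{s. ?a \<le> Re s \<and> Re s \<le> ?b} \<subseteq> ?S" using e by auto
  have Pin: "?a < Re p \<and> Re p < ?b \<and> Im p = 0" if "p \<in> ?P" for p using that e ap by auto
  show "\<exists>C. line_decay ?a (mellin_kernel w) C"
    by (rule line_integral_shift(1)[OF ab opS sub _ hol Pin C']) auto
  have "line_integral ?b (mellin_kernel w) = line_integral ?a (mellin_kernel w) + 2 * pi * (\<Sum>p\<in>?P. residue (mellin_kernel w) p)"
    by (rule line_integral_shift(3)[OF ab opS sub _ hol Pin C']) auto
  also have "(\<Sum>p\<in>?P. residue (mellin_kernel w) p) = residue (mellin_kernel w) ?\<alpha> + (\<Sum>p\<in>?N. residue (mellin_kernel w) p)"
    using nN by (intro sum.insert) auto
  also have "(\<Sum>p\<in>?N. residue (mellin_kernel w) p) = (\<Sum>k=0..N. residue (mellin_kernel w) (- of_nat k))"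
    by (rule sum.reindex_cong[of "\<lambda>k. - of_nat k"]) (auto simp: inj_on_def)
  also have "\<dots> = (\<Sum>k=0..N. (-1) ^ k * zfun (- of_nat k) / fact k * w ^ k)"
  proof (intro sum.cong refl)
    fix k assume k: "k \<in> {0..N}"
    have "- of_nat k \<noteq> ?\<alpha>" using ap by (auto simp: complex_eq_iff)
    then have "residue (\<lambda>s. Gamma s * (zfun s * w powr (- s))) (- of_nat k) =
        (-1) ^ k / fact k * (zfun (- of_nat k) * w powr (- (- of_nat k)))"
      by (intro residue_Gamma_mult[of "- {?\<alpha>}"]) (auto intro!: holomorphic_on_mult zfun_holomorphic hol_pow)
    then show "residue (mellin_kernel w) (- of_nat k) = (-1) ^ k * zfun (- of_nat k) / fact k * w ^ k"
      using w0 by (simp add: powr_minus_neg_nat mult_ac)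
  qed
  also have "residue (mellin_kernel w) ?\<alpha> = Gamma (?\<alpha> + 1) * complex_of_real vol * w powr (- ?\<alpha>)"
  proof (rule residue_simple')
    have \<alpha>_ni: "?\<alpha> \<notin> \<int>\<^sub>\<le>\<^sub>0" using ap by (auto elim!: nonpos_Ints_cases simp: complex_eq_iff)
    show "open {s. Re s > 0}" by (rule open_halfspace_Re_gt)
    show "?\<alpha> \<in> {s. Re s > 0}" using ap by simp
    show "mellin_kernel w holomorphic_on {s. Re s > 0} - {?\<alpha>}"
      by (intro holomorphic_on_mult holomorphic_Gamma hol_pow holomorphic_on_subset[OF zfun_holomorphic])
        (auto elim!: nonpos_Ints_cases)
    \<comment> \<open>The kernel multiplied by s - \<alpha>, with the singularity cancelled, so its
      value at \<alpha> is the residue.\<close>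
    let ?h = "\<lambda>s. Gamma s * (complex_of_real (\<alpha> * vol) + Dlim s * (s - ?\<alpha>)) * w powr (- s)"
    have "?h holomorphic_on {s. Re s > 0}"
      by (intro holomorphic_intros hol_pow Dlim_holomorphic holomorphic_Gamma) (auto elim!: nonpos_Ints_cases)
    then have "isCont ?h ?\<alpha>"
      using ap by (intro continuous_on_interior[OF holomorphic_on_imp_continuous_on]) (auto simp: interior_open open_halfspace_Re_gt)
    then have "(?h \<longlongrightarrow> ?h ?\<alpha>) (at ?\<alpha>)" by (simp only: isCont_def)
    moreover have "eventually (\<lambda>s. ?h s = mellin_kernel w s * (s - ?\<alpha>)) (at ?\<alpha>)"
      unfolding eventually_at_filter by (rule always_eventually) (simp add: zfun_def field_simps)
    ultimately have "((\<lambda>s. mellin_kernel w s * (s - ?\<alpha>)) \<longlongrightarrow> ?h ?\<alpha>) (at ?\<alpha>)" by (rule Lim_transform_eventually)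
    moreover have "?h ?\<alpha> = Gamma (?\<alpha> + 1) * complex_of_real vol * w powr (- ?\<alpha>)"
      using Gamma_plus1[OF \<alpha>_ni] by (simp add: mult_ac)
    ultimately show "((\<lambda>s. mellin_kernel w s * (s - ?\<alpha>)) \<longlongrightarrow> Gamma (?\<alpha> + 1) * complex_of_real vol * w powr (- ?\<alpha>)) (at ?\<alpha>)" by (simp only:)
  qed
  finally show "line_integral ?b (mellin_kernel w) = line_integral ?a (mellin_kernel w)
      + 2 * pi * (Gamma (?\<alpha> + 1) * complex_of_real vol * w powr (- ?\<alpha>) + (\<Sum>k=0..N. (-1) ^ k * zfun (- of_nat k) / fact k * w ^ k))" .
qed

lemma zeta_kernel_line:
  assumes e: "0 < e" "e < 1"
  shows "Gamma (Complex (- real N - 1 + e) t) * zeta \<alpha> \<phi> (Complex (- real N - 1 + e) t) * w powr (- Complex (- real N - 1 + e) t)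
    = mellin_kernel w (Complex (- real N - 1 + e) t)"
proof -
  have "Complex (- real N - 1 + e) t \<noteq> complex_of_real \<alpha>" using e trace_pos by (auto simp: complex_eq_iff)
  then show ?thesis by (simp add: zeta_eq_zfun)
qed

text \<open>The lattice point 0 contributes 1, and the residue at s = 0 contributes zeta at 0, which
  is -1; the two cancel.\<close>

lemma theta_expansion:
  assumes w: "Re w > 0" and e: "0 < e" "e < 1"
  shows "theta_term \<phi> (\<i> * w) summable_on int_lattice"
    and "theta \<phi> (\<i> * w) = Gamma (complex_of_real \<alpha> + 1) * complex_of_real vol * w powr (- complex_of_real \<alpha>)
        + (\<Sum>k=1..N. (-1) ^ k * zeta \<alpha> \<phi> (- of_nat k) / fact k * w ^ k)
        + line_integral (- real N - 1 + e) (mellin_kernel w) / (2 * pi)"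
proof -
  let ?a = "- real N - 1 + e"
  let ?main = "Gamma (complex_of_real \<alpha> + 1) * complex_of_real vol * w powr (- complex_of_real \<alpha>)"
  have term_eq: "theta_term \<phi> (\<i> * w) = (\<lambda>x. exp (- (w * complex_of_real (\<phi> x))))"
    by (auto simp: theta_term_def fun_eq_iff mult.assoc[symmetric])
  have "((\<lambda>x. exp (- (w * complex_of_real (\<phi> x)))) has_sum line_integral (\<alpha> + 1) (mellin_kernel w) / (2 * pi)) (int_lattice - {0})"
    by (rule theta_mellin[OF w]) simp
  then have "((\<lambda>x. exp (- (w * complex_of_real (\<phi> x)))) has_sum (exp (- (w * complex_of_real (\<phi> 0))) + line_integral (\<alpha> + 1) (mellin_kernel w) / (2 * pi)))
      (insert 0 (int_lattice - {0}))"
    by (intro has_sum_insert) auto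
  moreover have "insert 0 (int_lattice - {0}) = (int_lattice :: (real^'n) set)" by auto
  ultimately have hs: "(theta_term \<phi> (\<i> * w) has_sum (1 + line_integral (\<alpha> + 1) (mellin_kernel w) / (2 * pi))) int_lattice"
    unfolding term_eq by simp
  then show "theta_term \<phi> (\<i> * w) summable_on int_lattice" unfolding summable_on_def by blast
  have "theta \<phi> (\<i> * w) = 1 + line_integral (\<alpha> + 1) (mellin_kernel w) / (2 * pi)"
    unfolding theta_def by (rule infsumI[OF hs])
  also have "\<dots> = 1 + line_integral ?a (mellin_kernel w) / (2 * pi) + (?main + (\<Sum>k=0..N. (-1) ^ k * zfun (- of_nat k) / fact k * w ^ k))"
    unfolding theta_shift(2)[OF w e, of N] by (simp add: field_simps)
  also have "(\<Sum>k=0..N. (-1) ^ k * zfun (- of_nat k) / fact k * w ^ k) = zfun 0 + (\<Sum>k=1..N. (-1) ^ k * zfun (- of_nat k) / fact k * w ^ k)"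
    by (simp add: sum.atLeast_Suc_atMost)
  also have "(\<Sum>k=1..N. (-1) ^ k * zfun (- of_nat k) / fact k * w ^ k) = (\<Sum>k=1..N. (-1) ^ k * zeta \<alpha> \<phi> (- of_nat k) / fact k * w ^ k)"
  proof (intro sum.cong refl)
    fix k
    have "- of_nat k \<noteq> complex_of_real \<alpha>" using trace_pos by (auto simp: complex_eq_iff)
    then show "(-1) ^ k * zfun (- of_nat k) / fact k * w ^ k = (-1) ^ k * zeta \<alpha> \<phi> (- of_nat k) / fact k * w ^ k"
      by (simp add: zeta_eq_zfun)
  qed
  finally show "theta \<phi> (\<i> * w) = ?main + (\<Sum>k=1..N. (-1) ^ k * zeta \<alpha> \<phi> (- of_nat k) / fact k * w ^ k)
      + line_integral ?a (mellin_kernel w) / (2 * pi)" by (simp add: zfun_0)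
qed

text \<open>All constants are fixed before \<open>w\<close>: the bound for Gamma times zeta on the
  line does not involve \<open>w\<close>, and |arg w| is replaced by pi / 2 - \<delta>, so the
  surplus decay is exp (- \<delta> |t|). Only the power of |w| remains.\<close>

lemma remainder_bound:
  assumes e: "0 < e" "e < 1" and \<delta>: "\<delta> > 0"
  shows "\<exists>C. \<forall>w. Re w > 0 \<longrightarrow> \<bar>Arg w\<bar> \<le> pi / 2 - \<delta> \<longrightarrow>
    norm (line_integral (- real N - 1 + e) (mellin_kernel w)) \<le> C * norm w powr (real N + 1 - e)"
proof -
  let ?a = "- real N - 1 + e"
  obtain C m where C: "C \<ge> 0" "\<And>s. ?a \<le> Re s \<Longrightarrow> Re s \<le> ?a \<Longrightarrow> \<bar>Im s\<bar> \<ge> 1 \<Longrightarrow>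
    norm (Gamma s * zfun s) \<le> C * (1 + \<bar>Im s\<bar>) ^ m * exp (- (pi / 2) * \<bar>Im s\<bar>)" using Gamma_zfun_strip[of ?a ?a] by blast
  have cont: "continuous_on UNIV (\<lambda>t. Gamma (Complex ?a t) * zfun (Complex ?a t))"
  proof (rule continuous_on_line)
    let ?S = "- (\<int>\<^sub>\<le>\<^sub>0 \<union> {complex_of_real \<alpha>})"
    show "continuous_on ?S (\<lambda>s. Gamma s * zfun s)"
      by (intro holomorphic_on_imp_continuous_on holomorphic_on_mult holomorphic_Gamma holomorphic_on_subset[OF zfun_holomorphic]) auto
    fix t
    have "Complex ?a t \<notin> \<int>\<^sub>\<le>\<^sub>0"
    proof
      assume "Complex ?a t \<in> \<int>\<^sub>\<le>\<^sub>0"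
      then obtain n where "Complex ?a t = of_int n" by (elim nonpos_Ints_cases)
      then have "e = of_int (n + int N + 1)" by (simp add: complex_eq_iff)
      with e have "0 < n + int N + 1" "n + int N + 1 < 1" by (simp_all only: of_int_0_less_iff of_int_less_1_iff)
      then show False by simp
    qed
    moreover have "Complex ?a t \<noteq> complex_of_real \<alpha>" using e trace_pos by (auto simp: complex_eq_iff)
    ultimately show "Complex ?a t \<in> ?S" by simp
  qed
  have "bounded ((\<lambda>t. Gamma (Complex ?a t) * zfun (Complex ?a t)) ` {-1..1})"
    by (intro compact_imp_bounded compact_continuous_image continuous_on_subset[OF cont]) auto
  then obtain M where "\<forall>y\<in>(\<lambda>t. Gamma (Complex ?a t) * zfun (Complex ?a t)) ` {-1..1}. norm y \<le> M" unfolding bounded_iff by blast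
  then have M: "\<And>t. t \<in> {-1..1} \<Longrightarrow> norm (Gamma (Complex ?a t) * zfun (Complex ?a t)) \<le> M" by simp
  \<comment> \<open>The factor exp (pi / 2) offsets the decaying exponential for |t| \<le> 1, where
    only the compactness bound \<open>M\<close> is available.\<close>
  define C1 where "C1 = C + \<bar>M\<bar> * exp (pi / 2)"
  have C1: "C1 \<ge> 0" "C \<le> C1" using C(1) by (auto simp: C1_def)
  have line: "norm (Gamma (Complex ?a t) * zfun (Complex ?a t)) \<le> C1 * (1 + \<bar>t\<bar>) ^ m * exp (- (pi / 2) * \<bar>t\<bar>)" for t
  proof (cases "\<bar>t\<bar> \<ge> 1")
    case True
    have "norm (Gamma (Complex ?a t) * zfun (Complex ?a t)) \<le> C * (1 + \<bar>t\<bar>) ^ m * exp (- (pi / 2) * \<bar>t\<bar>)"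
      using C(2)[of "Complex ?a t"] True by simp
    also have "\<dots> \<le> C1 * (1 + \<bar>t\<bar>) ^ m * exp (- (pi / 2) * \<bar>t\<bar>)" using C1 by (intro mult_right_mono) auto
    finally show ?thesis .
  next
    case False
    then have "t \<in> {-1..1}" by auto
    then have "norm (Gamma (Complex ?a t) * zfun (Complex ?a t)) \<le> \<bar>M\<bar> * 1" using M[of t] by simp
    also have "\<dots> \<le> \<bar>M\<bar> * (exp (pi / 2) * exp (- (pi / 2) * \<bar>t\<bar>))"
      unfolding exp_add[symmetric] using False pi_gt_zero mult_left_mono[of "\<bar>t\<bar>" 1 "pi / 2"] by (intro mult_left_mono) auto
    also have "\<dots> \<le> C1 * exp (- (pi / 2) * \<bar>t\<bar>)"
      unfolding mult.assoc[symmetric] using C(1) by (intro mult_right_mono) (auto simp: C1_def)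
    also have "\<dots> \<le> C1 * (1 + \<bar>t\<bar>) ^ m * exp (- (pi / 2) * \<bar>t\<bar>)"
    proof (intro mult_right_mono)
      show "C1 \<le> C1 * (1 + \<bar>t\<bar>) ^ m" using C1(1) mult_left_mono[of 1 "(1 + \<bar>t\<bar>) ^ m" C1] by simp
    qed auto
    finally show ?thesis .
  qed
  obtain E where E: "E \<ge> 0" "\<And>x. x \<ge> 0 \<Longrightarrow> (1 + x) ^ m * exp (- \<delta> * x) \<le> E / (1 + x\<^sup>2)"
    using power_times_exp_bound[OF \<delta>, of m] by blast
  have "norm (line_integral ?a (mellin_kernel w)) \<le> (C1 * E * cauchy_mass) * norm w powr (real N + 1 - e)"
    if w: "Re w > 0" and arg: "\<bar>Arg w\<bar> \<le> pi / 2 - \<delta>" for w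
  proof -
    have w0: "w \<noteq> 0" using w by auto
    let ?W = "norm w powr (real N + 1 - e)"
    obtain C2 where "line_decay ?a (mellin_kernel w) C2" using theta_shift(1)[OF w e] by blast
    then have contw: "continuous_on UNIV (\<lambda>t. mellin_kernel w (Complex ?a t))" by (simp add: line_decay_def)
    have "line_decay ?a (mellin_kernel w) (C1 * ?W * E)"
      unfolding line_decay_def
    proof (intro conjI contw allI)
      fix t
      have "norm (w powr (- Complex ?a t)) \<le> ?W * exp (\<bar>Arg w\<bar> * \<bar>t\<bar>)"
        using norm_powr_minus_le[OF w0, of "Complex ?a t"] by (simp add: add.commute)
      also have "\<dots> \<le> ?W * exp ((pi / 2 - \<delta>) * \<bar>t\<bar>)" using arg by (intro mult_left_mono) (auto intro: mult_right_mono)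
      finally have "norm (mellin_kernel w (Complex ?a t)) \<le> (C1 * (1 + \<bar>t\<bar>) ^ m * exp (- (pi / 2) * \<bar>t\<bar>)) * (?W * exp ((pi / 2 - \<delta>) * \<bar>t\<bar>))"
        unfolding norm_mult[of "Gamma (Complex ?a t) * zfun (Complex ?a t)"] using line[of t] C1 by (intro mult_mono) auto
      also have "\<dots> = C1 * ?W * ((1 + \<bar>t\<bar>) ^ m * (exp (- (pi / 2) * \<bar>t\<bar>) * exp ((pi / 2 - \<delta>) * \<bar>t\<bar>)))"
        by (simp only: mult_ac)
      also have "exp (- (pi / 2) * \<bar>t\<bar>) * exp ((pi / 2 - \<delta>) * \<bar>t\<bar>) = exp (- \<delta> * \<bar>t\<bar>)"
        unfolding exp_add[symmetric] by (simp add: algebra_simps)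
      also have "C1 * ?W * ((1 + \<bar>t\<bar>) ^ m * exp (- \<delta> * \<bar>t\<bar>)) \<le> C1 * ?W * (E / (1 + \<bar>t\<bar>\<^sup>2))"
        using C1 by (intro mult_left_mono E(2)) auto
      finally show "norm (mellin_kernel w (Complex ?a t)) \<le> C1 * ?W * E / (1 + t\<^sup>2)" by simp
    qed
    from line_decay_norm_le[OF this] show ?thesis by (simp add: mult_ac)
  qed
  then show ?thesis by blast
qed

end

lemma (in cutoff_dilation) theta_asymptotics:
  fixes N :: nat
  assumes e: "0 < e" "e < 1"
  shows "(\<forall>w::complex. Re w > 0 \<longrightarrow>
        theta_term \<phi> (\<i> * w) summable_on int_lattice \<and>
        vline_integrable (- real N - 1 + e) (\<lambda>s. Gamma s * zeta \<alpha> \<phi> s * w powr (- s)) \<and>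
        theta \<phi> (\<i> * w) =
          Gamma (complex_of_real \<alpha> + 1) * complex_of_real vol * w powr (- complex_of_real \<alpha>)
          + (\<Sum>k=1..N. (- 1) ^ k * zeta \<alpha> \<phi> (- of_nat k) / fact k * w ^ k)
          + 1 / (2 * complex_of_real pi * \<i>)
            * vline_integral (- real N - 1 + e) (\<lambda>s. Gamma s * zeta \<alpha> \<phi> s * w powr (- s)))
     \<and> (\<forall>\<delta>::real. 0 < \<delta> \<and> \<delta> < pi / 2 \<longrightarrow>
        (\<exists>C>0. \<forall>w::complex. Re w > 0 \<and> \<bar>Arg w\<bar> \<le> pi / 2 - \<delta> \<longrightarrow>
           cmod (vline_integral (- real N - 1 + e) (\<lambda>s. Gamma s * zeta \<alpha> \<phi> s * w powr (- s)))
             \<le> C * cmod w powr (real N + 1 - e)))"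
proof -
  let ?a = "- real N - 1 + e"
  let ?K = "\<lambda>w s. Gamma s * zeta \<alpha> \<phi> s * w powr (- s)"
  have vline: "vline_integrable ?a (?K w)" "vline_integral ?a (?K w) = \<i> * line_integral ?a (mellin_kernel w)"
    if w: "Re w > 0" for w
  proof -
    obtain C where "line_decay ?a (mellin_kernel w) C" using theta_shift(1)[OF w e] by blast
    then have "line_decay ?a (?K w) C" unfolding line_decay_def zeta_kernel_line[OF e] .
    from line_decay_vline[OF this]
    show "vline_integrable ?a (?K w)" "vline_integral ?a (?K w) = \<i> * line_integral ?a (mellin_kernel w)"
      unfolding line_integral_def zeta_kernel_line[OF e] .
  qed
  show ?thesis
  proof (intro conjI allI impI)
    fix w :: complex assume w: "Re w > 0"
    show "theta_term \<phi> (\<i> * w) summable_on int_lattice" by (rule theta_expansion(1)[OF w e])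
    show "vline_integrable ?a (?K w)" by (rule vline(1)[OF w])
    show "theta \<phi> (\<i> * w) =
          Gamma (complex_of_real \<alpha> + 1) * complex_of_real vol * w powr (- complex_of_real \<alpha>)
          + (\<Sum>k=1..N. (- 1) ^ k * zeta \<alpha> \<phi> (- of_nat k) / fact k * w ^ k)
          + 1 / (2 * complex_of_real pi * \<i>) * vline_integral ?a (?K w)"
      unfolding vline(2)[OF w] theta_expansion(2)[OF w e, of N] by simp
  next
    fix \<delta> :: real assume \<delta>: "0 < \<delta> \<and> \<delta> < pi / 2"
    then obtain C where C: "\<And>w. Re w > 0 \<Longrightarrow> \<bar>Arg w\<bar> \<le> pi / 2 - \<delta> \<Longrightarrow>
        norm (line_integral ?a (mellin_kernel w)) \<le> C * norm w powr (real N + 1 - e)"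
      using remainder_bound[OF e, of \<delta> N] by blast
    show "\<exists>C>0. \<forall>w::complex. Re w > 0 \<and> \<bar>Arg w\<bar> \<le> pi / 2 - \<delta> \<longrightarrow>
        cmod (vline_integral ?a (?K w)) \<le> C * cmod w powr (real N + 1 - e)"
    \<comment> \<open>The constant has to be strictly positive, and nothing is known about the sign
      of \<open>C\<close>.\<close>
    proof (intro exI[of _ "\<bar>C\<bar> + 1"] conjI allI impI)
      fix w :: complex assume w: "Re w > 0 \<and> \<bar>Arg w\<bar> \<le> pi / 2 - \<delta>"
      have "cmod (vline_integral ?a (?K w)) = norm (line_integral ?a (mellin_kernel w))"
        using w by (simp add: vline(2) norm_mult)
      also have "\<dots> \<le> C * norm w powr (real N + 1 - e)" using w by (intro C) auto
      also have "\<dots> \<le> (\<bar>C\<bar> + 1) * cmod w powr (real N + 1 - e)" by (intro mult_right_mono) auto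
      finally show "cmod (vline_integral ?a (?K w)) \<le> (\<bar>C\<bar> + 1) * cmod w powr (real N + 1 - e)" .
    qed simp
  qed
qed

theorem theorem1p4:
  fixes A :: "real^'n^'n" and \<phi> :: "real^'n \<Rightarrow> real" and \<alpha> :: real
    and N :: nat and \<epsilon> :: real
  assumes "A \<in> M_plus"
    and "\<alpha> = trace A"
    and "continuous_on UNIV \<phi>"
    and "Cinf_on (UNIV - {0}) \<phi>"
    and "positive_homogeneous A \<phi>"
    and "N > 0"
    and "0 < \<epsilon>" and "\<epsilon> < 1"
  shows
    "(\<forall>w::complex. Re w > 0 \<longrightarrow>
        theta_term \<phi> (\<i> * w) summable_on int_lattice \<and>
        vline_integrable (- real N - 1 + \<epsilon>) (\<lambda>s. Gamma s * zeta \<alpha> \<phi> s * w powr (- s)) \<and>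
        theta \<phi> (\<i> * w) =
          Gamma (complex_of_real \<alpha> + 1) * complex_of_real (measure lebesgue (unit_sublevel \<phi>))
            * w powr (- complex_of_real \<alpha>)
          + (\<Sum>k=1..N. (- 1) ^ k * zeta \<alpha> \<phi> (- of_nat k) / fact k * w ^ k)
          + 1 / (2 * complex_of_real pi * \<i>)
            * vline_integral (- real N - 1 + \<epsilon>) (\<lambda>s. Gamma s * zeta \<alpha> \<phi> s * w powr (- s)))
     \<and> (\<forall>\<delta>::real. 0 < \<delta> \<and> \<delta> < pi / 2 \<longrightarrow>
        (\<exists>c>0. \<forall>w::complex. Re w > 0 \<and> \<bar>Arg w\<bar> \<le> pi / 2 - \<delta> \<longrightarrow>
           cmod (vline_integral (- real N - 1 + \<epsilon>) (\<lambda>s. Gamma s * zeta \<alpha> \<phi> s * w powr (- s)))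
             \<le> c * cmod w powr (real N + 1 - \<epsilon>)))"
proof -
  interpret pos_homogeneous A \<phi> by unfold_locales (rule assms)+
  obtain T q where Tq: "T > 1" "0 < q" "q < 1" "\<And>x. norm (matrix_powr (1 / T) A *v x) \<le> q * norm x"
    using expanding_dilation by blast
  obtain c where c: "\<And>j u. (c j has_real_derivative c (Suc j) u) (at u)"
    "\<And>u. u \<le> 1 \<Longrightarrow> c 0 u = 1" "\<And>u. u \<ge> 2 \<Longrightarrow> c 0 u = 0" "\<And>u. 0 \<le> c 0 u" "\<And>u. c 0 u \<le> 1"
    "\<And>j u. u \<le> 1 \<or> u \<ge> 2 \<Longrightarrow> c (Suc j) u = 0"
    using smooth_cutoff by blast
  \<comment> \<open>The maximum with 1 ensures that powers of \<open>Q\<close> are at least 1, as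
    the counting estimates require.\<close>
  define Q where "Q = max 1 (onorm ((*v) (matrix_powr T A)))"
  have Q: "norm (matrix_powr T A *v x) \<le> Q * norm x" for x
  proof -
    have "norm (matrix_powr T A *v x) \<le> onorm ((*v) (matrix_powr T A)) * norm x"
      by (rule onorm[OF matrix_vector_mul_bounded_linear])
    also have "\<dots> \<le> Q * norm x" by (intro mult_right_mono) (auto simp: Q_def)
    finally show ?thesis .
  qed
  interpret cutoff_dilation A \<phi> T q Q c
  proof unfold_locales
    show "Q \<ge> 1" by (simp add: Q_def)
  qed (rule Tq Q c | assumption)+
  show ?thesis unfolding assms(2) by (rule theta_asymptotics[OF assms(7,8)])
qed

end
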